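(* Let $I\subseteq k[\mathbf{P}^N]$ be a homogeneous ideal (not necessarily saturated) defining a $0$-dimensional subscheme of $\mathbf{P}^N$. If $c$ is a positive real number such that $mc\le\alpha(I^{(m)})$ for all integers $m\ge 1$, then for all positive integers $m,r$ with $m/r\ge\mathrm{reg}(I)/c$ we have $I^{(m)}\subseteq I^r$; in particular, $\rho(I)\le\mathrm{reg}(I)/c$.
   Context: $k$ is an arbitrary algebraically closed field, $N\ge 1$, and $k[\mathbf{P}^N]=k[x_0,\dots,x_N]$ is the polynomial ring with its standard grading. Symbolic powers: for a homogeneous ideal $0\ne I\subsetneq R=k[\mathbf{P}^N]$ and $m\ge 1$, $I^{(m)}$ is the contraction to $R$ of $I^mR_A$, where $R_A$ is the localization of $R$ at the multiplicative system $A$ equal to the complement of the union of the associated primes of $I$. Resurgence: $\rho(I)=\sup\{m/r : m,r\ge 1 \text{ integers},\ I^{(m)}\not\subseteq I^r\}$. $\alpha(J)$, for a nonzero homogeneous ideal $J$, is the least degree $t$ with $J_t\ne 0$. $\mathrm{reg}(I)$ is the Castelnuovo–Mumford regularity: if $0\to F_N\to\cdots\to F_0\to I\to 0$ is a minimal graded free resolution over $R$ with $F_i=\bigoplus_j R[-b_{ij}]$, then $\mathrm{reg}(I)=\max_{i,j}(b_{ij}-i)$. "Defines a $0$-dimensional subscheme" means the closed subscheme of $\mathbf{P}^N$ determined by $I$ is nonempty of dimension $0$. *)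

theory Defs
  imports
    "HOL-Analysis.Analysis"
    "HOL-Library.Poly_Mapping"
    "HOL-Computational_Algebra.Computational_Algebra"
begin

(* The polynomial ring over 'k in variables indexed by 'n.  The coordinate ring of
   projective N-space is the case CARD('n) = N + 1.  The linear order carried by 'n in what
   follows only serves to make this ring an instance of idom. *)
type_synonym ('n, 'k) mpoly = "('n \<Rightarrow>\<^sub>0 nat) \<Rightarrow>\<^sub>0 'k"

subsection \<open>Ideals\<close>

(* Ideals of a commutative ring are its submodules: ideal.subspace is "is an ideal",
   ideal.span is "the ideal generated by". *)
interpretation ideal: module "(*) :: 'a::comm_ring_1 \<Rightarrow> 'a \<Rightarrow> 'a"
  by unfold_locales (simp_all add: algebra_simps)

definition ideal_mult :: "'a::comm_ring_1 set \<Rightarrow> 'a set \<Rightarrow> 'a set" where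
  "ideal_mult I J = ideal.span {a * b | a b. a \<in> I \<and> b \<in> J}"

primrec ideal_power :: "'a::comm_ring_1 set \<Rightarrow> nat \<Rightarrow> 'a set" where
  "ideal_power I 0 = UNIV"
| "ideal_power I (Suc r) = ideal_mult I (ideal_power I r)"

definition prime_ideal :: "'a::comm_ring_1 set \<Rightarrow> bool" where
  "prime_ideal P \<longleftrightarrow>
     ideal.subspace P \<and> P \<noteq> UNIV \<and> (\<forall>a b. a * b \<in> P \<longrightarrow> a \<in> P \<or> b \<in> P)"

definition associated_primes :: "'a::comm_ring_1 set \<Rightarrow> 'a set set" where
  "associated_primes I = {P. prime_ideal P \<and> (\<exists>f. P = {g. g * f \<in> I})}"

subsection \<open>Symbolic powers\<close>

(* The localization of a domain at A, realised inside the fraction field; this presupposes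
   that 0 is not in A. *)
definition localization :: "'a::idom set \<Rightarrow> 'a fract set" where
  "localization A = {Fract a s | a s. s \<in> A}"

definition extended_ideal :: "'a::idom set \<Rightarrow> 'a set \<Rightarrow> 'a fract set" where
  "extended_ideal A J =
     {\<Sum>g\<in>G. x g * to_fract g | G x. finite G \<and> G \<subseteq> J \<and> (\<forall>g\<in>G. x g \<in> localization A)}"

(* For a proper ideal I of a Noetherian domain there is an associated prime, so that the
   multiplicative system used here does not contain 0. *)
definition symbolic_power :: "'a::idom set \<Rightarrow> nat \<Rightarrow> 'a set" where
  "symbolic_power I m =
     {f. to_fract f \<in> extended_ideal (- \<Union>(associated_primes I)) (ideal_power I m)}"

(* Extended-real valued: finiteness of the supremum is not presupposed. *)
definition resurgence :: "'a::idom set \<Rightarrow> ereal" where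
  "resurgence I =
     Sup {ereal (real m / real r) | m r.
            m \<ge> 1 \<and> r \<ge> 1 \<and> \<not> symbolic_power I m \<subseteq> ideal_power I r}"

subsection \<open>The standard grading\<close>

definition monom_degree :: "('n \<Rightarrow>\<^sub>0 nat) \<Rightarrow> nat" where
  "monom_degree u = (\<Sum>i\<in>Poly_Mapping.keys u. Poly_Mapping.lookup u i)"

(* 0 is homogeneous of every degree, and is the only element of negative degree. *)
definition homogeneous :: "int \<Rightarrow> ('n, 'k::zero) mpoly \<Rightarrow> bool" where
  "homogeneous d f \<longleftrightarrow> (\<forall>u\<in>Poly_Mapping.keys f. int (monom_degree u) = d)"

definition homogeneous_ideal :: "('n, 'k::comm_ring_1) mpoly set \<Rightarrow> bool" where
  "homogeneous_ideal I \<longleftrightarrow>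
     ideal.subspace I \<and> I = ideal.span {f \<in> I. \<exists>d. homogeneous d f}"

definition irrelevant_ideal :: "('n, 'k::comm_ring_1) mpoly set" where
  "irrelevant_ideal =
     ideal.span (range (\<lambda>i. Poly_Mapping.single (Poly_Mapping.single i 1) 1))"

definition alpha :: "('n, 'k::zero) mpoly set \<Rightarrow> nat" where
  "alpha J = (LEAST t. \<exists>f\<in>J. f \<noteq> 0 \<and> homogeneous (int t) f)"

subsection \<open>Castelnuovo-Mumford regularity\<close>

(* The free module of rank n, as the vectors supported on {..<n}. *)
definition free_mod :: "nat \<Rightarrow> (nat \<Rightarrow> 'a::comm_ring_1) set" where
  "free_mod n = {v. \<forall>j\<ge>n. v j = 0}"

(* The homomorphism from rank p to rank q sending the j-th basis vector to the j-th row of M. *)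
definition free_hom ::
    "nat \<Rightarrow> nat \<Rightarrow> (nat \<Rightarrow> nat \<Rightarrow> 'a::comm_ring_1) \<Rightarrow> (nat \<Rightarrow> 'a) \<Rightarrow> (nat \<Rightarrow> 'a)" where
  "free_hom p q M v = (\<lambda>l. if l < q then \<Sum>j<p. v j * M j l else 0)"

(* A minimal graded free resolution 0 -> F_N -> ... -> F_0 -> I -> 0 with N + 1 = CARD('n):
   F_i is the direct sum of the R[- b i j] for j < n i, the augmentation F_0 -> I sends the
   j-th basis vector to g j, and D i is the matrix of the differential F_(i+1) -> F_i.
   Since R[- b] is generated in degree b, a map R[- b] -> R[- b'] of degree 0 is
   multiplication by a form of degree b - b'.  Minimality says that each differential maps
   into the irrelevant ideal times its target.  As F_i = 0 for i > N, exactness at F_N is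
   injectivity of F_N -> F_(N-1). *)
definition minimal_graded_free_resolution ::
    "('n::finite, 'k::comm_ring_1) mpoly set \<Rightarrow> (nat \<Rightarrow> nat) \<Rightarrow> (nat \<Rightarrow> nat \<Rightarrow> int) \<Rightarrow>
     (nat \<Rightarrow> ('n, 'k) mpoly) \<Rightarrow> (nat \<Rightarrow> nat \<Rightarrow> nat \<Rightarrow> ('n, 'k) mpoly) \<Rightarrow> bool" where
  "minimal_graded_free_resolution I n b g D \<longleftrightarrow>
     (\<forall>i\<ge>CARD('n). n i = 0) \<and>
     (\<forall>j<n 0. homogeneous (b 0 j) (g j)) \<and>
     (\<forall>i. \<forall>j<n (Suc i). \<forall>l<n i. homogeneous (b (Suc i) j - b i l) (D i j l)) \<and>
     (\<lambda>v. \<Sum>j<n 0. v j * g j) ` free_mod (n 0) = I \<and>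
     {v \<in> free_mod (n 0). (\<Sum>j<n 0. v j * g j) = 0} =
       free_hom (n 1) (n 0) (D 0) ` free_mod (n 1) \<and>
     (\<forall>i. {v \<in> free_mod (n (Suc i)). free_hom (n (Suc i)) (n i) (D i) v = (\<lambda>_. 0)} =
       free_hom (n (Suc (Suc i))) (n (Suc i)) (D (Suc i)) ` free_mod (n (Suc (Suc i)))) \<and>
     (\<forall>i. \<forall>v\<in>free_mod (n (Suc i)). \<forall>l.
       free_hom (n (Suc i)) (n i) (D i) v l \<in> irrelevant_ideal)"

(* Minimal graded free resolutions of a nonzero homogeneous ideal over a field exist by
   Hilbert's syzygy theorem and share the same shifts, so the choice is immaterial. *)
definition regularity :: "('n::finite, 'k::comm_ring_1) mpoly set \<Rightarrow> int" where
  "regularity I =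
     (SOME \<rho>. \<exists>n b g D. minimal_graded_free_resolution I n b g D \<and>
        \<rho> = Max {b i j - int i | i j. i < CARD('n) \<and> j < n i})"

subsection \<open>Projective space and its closed subschemes\<close>

definition proj_points :: "('n, 'k::comm_ring_1) mpoly set set" where
  "proj_points = {P. prime_ideal P \<and> homogeneous_ideal P \<and> \<not> irrelevant_ideal \<subseteq> P}"

definition proj_topology :: "('n, 'k::comm_ring_1) mpoly set topology" where
  "proj_topology =
     topology (\<lambda>U. \<exists>J. homogeneous_ideal J \<and> U = {P \<in> proj_points. \<not> J \<subseteq> P})"

lemma span_subset_iff:
  assumes "ideal.subspace P"
  shows "ideal.span S \<subseteq> P \<longleftrightarrow> S \<subseteq> P"
  using assms ideal.span_minimal ideal.span_superset by blast

lemma homogeneous_ideal_span: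
  assumes "\<And>f. f \<in> S \<Longrightarrow> \<exists>d. homogeneous d f"
  shows "homogeneous_ideal (ideal.span S)"
proof -
  have "S \<subseteq> {f \<in> ideal.span S. \<exists>d. homogeneous d f}"
    using assms ideal.span_superset by blast
  moreover have "{f \<in> ideal.span S. \<exists>d. homogeneous d f} \<subseteq> ideal.span S"
    by blast
  ultimately show ?thesis
    unfolding homogeneous_ideal_def
    by (metis (no_types, lifting) ideal.span_mono ideal.span_span ideal.subspace_span subset_antisym)
qed

lemma homogeneous_mult:
  assumes "homogeneous d f" "homogeneous e (g :: ('n, 'k::comm_ring_1) mpoly)"
  shows "homogeneous (d + e) (f * g)"
  unfolding homogeneous_def
proof
  fix w assume "w \<in> Poly_Mapping.keys (f * g)"
  then obtain u v where w: "w = u + v" "u \<in> Poly_Mapping.keys f" "v \<in> Poly_Mapping.keys g"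
    using keys_mult[of f g] by auto
  have eq: "monom_degree x = (\<Sum>i\<in>Poly_Mapping.keys u \<union> Poly_Mapping.keys v. Poly_Mapping.lookup x i)"
    if "Poly_Mapping.keys x \<subseteq> Poly_Mapping.keys u \<union> Poly_Mapping.keys v" for x
    unfolding monom_degree_def
    by (rule sum.mono_neutral_left) (use that in \<open>auto simp: in_keys_iff\<close>)
  have "monom_degree (u + v) = monom_degree u + monom_degree v"
    using Poly_Mapping.keys_add[of u v] by (simp add: eq lookup_add sum.distrib)
  then show "int (monom_degree w) = d + e"
    using assms w by (auto simp: homogeneous_def)
qed

lemma openin_proj_topology:
  "openin proj_topology U \<longleftrightarrow>
     (\<exists>J. homogeneous_ideal (J :: ('n, 'k::comm_ring_1) mpoly set) \<and>
          U = {P \<in> proj_points. \<not> J \<subseteq> P})"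
proof -
  let ?H = "\<lambda>J :: ('n, 'k) mpoly set. {f \<in> J. \<exists>d. homogeneous d f}"
  let ?D = "\<lambda>S. {P \<in> proj_points. \<not> S \<subseteq> P}"
  let ?O = "\<lambda>U. \<exists>J :: ('n, 'k) mpoly set. homogeneous_ideal J \<and> U = ?D J"
  have D_span: "?D (ideal.span S) = ?D S" for S :: "('n, 'k) mpoly set"
    using span_subset_iff by (auto simp: proj_points_def prime_ideal_def)
  have D_H: "?D J = ?D (?H J)" if "homogeneous_ideal J" for J
    using that D_span[of "?H J"] by (simp add: homogeneous_ideal_def)
  have I: "?O (?D S)" if "\<And>f. f \<in> S \<Longrightarrow> \<exists>d. homogeneous d f" for S
    using homogeneous_ideal_span[of S] that D_span[of S] by blast
  have "istopology ?O"
    unfolding istopology_def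
  proof (intro conjI allI impI)
    fix U V assume "?O U" "?O V"
    then obtain J K where J: "homogeneous_ideal J" "U = ?D J" and K: "homogeneous_ideal K" "V = ?D K"
      by blast
    let ?S = "{a * b | a b. a \<in> ?H J \<and> b \<in> ?H K}"
    have mem: "a * b \<in> P \<longleftrightarrow> a \<in> P \<or> b \<in> P" if "P \<in> proj_points" for a b P
      using that ideal.subspace_scale[of P a b] ideal.subspace_scale[of P b a]
      by (auto simp: proj_points_def prime_ideal_def mult.commute)
    have "U \<inter> V = ?D (?H J) \<inter> ?D (?H K)"
      using D_H J K by blast
    also have "\<dots> = ?D ?S"
    proof (rule set_eqI)
      fix P
      show "P \<in> ?D (?H J) \<inter> ?D (?H K) \<longleftrightarrow> P \<in> ?D ?S"
      proof (cases "P \<in> proj_points")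
        case True
        have "\<not> ?S \<subseteq> P \<longleftrightarrow> (\<exists>a\<in>?H J. \<exists>b\<in>?H K. a * b \<notin> P)"
          by blast
        then show ?thesis
          using True mem[OF True] by blast
      qed blast
    qed
    finally have UV: "U \<inter> V = ?D ?S" .
    have "\<exists>d. homogeneous d f" if "f \<in> ?S" for f
      using that homogeneous_mult by blast
    from I[OF this] show "?O (U \<inter> V)"
      unfolding UV .
  next
    fix \<U> assume "\<forall>U\<in>\<U>. ?O U"
    from bchoice[OF this] obtain J
      where J': "\<forall>U\<in>\<U>. homogeneous_ideal (J U) \<and> U = ?D (J U)" ..
    have J: "U = ?D (?H (J U))" if "U \<in> \<U>" for U
    proof -
      have *: "homogeneous_ideal (J U)" "U = ?D (J U)"
        using conjunct1[OF bspec[OF J' that]] conjunct2[OF bspec[OF J' that]] .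
      from *(2) D_H[OF *(1)] show ?thesis
        by (rule trans)
    qed
    have "\<Union>\<U> = (\<Union>U\<in>\<U>. U)"
      by simp
    also have "\<dots> = (\<Union>U\<in>\<U>. ?D (?H (J U)))"
      by (rule SUP_cong[OF refl J])
    also have "\<dots> = ?D (\<Union>U\<in>\<U>. ?H (J U))"
      by blast
    finally have UU: "\<Union>\<U> = ?D (\<Union>U\<in>\<U>. ?H (J U))" .
    have "\<exists>d. homogeneous d f" if "f \<in> (\<Union>U\<in>\<U>. ?H (J U))" for f
      using that by blast
    from I[OF this] show "?O (\<Union>\<U>)"
      unfolding UU .
  qed
  then show ?thesis
    by (simp add: proj_topology_def)
qed

(* The underlying space of the closed subscheme determined by I. *)
definition subscheme_space :: "('n, 'k::comm_ring_1) mpoly set \<Rightarrow> ('n, 'k) mpoly set topology" where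
  "subscheme_space I = subtopology proj_topology {P. I \<subseteq> P}"

definition irreducible_closed :: "'a topology \<Rightarrow> 'a set \<Rightarrow> bool" where
  "irreducible_closed X C \<longleftrightarrow>
     closedin X C \<and> C \<noteq> {} \<and>
     (\<forall>A B. closedin X A \<and> closedin X B \<and> C = A \<union> B \<longrightarrow> C = A \<or> C = B)"

definition krull_dim :: "'a topology \<Rightarrow> enat" where
  "krull_dim X =
     Sup {enat n | n. \<exists>C. (\<forall>i\<le>n. irreducible_closed X (C i)) \<and> (\<forall>i<n. C i \<subset> C (Suc i))}"

(* Nonemptiness is stated separately: Sup {} = 0 makes the empty space 0-dimensional. *)
definition defines_zero_dim_subscheme :: "('n, 'k::comm_ring_1) mpoly set \<Rightarrow> bool" where
  "defines_zero_dim_subscheme I \<longleftrightarrow>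
     topspace (subscheme_space I) \<noteq> {} \<and> krull_dim (subscheme_space I) = 0"

end

theory Submission
  imports Defs "HOL-Library.Function_Algebras"
begin

text \<open>
  Since the subscheme is \<open>0\<close>-dimensional, there is a linear form \<open>l\<close> that avoids all of its points, and
  \<open>I + (l)\<close> contains all forms of large degree.  Modulo \<open>l\<close> and the complementary variables the
  minimal resolution keeps its shifts, and going back one variable at a time shows that in degrees
  \<open>t \<ge> reg I\<close> multiplication by \<open>l\<close> is injective on \<open>R/I\<close> and \<open>I + (l)\<close> is everything.  These two
  properties are additive in products: \<open>l\<close> is injective on \<open>R/I^r\<close> in degrees \<open>t \<ge> r reg I\<close>.

  If the irrelevant ideal is associated to \<open>I\<close>, then \<open>I^(m) = I^m\<close>, and \<open>m \<ge> r\<close> because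
  \<open>c \<le> \<alpha>(I) \<le> reg I\<close>.  Otherwise \<open>I^(m)\<close> consists of the \<open>f\<close> with \<open>l^e f \<in> I^m\<close> for some \<open>e\<close>; its homogeneous
  elements have degree at least \<open>m c \<ge> r reg I\<close>, so that \<open>l^e\<close> can be cancelled modulo \<open>I^r\<close>.
\<close>

(* At multiplication this rule is associativity from right to left; it loops with algebra_simps. *)
declare ideal.scale_scale [simp del]

subsection \<open>Homogeneous components\<close>

text \<open>The obstacle in products is the injectivity of l modulo I J: if l f lies in I J, a
  representation of l f as a sum of products need not show a factor l anywhere. The remedy is a
  k-linear map, given by \<theta> on the monomials of degree \<rho> + d + 1, that reproduces the
  elements of I J modulo l I J and sends multiples of l into l I J. Then l f lies in l I J, and l is
  cancelled in the domain R. Since I need not be saturated, l may be a zero divisor modulo I in low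
  degrees. Hence every cancellation carries a degree bound, and the case distinction on the
  irrelevant ideal decides whether l may serve as a denominator in the symbolic power. If it may, an
  arbitrary denominator s is replaced by a power of l: R/I is finite over k[l], so s and l satisfy a
  polynomial relation modulo I. The gain is that powers of l are homogeneous, so the components of
  an element of I^(m) stay in I^(m), where \<open>alpha\<close> bounds their degree from
  below.\<close>

abbreviation "lookup \<equiv> Poly_Mapping.lookup"
abbreviation "single \<equiv> Poly_Mapping.single"
abbreviation "keys \<equiv> Poly_Mapping.keys"

definition var :: "'n \<Rightarrow> ('n, 'k::comm_ring_1) mpoly" where
  "var i = single (single i 1) 1"

lemma irrelevant_ideal_span_var: "irrelevant_ideal = ideal.span (range var)"
  by (simp add: irrelevant_ideal_def var_def [abs_def])

abbreviation const :: "'k::zero \<Rightarrow> ('n, 'k) mpoly" where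
  "const c \<equiv> single 0 c"

abbreviation monom :: "('n \<Rightarrow>\<^sub>0 nat) \<Rightarrow> ('n, 'k::comm_ring_1) mpoly" where
  "monom u \<equiv> single u 1"

lemma monom_degree_eq_sum:
  "monom_degree (u :: 'n::finite \<Rightarrow>\<^sub>0 nat) = (\<Sum>i\<in>UNIV. lookup u i)"
  unfolding monom_degree_def by (rule sum.mono_neutral_left) (auto simp: in_keys_iff)

lemma monom_degree_add [simp]:
  "monom_degree (u + v :: 'n::finite \<Rightarrow>\<^sub>0 nat) = monom_degree u + monom_degree v"
  by (simp add: monom_degree_eq_sum lookup_add sum.distrib)

lemma monom_degree_zero [simp]: "monom_degree 0 = 0"
  by (simp add: monom_degree_def)

lemma monom_degree_single [simp]: "monom_degree (single i k) = k"
  by (simp add: monom_degree_def)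

lemma monom_degree_eq_0_iff [simp]: "monom_degree (u :: 'n::finite \<Rightarrow>\<^sub>0 nat) = 0 \<longleftrightarrow> u = 0"
  by (auto simp: monom_degree_eq_sum poly_mapping_eq_iff fun_eq_iff)

text \<open>Keeping only some terms is the common core of the degree components \<open>hcomp\<close>
  and of the substitution \<open>kill\<close>; both get their additivity from here.\<close>

lift_definition restrict_keys :: "('a \<Rightarrow> bool) \<Rightarrow> ('a \<Rightarrow>\<^sub>0 'b::zero) \<Rightarrow> ('a \<Rightarrow>\<^sub>0 'b)"
  is "\<lambda>P f a. f a when P a"
proof -
  fix P :: "'a \<Rightarrow> bool" and f :: "'a \<Rightarrow> 'b"
  assume "finite {a. f a \<noteq> 0}"
  then show "finite {a. (f a when P a) \<noteq> 0}" by (rule rev_finite_subset) auto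
qed

lemma lookup_restrict_keys:
  "lookup (restrict_keys P f) a = (lookup f a when P a)"
  by transfer simp

lemma keys_restrict_keys: "keys (restrict_keys P f) = {a \<in> keys f. P a}"
  by (auto simp: in_keys_iff lookup_restrict_keys)

lemma restrict_keys_zero [simp]: "restrict_keys P 0 = 0"
  by (rule poly_mapping_eqI) (simp add: lookup_restrict_keys)

lemma restrict_keys_add:
  "restrict_keys P (f + g) = restrict_keys P f + restrict_keys P (g :: _ \<Rightarrow>\<^sub>0 _::comm_monoid_add)"
  by (rule poly_mapping_eqI) (simp add: lookup_restrict_keys lookup_add when_add_distrib)

lemma restrict_keys_diff:
  "restrict_keys P (f - g) = restrict_keys P f - restrict_keys P (g :: _ \<Rightarrow>\<^sub>0 _::ab_group_add)"
  by (rule poly_mapping_eqI) (simp add: lookup_restrict_keys lookup_minus when_diff_distrib)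

lemma restrict_keys_sum:
  "restrict_keys P (sum f A) = (\<Sum>a\<in>A. restrict_keys P (f a :: _ \<Rightarrow>\<^sub>0 _::comm_monoid_add))"
  by (induction A rule: infinite_finite_induct) (simp_all add: restrict_keys_add)

lemma restrict_keys_id: "(\<And>a. a \<in> keys f \<Longrightarrow> P a) \<Longrightarrow> restrict_keys P f = f"
  by (rule poly_mapping_eqI) (auto simp: lookup_restrict_keys when_def in_keys_iff)

lemma restrict_keys_none: "(\<And>a. a \<in> keys f \<Longrightarrow> \<not> P a) \<Longrightarrow> restrict_keys P f = 0"
  by (rule poly_mapping_eqI) (auto simp: lookup_restrict_keys when_def in_keys_iff)

definition hcomp :: "int \<Rightarrow> ('n, 'k::zero) mpoly \<Rightarrow> ('n, 'k) mpoly" where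
  "hcomp d f = restrict_keys (\<lambda>u. int (monom_degree u) = d) f"

definition degrees :: "('n, 'k::zero) mpoly \<Rightarrow> int set" where
  "degrees f = (\<lambda>u. int (monom_degree u)) ` keys f"

lemma finite_degrees [simp]: "finite (degrees f)"
  by (simp add: degrees_def)

lemma hcomp_zero [simp]: "hcomp d 0 = 0"
  by (simp add: hcomp_def)

lemma hcomp_add: "hcomp d (f + g) = hcomp d f + hcomp d (g :: ('n, 'k::comm_ring_1) mpoly)"
  by (simp add: hcomp_def restrict_keys_add)

lemma hcomp_diff: "hcomp d (f - g) = hcomp d f - hcomp d (g :: ('n, 'k::comm_ring_1) mpoly)"
  by (simp add: hcomp_def restrict_keys_diff)

lemma hcomp_sum: "hcomp d (sum f A) = (\<Sum>a\<in>A. hcomp d (f a :: ('n, 'k::comm_ring_1) mpoly))"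
  by (simp add: hcomp_def restrict_keys_sum)

lemma homogeneous_hcomp [simp]: "homogeneous d (hcomp d f)"
  by (simp add: homogeneous_def hcomp_def keys_restrict_keys)

lemma homogeneous_zero [simp]: "homogeneous d 0"
  by (simp add: homogeneous_def)

lemma homogeneous_add:
  "homogeneous d f \<Longrightarrow> homogeneous d g \<Longrightarrow> homogeneous d (f + g :: ('n, 'k::comm_ring_1) mpoly)"
  using Poly_Mapping.keys_add[of f g] by (auto simp: homogeneous_def)

lemma homogeneous_uminus:
  "homogeneous d f \<Longrightarrow> homogeneous d (- f :: ('n, 'k::comm_ring_1) mpoly)"
  by (auto simp: homogeneous_def in_keys_iff)

lemma homogeneous_diff:
  "homogeneous d f \<Longrightarrow> homogeneous d g \<Longrightarrow> homogeneous d (f - g :: ('n, 'k::comm_ring_1) mpoly)"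
  using homogeneous_add[of d f "- g"] homogeneous_uminus[of d g] by simp

lemma homogeneous_sum:
  "(\<And>a. a \<in> A \<Longrightarrow> homogeneous d (f a)) \<Longrightarrow> homogeneous d (sum f A :: ('n, 'k::comm_ring_1) mpoly)"
  by (induction A rule: infinite_finite_induct) (simp_all add: homogeneous_add)

lemma homogeneous_single: "int (monom_degree u) = d \<Longrightarrow> homogeneous d (single u c)"
  by (simp add: homogeneous_def)

lemma homogeneous_const: "homogeneous 0 (const c)"
  by (simp add: homogeneous_single)

lemma homogeneous_one: "homogeneous 0 (1 :: ('n, 'k::comm_ring_1) mpoly)"
  by (simp add: homogeneous_def)

lemma homogeneous_var: "homogeneous 1 (var i)"
  by (simp add: var_def homogeneous_single)

lemma homogeneous_const_mult:
  "homogeneous d f \<Longrightarrow> homogeneous d (const c * (f :: ('n, 'k::comm_ring_1) mpoly))"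
  using homogeneous_mult[OF homogeneous_const, of d f c] by simp

lemma homogeneous_power:
  "homogeneous d f \<Longrightarrow> homogeneous (int e * d) (f ^ e :: ('n, 'k::comm_ring_1) mpoly)"
proof (induction e)
  case 0
  show ?case by (simp add: homogeneous_one)
next
  case (Suc e)
  then show ?case using homogeneous_mult[of d f "int e * d" "f ^ e"] by (simp add: algebra_simps)
qed

lemma homogeneous_neg: "homogeneous d f \<Longrightarrow> d < 0 \<Longrightarrow> f = 0"
  by (rule poly_mapping_eqI) (fastforce simp: homogeneous_def in_keys_iff)

lemma hcomp_homogeneous:
  "homogeneous e f \<Longrightarrow> hcomp d f = (if d = e then f else 0)"
  by (auto simp: hcomp_def homogeneous_def intro!: restrict_keys_id restrict_keys_none)

lemma hcomp_eq_0: "d \<notin> degrees f \<Longrightarrow> hcomp d f = 0"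
  by (auto simp: hcomp_def degrees_def intro!: restrict_keys_none)

lemma sum_hcomp:
  fixes f :: "('n, 'k::comm_ring_1) mpoly"
  assumes "finite D" "degrees f \<subseteq> D"
  shows "(\<Sum>d\<in>D. hcomp d f) = f"
proof (rule poly_mapping_eqI)
  fix u
  have "lookup (\<Sum>d\<in>D. hcomp d f) u =
      (\<Sum>d\<in>D. if int (monom_degree u) = d then lookup f u else 0)"
    by (simp add: lookup_sum hcomp_def lookup_restrict_keys when_def)
  also have "\<dots> = lookup f u"
    using assms by (auto simp: degrees_def in_keys_iff image_subset_iff)
  finally show "lookup (\<Sum>d\<in>D. hcomp d f) u = lookup f u" .
qed

lemma hcomp_mult_left:
  fixes f g :: "('n, 'k::comm_ring_1) mpoly"
  assumes "homogeneous e f"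
  shows "hcomp d (f * g) = f * hcomp (d - e) g"
proof -
  have "hcomp d (f * g) = hcomp d (\<Sum>a\<in>degrees g. f * hcomp a g)"
    by (simp add: sum_hcomp flip: sum_distrib_left)
  also have "\<dots> = (\<Sum>a\<in>degrees g. if a = d - e then f * hcomp a g else 0)"
    unfolding hcomp_sum
    by (rule sum.cong)
      (auto simp: hcomp_homogeneous[OF homogeneous_mult[OF assms homogeneous_hcomp]])
  also have "\<dots> = f * hcomp (d - e) g"
    by (auto simp: hcomp_eq_0)
  finally show ?thesis .
qed

lemma hcomp_mult:
  fixes f g :: "('n, 'k::comm_ring_1) mpoly"
  shows "hcomp d (f * g) = (\<Sum>e\<in>degrees f. hcomp e f * hcomp (d - e) g)"
proof -
  have "hcomp d (f * g) = hcomp d ((\<Sum>e\<in>degrees f. hcomp e f) * g)"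
    by (simp add: sum_hcomp)
  also have "\<dots> = (\<Sum>e\<in>degrees f. hcomp e f * hcomp (d - e) g)"
    by (simp add: sum_distrib_right hcomp_sum hcomp_mult_left[OF homogeneous_hcomp])
  finally show ?thesis .
qed

lemma sum_single: "(\<Sum>u\<in>keys f. single u (lookup f u)) = f"
  for f :: "'a \<Rightarrow>\<^sub>0 'b::comm_monoid_add"
proof (rule poly_mapping_eqI)
  fix u
  have "lookup (\<Sum>u\<in>keys f. single u (lookup f u)) u =
      (\<Sum>v\<in>keys f. if u = v then lookup f u else 0)"
    by (auto simp: lookup_sum lookup_single when_def intro!: sum.cong)
  also have "\<dots> = lookup f u"
    by (auto simp: in_keys_iff)
  finally show "lookup (\<Sum>u\<in>keys f. single u (lookup f u)) u
    = lookup f u" .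
qed

lemma sum_monom:
  "(\<Sum>u\<in>keys f. const (lookup f u) * monom u) = (f :: ('n, 'k::comm_ring_1) mpoly)"
  using sum_single[of f] by (simp add: mult_single)

text \<open>A form is the sum of its terms, all of one degree. Constants are kept apart from
  monomials so that maps linear over k can be checked on monomials.\<close>

lemma mpoly_homogeneous_induct [consumes 1, case_names zero add monom]:
  fixes f :: "('n, 'k::comm_ring_1) mpoly"
  assumes "homogeneous d f"
    and "P 0" "\<And>f g. P f \<Longrightarrow> P g \<Longrightarrow> P (f + g)"
    and "\<And>u c. int (monom_degree u) = d \<Longrightarrow> P (const c * monom u)"
  shows "P f"
proof -
  have "P (\<Sum>u\<in>A. const (lookup f u) * monom u)"
    if "finite A" "A \<subseteq> keys f" for A
    using that
  proof (induction A)
    case empty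
    then show ?case using assms(2) by simp
  next
    case (insert u A)
    have "P (const (lookup f u) * monom u)"
      using insert.prems assms(1) by (intro assms(4)) (auto simp: homogeneous_def)
    with insert show ?case by (simp add: assms(3))
  qed
  from this[of "keys f"] show ?thesis
    by (simp only: sum_monom finite_keys order_refl)
qed

lemma var_mult_monom: "var i * monom u = monom (single i 1 + u)"
  by (simp add: var_def mult_single)

lemma const_mult_const: "const a * const b = (const (a * b) :: ('n, 'k::comm_ring_1) mpoly)"
  by (simp add: mult_single)

lemma homogeneous_zero_const:
  fixes f :: "('n::finite, 'k::comm_ring_1) mpoly"
  assumes "homogeneous 0 f"
  shows "f = const (lookup f 0)"
proof (rule poly_mapping_eqI)
  fix u
  show "lookup f u = lookup (const (lookup f 0)) u"
  proof (cases "u = 0")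
    case False
    then have "u \<notin> keys f"
      using assms by (auto simp: homogeneous_def)
    with False show ?thesis by (simp add: lookup_single in_keys_iff when_def)
  qed simp
qed

text \<open>Evaluation at the origin is multiplicative: degrees are nonnegative and add up to 0 only
  as 0 + 0.\<close>

lemma lookup_mult_zero:
  fixes f g :: "('n::finite, 'k::comm_ring_1) mpoly"
  shows "lookup (f * g) 0 = lookup f 0 * lookup g 0"
proof -
  have h0: "hcomp 0 p = const (lookup p 0)" for p :: "('n, 'k) mpoly"
    using homogeneous_zero_const[OF homogeneous_hcomp[of 0 p]]
    by (simp add: hcomp_def lookup_restrict_keys)
  have "hcomp 0 (f * g) = (\<Sum>e\<in>degrees f. if e = 0 then hcomp 0 f * hcomp 0 g else 0)"
    unfolding hcomp_mult
  proof (rule sum.cong)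
    fix e assume "e \<in> degrees f"
    then have "e \<ge> 0" by (auto simp: degrees_def)
    then show "hcomp e f * hcomp (0 - e) g = (if e = 0 then hcomp 0 f * hcomp 0 g else 0)"
      using homogeneous_neg[OF homogeneous_hcomp, of "- e" g] by auto
  qed simp
  also have "\<dots> = hcomp 0 f * hcomp 0 g"
    by (auto simp: hcomp_eq_0)
  finally have "const (lookup (f * g) 0) =
      (const (lookup f 0 * lookup g 0) :: ('n, 'k) mpoly)"
    by (simp add: h0 const_mult_const)
  then show ?thesis by (metis lookup_single_eq)
qed

lemma hcomp_0: "hcomp 0 p = const (lookup p 0)" for p :: "('n::finite, 'k::comm_ring_1) mpoly"
  using homogeneous_zero_const[OF homogeneous_hcomp[of 0 p]]
  by (simp add: hcomp_def lookup_restrict_keys)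

lemma lookup_homogeneous_zero:
  "homogeneous d f \<Longrightarrow> d \<noteq> 0 \<Longrightarrow> lookup f 0 = 0"
  by (metis homogeneous_def in_keys_iff monom_degree_zero of_nat_0)

subsection \<open>Homogeneous ideals\<close>

lemma homogeneous_ideal_iff:
  fixes I :: "('n, 'k::comm_ring_1) mpoly set"
  shows "homogeneous_ideal I \<longleftrightarrow> ideal.subspace I \<and> (\<forall>f\<in>I. \<forall>d. hcomp d f \<in> I)"
proof
  assume I: "homogeneous_ideal I"
  then have sub: "ideal.subspace I" and eq: "I = ideal.span {f \<in> I. \<exists>d. homogeneous d f}"
    by (auto simp: homogeneous_ideal_def)
  have "hcomp d f \<in> I" if "f \<in> I" for f d
  proof -
    from that have "f \<in> ideal.span {f \<in> I. \<exists>d. homogeneous d f}" using eq by simp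
    then show ?thesis
    proof (induction rule: ideal.span_induct_alt)
      case base
      then show ?case using ideal.subspace_0[OF sub] by simp
    next
      case (step c x y)
      then obtain e where "homogeneous e x" "x \<in> I" by auto
      then have "hcomp d (c * x) = hcomp (d - e) c * x"
        using hcomp_mult_left[of e x d c] by (simp add: mult.commute)
      then show ?case
        using step \<open>x \<in> I\<close> by (simp add: hcomp_add ideal.subspace_add[OF sub] ideal.subspace_scale[OF sub])
    qed
  qed
  with sub show "ideal.subspace I \<and> (\<forall>f\<in>I. \<forall>d. hcomp d f \<in> I)" by blast
next
  assume I: "ideal.subspace I \<and> (\<forall>f\<in>I. \<forall>d. hcomp d f \<in> I)"
  let ?S = "{f \<in> I. \<exists>d. homogeneous d f}"
  have "f \<in> ideal.span ?S" if "f \<in> I" for f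
  proof -
    have "(\<Sum>d\<in>degrees f. hcomp d f) \<in> ideal.span ?S"
      using I that by (intro ideal.span_sum ideal.span_base) (auto intro: homogeneous_hcomp)
    then show ?thesis by (simp add: sum_hcomp)
  qed
  moreover have "ideal.span ?S \<subseteq> I"
    using I by (intro ideal.span_minimal) auto
  ultimately show "homogeneous_ideal I"
    using I unfolding homogeneous_ideal_def by blast
qed

lemma homogeneous_ideal_subspace: "homogeneous_ideal I \<Longrightarrow> ideal.subspace I"
  by (simp add: homogeneous_ideal_def)

lemma homogeneous_ideal_hcomp: "homogeneous_ideal I \<Longrightarrow> f \<in> I \<Longrightarrow> hcomp d f \<in> I"
  by (simp add: homogeneous_ideal_iff)

lemma mem_if_hcomp_mem:
  assumes "ideal.subspace I" "\<And>d. hcomp d f \<in> I"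
  shows "f \<in> (I :: ('n, 'k::comm_ring_1) mpoly set)"
  using ideal.subspace_sum[OF assms(1), of "degrees f" "\<lambda>d. hcomp d f"] assms(2)
  by (simp add: sum_hcomp)

lemma subspace_mult_right: "ideal.subspace I \<Longrightarrow> f \<in> I \<Longrightarrow> f * g \<in> I"
  using ideal.subspace_scale[of I f g] by (simp add: mult.commute)

lemma subspace_UNIV_iff: "ideal.subspace I \<Longrightarrow> 1 \<in> I \<longleftrightarrow> I = UNIV"
  using ideal.subspace_scale[of I 1] by auto

lemma monom_mem_irrelevant:
  assumes "u \<noteq> 0"
  shows "monom u \<in> (irrelevant_ideal :: ('n, 'k::comm_ring_1) mpoly set)"
proof -
  obtain i where i: "i \<in> keys u"
    using assms by (metis ex_in_conv keys_eq_empty)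
  have "u = single i 1 + (u - single i 1)"
    using i by (auto intro!: poly_mapping_eqI simp: lookup_add lookup_minus lookup_single when_def in_keys_iff)
  then have "monom u = (monom (u - single i 1) * var i :: ('n, 'k) mpoly)"
    by (metis mult.commute var_mult_monom)
  then show ?thesis
    unfolding irrelevant_ideal_span_var by (simp only:) (intro ideal.span_scale ideal.span_base; simp)
qed

lemma irrelevant_ideal_eq:
  "(irrelevant_ideal :: ('n::finite, 'k::comm_ring_1) mpoly set) = {f. lookup f 0 = 0}"
proof
  have "ideal.subspace {f :: ('n, 'k) mpoly. lookup f 0 = 0}"
    by (auto intro!: ideal.subspaceI simp: lookup_add lookup_mult_zero)
  then show "irrelevant_ideal \<subseteq> {f :: ('n, 'k) mpoly. lookup f 0 = 0}"
    unfolding irrelevant_ideal_span_var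
    by (intro ideal.span_minimal) (auto simp: lookup_homogeneous_zero[OF homogeneous_var])
next
  show "{f :: ('n, 'k) mpoly. lookup f 0 = 0} \<subseteq> irrelevant_ideal"
  proof safe
    fix f :: "('n, 'k) mpoly" assume f: "lookup f 0 = 0"
    have "(\<Sum>u\<in>keys f. const (lookup f u) * monom u) \<in> irrelevant_ideal"
    proof (rule ideal.subspace_sum)
      show sub: "ideal.subspace (irrelevant_ideal :: ('n, 'k) mpoly set)"
        by (simp add: irrelevant_ideal_def)
      fix u assume "u \<in> keys f"
      then have "u \<noteq> 0" using f by (auto simp: in_keys_iff)
      then show "const (lookup f u) * monom u \<in> irrelevant_ideal"
        by (intro ideal.subspace_scale[OF sub] monom_mem_irrelevant)
    qed
    then show "f \<in> irrelevant_ideal" by (simp only: sum_monom)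
  qed
qed

lemma homogeneous_mem_irrelevant:
  "homogeneous d f \<Longrightarrow> d \<noteq> 0 \<Longrightarrow> (f :: ('n::finite, 'k::comm_ring_1) mpoly) \<in> irrelevant_ideal"
  by (simp add: irrelevant_ideal_eq lookup_homogeneous_zero)

lemma homogeneous_ideal_irrelevant:
  "homogeneous_ideal (irrelevant_ideal :: ('n, 'k::comm_ring_1) mpoly set)"
  unfolding irrelevant_ideal_span_var
  by (rule homogeneous_ideal_span) (auto intro: homogeneous_var)

text \<open>The degree 0 component is the constant term, and a nonzero constant in the ideal would
  be a unit.\<close>

lemma homogeneous_ideal_subset_irrelevant:
  fixes I :: "('n::finite, 'k::field) mpoly set"
  assumes "homogeneous_ideal I" "I \<noteq> UNIV"
  shows "I \<subseteq> irrelevant_ideal"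
proof
  fix f assume "f \<in> I"
  then have "const (inverse (lookup f 0)) * hcomp 0 f \<in> I"
    using assms(1) by (intro ideal.subspace_scale homogeneous_ideal_subspace homogeneous_ideal_hcomp)
  then have "lookup f 0 \<noteq> 0 \<Longrightarrow> 1 \<in> I"
    by (simp add: hcomp_0 const_mult_const)
  then show "f \<in> irrelevant_ideal"
    using assms subspace_UNIV_iff[OF homogeneous_ideal_subspace] by (auto simp: irrelevant_ideal_eq)
qed

text \<open>The homogeneous components of \<open>f\<close> are recovered one by one, in increasing degree.\<close>
lemma unit_cancel:
  fixes I :: "('n::finite, 'k::field) mpoly set"
  assumes I: "homogeneous_ideal I" and s: "lookup s 0 \<noteq> 0" and sf: "s * f \<in> I"
  shows "f \<in> I"
proof -
  note sub = homogeneous_ideal_subspace[OF I]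
  have "hcomp (int t) f \<in> I" for t
  proof (induction t rule: less_induct)
    case (less t)
    have zero: "hcomp 0 s = const (lookup s 0)" by (rule hcomp_0)
    have "hcomp (int t) (s * f) = (\<Sum>e\<in>insert 0 (degrees s). hcomp e s * hcomp (int t - e) f)"
      unfolding hcomp_mult by (intro sum.mono_neutral_left) (auto simp: hcomp_eq_0)
    also have "\<dots> = hcomp 0 s * hcomp (int t) f + (\<Sum>e\<in>degrees s - {0}. hcomp e s * hcomp (int t - e) f)"
      by (simp add: sum.insert_remove)
    finally have "hcomp 0 s * hcomp (int t) f =
        hcomp (int t) (s * f) - (\<Sum>e\<in>degrees s - {0}. hcomp e s * hcomp (int t - e) f)"
      by simp
    also have "\<dots> \<in> I"
    proof (rule ideal.subspace_diff[OF sub homogeneous_ideal_hcomp[OF I sf]],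
        intro ideal.subspace_sum[OF sub] ideal.subspace_scale[OF sub])
      fix e assume "e \<in> degrees s - {0}"
      then have "e \<ge> 0" "e \<noteq> 0" by (auto simp: degrees_def)
      then have "e > 0" by simp
      show "hcomp (int t - e) f \<in> I"
      proof (cases "int t - e < 0")
        case True
        then show ?thesis
          using homogeneous_neg[OF homogeneous_hcomp] ideal.subspace_0[OF sub] by metis
      next
        case False
        then have "nat (int t - e) < t" "int (nat (int t - e)) = int t - e" using \<open>e > 0\<close> by auto
        then show ?thesis using less.IH by metis
      qed
    qed
    finally have "const (inverse (lookup s 0)) * (hcomp 0 s * hcomp (int t) f) \<in> I"
      by (rule ideal.subspace_scale[OF sub])
    then show ?case
      using s by (simp add: zero const_mult_const flip: mult.assoc)
  qed
  moreover have "hcomp d f \<in> I" if "d < 0" for d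
    using homogeneous_neg[OF homogeneous_hcomp that] ideal.subspace_0[OF sub] by metis
  ultimately have "hcomp d f \<in> I" for d
    by (cases d) auto
  then show ?thesis by (rule mem_if_hcomp_mem[OF sub])
qed

subsection \<open>Setting variables to zero\<close>

lemma single_add_diff:
  "lookup u i \<noteq> (0::nat) \<Longrightarrow>
     single i 1 + (u - single i 1) = u"
  by (auto intro!: poly_mapping_eqI simp: lookup_add lookup_minus lookup_single when_def)

text \<open>The substitution x_j = 0 for j in A, kept as an endomorphism of one ring: questions
  modulo variables become equations in a domain of fixed type.\<close>

definition kill :: "'n set \<Rightarrow> ('n, 'k::zero) mpoly \<Rightarrow> ('n, 'k) mpoly" where
  "kill A f = restrict_keys (\<lambda>u. \<forall>j\<in>A. lookup u j = 0) f"

lemma kill_zero [simp]: "kill A 0 = 0"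
  by (simp add: kill_def)

lemma kill_diff: "kill A (f - g) = kill A f - kill A (g :: ('n, 'k::comm_ring_1) mpoly)"
  by (simp add: kill_def restrict_keys_diff)

lemma kill_add: "kill A (f + g) = kill A f + kill A (g :: ('n, 'k::comm_ring_1) mpoly)"
  by (simp add: kill_def restrict_keys_add)

lemma kill_kill: "kill A (kill B f) = kill (A \<union> B) f"
  by (rule poly_mapping_eqI) (auto simp: kill_def lookup_restrict_keys when_def)

lemma keys_kill: "u \<in> keys (kill A f) \<longleftrightarrow>
    u \<in> keys f \<and> (\<forall>j\<in>A. lookup u j = 0)"
  by (simp add: kill_def keys_restrict_keys)

text \<open>Every term of \<open>f - kill A f\<close> contains a variable of A, and so does every
  term of a multiple of it.\<close>

lemma kill_mult: "kill A (f * g) = kill A f * kill A (g :: ('n, 'k::comm_ring_1) mpoly)"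
proof -
  have split: "u \<in> keys (p * q) \<Longrightarrow> \<exists>a b. u = a + b \<and> a \<in> keys p \<and> b \<in> keys q"
    for u and p q :: "('n, 'k) mpoly"
    using keys_mult by blast
  have rest: "\<exists>j\<in>A. lookup a j \<noteq> 0" if "a \<in> keys (p - kill A p)" for a and p :: "('n, 'k) mpoly"
    using that by (auto simp: kill_def in_keys_iff lookup_minus lookup_restrict_keys when_def split: if_splits)
  have zero: "kill A ((p - kill A p) * q) = 0" for p q :: "('n, 'k) mpoly"
    unfolding kill_def[of A "_ * _"]
    by (rule restrict_keys_none) (use rest split in \<open>fastforce simp: lookup_add\<close>)
  have "kill A (kill A f * kill A g) = kill A f * kill A g"
    unfolding kill_def[of A "_ * _"]
    by (rule restrict_keys_id) (use split in \<open>fastforce simp: lookup_add keys_kill\<close>)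
  moreover have "f * g = (f - kill A f) * g + ((g - kill A g) * kill A f + kill A f * kill A g)"
    by (simp add: algebra_simps)
  ultimately show ?thesis by (simp only: kill_add zero add_0)
qed

lemma kill_var: "kill A (var i) = (if i \<in> A then 0 else var i)"
  unfolding kill_def var_def
  by (auto intro!: restrict_keys_id restrict_keys_none simp: lookup_single when_def split: if_splits)

lemma span_var_iff:
  fixes f :: "('n, 'k::comm_ring_1) mpoly"
  shows "f \<in> ideal.span (var ` A) \<longleftrightarrow> kill A f = 0"
proof
  have "ideal.subspace {f :: ('n, 'k) mpoly. kill A f = 0}"
    by (intro ideal.subspaceI) (auto simp: kill_add kill_mult)
  then have "ideal.span (var ` A) \<subseteq> {f :: ('n, 'k) mpoly. kill A f = 0}"
    by (intro ideal.span_minimal) (auto simp: kill_var)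
  then show "f \<in> ideal.span (var ` A) \<Longrightarrow> kill A f = 0" by blast
next
  assume f: "kill A f = 0"
  have "(\<Sum>u\<in>keys f. const (lookup f u) * monom u) \<in> ideal.span (var ` A)"
  proof (intro ideal.span_sum ideal.span_scale)
    fix u assume "u \<in> keys f"
    with f obtain j where j: "j \<in> A" "lookup u j \<noteq> 0"
      using keys_kill[of u A f] by auto
    have "monom u = monom (u - single j 1) * (var j :: ('n, 'k) mpoly)"
      by (metis j(2) mult.commute single_add_diff var_mult_monom)
    with j(1) show "monom u \<in> ideal.span (var ` A :: ('n, 'k) mpoly set)"
      by (metis ideal.span_base ideal.span_scale imageI)
  qed
  then show "f \<in> ideal.span (var ` A)" by (simp only: sum_monom)
qed

lemma var_regular_mod_vars:
  fixes f :: "('n::{finite, linorder}, 'k::field) mpoly"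
  assumes "i \<notin> A" "var i * f \<in> ideal.span (var ` A)"
  shows "f \<in> ideal.span (var ` A)"
proof -
  have "var i \<noteq> (0 :: ('n, 'k) mpoly)"
    by (metis lookup_single_eq lookup_zero one_neq_zero var_def)
  with assms show ?thesis by (simp add: span_var_iff kill_mult kill_var)
qed

text \<open>Modulo the variables in A, suppose x_i f = h l. Setting x_i to 0 as well leaves l
  nonzero, since its x_j term survives; so h vanishes there, that is, x_i divides h and can be
  cancelled. Thus l takes the place of x_j in a regular sequence with the other variables.\<close>

lemma var_regular_mod_linear:
  fixes f l :: "('n::{finite, linorder}, 'k::field) mpoly"
  assumes i: "i \<notin> A" and j: "j \<notin> A" "j \<noteq> i" and l: "single j 1 \<in> keys l"
    and f: "var i * f \<in> ideal.span (insert l (var ` A))"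
  shows "f \<in> ideal.span (insert l (var ` A))"
proof -
  have var: "var i \<noteq> (0 :: ('n, 'k) mpoly)"
    by (metis lookup_single_eq lookup_zero one_neq_zero var_def)
  obtain h where h: "var i * f - h * l \<in> ideal.span (var ` A)"
    using f unfolding ideal.span_insert by auto
  then have eq: "var i * kill A f = kill A h * kill A l"
    using i by (simp add: span_var_iff kill_diff kill_mult kill_var)
  have "single j 1 \<in> keys (kill {i} (kill A l))"
    using l j by (auto simp: keys_kill lookup_single when_def)
  then have "kill {i} (kill A l) \<noteq> 0" by auto
  moreover have "kill {i} (kill A h) * kill {i} (kill A l) = 0"
    using arg_cong[OF eq, of "kill {i}"] by (simp add: kill_mult kill_var)
  ultimately have "kill {i} (kill A h) = 0" by simp
  then have "kill A h \<in> ideal.span (var ` {i})"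
    by (rule iffD2[OF span_var_iff])
  then have "kill A h \<in> range (\<lambda>k. k * var i)"
    by (simp only: image_insert image_empty ideal.span_singleton)
  then obtain k where k: "kill A h = k * var i" by (elim imageE)
  then have "var i * kill A f = var i * (k * kill A l)"
    unfolding eq k by (simp only: mult_ac)
  then have "kill A f = k * kill A l" using var by simp
  from arg_cong[OF this, of "kill A"] have "kill A f = kill A k * kill A l"
    by (simp add: kill_mult kill_kill)
  then have "f - k * l \<in> ideal.span (var ` A)"
    by (simp add: span_var_iff kill_diff kill_mult)
  then show ?thesis unfolding ideal.span_insert by auto
qed

subsection \<open>Hilbert's basis theorem\<close>

text \<open>A nonincreasing sequence of naturals is constant from its minimum on, so a monotone
  subsequence of the wrong direction becomes nondecreasing after a shift.\<close>

lemma nat_seq_mono_subseq: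
  fixes g :: "nat \<Rightarrow> nat"
  shows "\<exists>r::nat \<Rightarrow> nat. strict_mono r \<and> mono (\<lambda>n. g (r n))"
proof -
  obtain s where s: "strict_mono s" "monoseq (\<lambda>n. g (s n))"
    using seq_monosub[of g] by blast
  show ?thesis
  proof (cases "mono (\<lambda>n. g (s n))")
    case True
    with s show ?thesis by blast
  next
    case False
    then have dec: "\<And>m n. m \<le> n \<Longrightarrow> g (s n) \<le> g (s m)"
      using s(2) unfolding monoseq_def mono_def by blast
    obtain N where N: "\<And>n. g (s N) \<le> g (s n)"
      using ex_has_least_nat[of "\<lambda>_. True" 0 "\<lambda>n. g (s n)"] by auto
    have "g (s (n + N)) = g (s N)" for n
      using N[of "n + N"] dec[of N "n + N"] by simp
    then have "mono (\<lambda>n. g (s (n + N)))" by (simp add: mono_def)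
    moreover have "strict_mono (\<lambda>n. s (n + N))"
      using s(1) by (simp add: strict_mono_def)
    ultimately show ?thesis by (intro exI[of _ "\<lambda>n. s (n + N)"]) simp
  qed
qed

text \<open>Passing to a subsequence for one variable after another makes all exponents
  nondecreasing; the first member then divides the second.\<close>

lemma dickson:
  fixes f :: "nat \<Rightarrow> ('n::finite \<Rightarrow>\<^sub>0 nat)"
  shows "\<exists>i j w. i < j \<and> f j = f i + w"
proof -
  have "\<exists>r::nat \<Rightarrow> nat. strict_mono r \<and> (\<forall>a\<in>A. mono (\<lambda>n. lookup (f (r n)) a))" if "finite A" for A
    using that
  proof (induction A)
    case empty
    show ?case by (intro exI[of _ "\<lambda>n. n"]) (simp add: strict_mono_def)
  next
    case (insert a A)
    then obtain r :: "nat \<Rightarrow> nat" where r: "strict_mono r" "\<forall>a\<in>A. mono (\<lambda>n. lookup (f (r n)) a)"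
      by blast
    obtain s :: "nat \<Rightarrow> nat" where s: "strict_mono s" "mono (\<lambda>n. lookup (f (r (s n))) a)"
      using nat_seq_mono_subseq[of "\<lambda>n. lookup (f (r n)) a"] by blast
    have "strict_mono (\<lambda>n. r (s n))" using r(1) s(1) by (simp add: strict_mono_def)
    moreover have "mono (\<lambda>n. lookup (f (r (s n))) b)" if "b \<in> A" for b
      using r(2) that s(1) by (simp add: mono_def strict_mono_less_eq)
    ultimately show ?case using s(2) by (intro exI[of _ "\<lambda>n. r (s n)"]) simp
  qed
  from this[of UNIV] obtain r :: "nat \<Rightarrow> nat" where r: "strict_mono r" "\<And>a. mono (\<lambda>n. lookup (f (r n)) a)"
    by auto
  have "f (r 1) = f (r 0) + (f (r 1) - f (r 0))"
    using r(2) by (intro poly_mapping_eqI) (simp add: lookup_add lookup_minus mono_def)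
  moreover have "r 0 < r 1" using r(1) by (simp add: strict_mono_def)
  ultimately show ?thesis by blast
qed

text \<open>The order on finitely supported functions is decided at the least position where they
  differ, so it is lexicographic with 0 at the bottom.\<close>

lemma monomial_nonneg: "0 \<le> (u :: 'n::{finite, linorder} \<Rightarrow>\<^sub>0 nat)"
proof (cases "u = 0")
  case False
  let ?k = "Min (keys u)"
  have "?k \<in> keys u" using False by (intro Min_in) auto
  moreover have "\<forall>k' < ?k. lookup u k' = 0"
    using not_less Min_le[OF finite_keys] by (metis in_keys_iff)
  ultimately have "less_fun (lookup 0) (lookup u)"
    unfolding less_fun_def by (intro exI[of _ ?k]) (auto simp: in_keys_iff)
  then have "0 < u" by (simp add: less_poly_mapping.rep_eq)
  then show ?thesis by simp
qed simp

text \<open>In a descending chain a later monomial would be a multiple of an earlier one, hence not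
  smaller.\<close>

lemma wf_monomial_order: "wf {(u, v :: 'n::{finite, linorder} \<Rightarrow>\<^sub>0 nat). u < v}"
  unfolding wf_iff_no_infinite_down_chain
proof
  assume "\<exists>f. \<forall>i. (f (Suc i), f i) \<in> {(u, v :: 'n \<Rightarrow>\<^sub>0 nat). u < v}"
  then obtain f :: "nat \<Rightarrow> 'n \<Rightarrow>\<^sub>0 nat" where f: "\<And>i. f (Suc i) < f i" by auto
  have dec: "f j < f i" if "i < j" for i j
    using that
  proof (induction j)
    case (Suc j)
    then show ?case using f[of j] by (cases "i = j") auto
  qed simp
  obtain i j w where "i < j" "f j = f i + w" using dickson[of f] by blast
  moreover have "f i + 0 \<le> f i + w" by (intro add_left_mono monomial_nonneg)
  ultimately show False using dec[of i j] by simp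
qed

lemma lookup_single_mult:
  fixes f :: "('n, 'k::comm_ring_1) mpoly"
  shows "lookup (single w c * f) (w + v) = c * lookup f v"
proof -
  have "single w c * f = (\<Sum>u\<in>keys f. single (w + u) (c * lookup f u))"
    by (subst sum_single[of f, symmetric]) (simp add: sum_distrib_left mult_single)
  then have "lookup (single w c * f) (w + v) =
      (\<Sum>u\<in>keys f. if v = u then c * lookup f u else 0)"
    by (auto simp: lookup_sum lookup_single when_def intro!: sum.cong)
  also have "\<dots> = c * lookup f v"
    by (auto simp: in_keys_iff)
  finally show ?thesis .
qed

text \<open>A minimal bad sequence of leading monomials contradicts Dickson's lemma.\<close>
theorem hilbert_basis:
  fixes J :: "('n::{finite, linorder}, 'k::field) mpoly set"
  assumes J: "ideal.subspace J"
  shows "\<exists>B. finite B \<and> B \<subseteq> J \<and> J = ideal.span B"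
proof (rule ccontr)
  assume neg: "\<not> ?thesis"
  define lm :: "('n, 'k) mpoly \<Rightarrow> 'n \<Rightarrow>\<^sub>0 nat" where "lm f = Max (keys f)" for f
  have "\<exists>p. p \<in> J - ideal.span B \<and> (\<forall>g\<in>J - ideal.span B. lm p \<le> lm g)" if "finite B" "B \<subseteq> J" for B
  proof -
    have "J - ideal.span B \<noteq> {}"
      using neg that ideal.span_minimal[OF that(2) J] by blast
    then have "lm ` (J - ideal.span B) \<noteq> {}" by blast
    then obtain u where "u \<in> lm ` (J - ideal.span B)" "\<And>v. v < u \<Longrightarrow> v \<notin> lm ` (J - ideal.span B)"
      using wfE_min'[OF wf_monomial_order, of "lm ` (J - ideal.span B)"] by auto
    then show ?thesis by (metis imageE imageI leI)
  qed
  then obtain p where p: "\<And>B. finite B \<Longrightarrow> B \<subseteq> J \<Longrightarrow> p B \<in> J - ideal.span B"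
    and pmin: "\<And>B g. finite B \<Longrightarrow> B \<subseteq> J \<Longrightarrow> g \<in> J - ideal.span B \<Longrightarrow> lm (p B) \<le> lm g"
    by metis
  \<comment> \<open>Greedy construction: each new generator has the least leading monomial among the
    elements of J not yet generated.\<close>
  define B where "B n = ((\<lambda>B. insert (p B) B) ^^ n) {}" for n
  have B: "finite (B n) \<and> B n \<subseteq> J" for n
    by (induction n) (use p in \<open>auto simp: B_def\<close>)
  define f where "f n = p (B n)" for n
  have B_Suc: "B (Suc n) = insert (f n) (B n)" for n by (simp add: B_def f_def)
  have f_mem: "f i \<in> B j" if "i < j" for i j
    using that by (induction j) (auto simp: B_Suc less_Suc_eq)
  have fJ: "f n \<in> J - ideal.span (B n)" for n
    using p B unfolding f_def by blast
  have f0: "f n \<noteq> 0" for n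
    using fJ[of n] ideal.span_zero[of "B n"] by auto
  have lm_in: "lm g \<in> keys g" if "g \<noteq> 0" for g
    unfolding lm_def using that by (intro Max_in) auto
  obtain i j w where ij: "i < j" "lm (f j) = lm (f i) + w"
    using dickson[of "\<lambda>n. lm (f n)"] by blast
  \<comment> \<open>The leading monomial of \<open>f i\<close> divides that of \<open>f j\<close>.
    Subtracting this multiple cancels the leading term without entering the span, against the
    minimal choice of \<open>f j\<close>.\<close>
  define c where "c = lookup (f j) (lm (f j)) / lookup (f i) (lm (f i))"
  define g where "g = f j - single w c * f i"
  have "f i \<in> ideal.span (B j)" using f_mem[OF ij(1)] by (rule ideal.span_base)
  then have "g \<notin> ideal.span (B j)"
    using fJ[of j] ideal.span_add[of g "B j" "single w c * f i"]
    by (auto simp: g_def ideal.span_scale)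
  moreover have "g \<in> J"
    unfolding g_def using fJ by (intro ideal.subspace_diff[OF J] ideal.subspace_scale[OF J]) auto
  ultimately have g: "g \<in> J - ideal.span (B j)" by blast
  then have "g \<noteq> 0" using ideal.span_zero[of "B j"] by auto
  have le: "u \<le> lm (f j)" if "u \<in> keys g" for u
  proof -
    have "u \<in> keys (f j) \<or> u \<in> keys (single w c * f i)"
      using that by (auto simp: g_def in_keys_iff lookup_minus)
    then show ?thesis
    proof
      assume "u \<in> keys (f j)"
      then show ?thesis by (simp add: lm_def)
    next
      assume "u \<in> keys (single w c * f i)"
      then obtain v where "u = w + v" "v \<in> keys (f i)"
        using keys_mult[of "single w c" "f i"] by (auto split: if_splits)
      then have "u \<le> w + lm (f i)" by (simp add: lm_def add_left_mono)
      then show ?thesis by (simp add: ij(2) add.commute)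
    qed
  qed
  have "lookup g (lm (f j)) = 0"
    using lm_in[OF f0[of i]] lookup_single_mult[of w c "f i" "lm (f i)"]
    by (simp add: g_def lookup_minus ij(2) add.commute c_def in_keys_iff)
  then have "lm g \<noteq> lm (f j)" using lm_in[OF \<open>g \<noteq> 0\<close>] by (auto simp: in_keys_iff)
  then have "lm g < lm (f j)" using le[OF lm_in[OF \<open>g \<noteq> 0\<close>]] by simp
  moreover have "lm (f j) \<le> lm g"
    using pmin[of "B j" g] B g by (simp add: f_def)
  ultimately show False by simp
qed

text \<open>The union of a strictly ascending chain is an ideal whose finitely many generators lie
  in one member, where the chain would stop. The family is arbitrary because it is later one of
  homogeneous ideals, of the ideals I : l^e, and of annihilators.\<close>

lemma maximal_ideal_in_family:
  fixes F :: "('n::{finite, linorder}, 'k::field) mpoly set set"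
  assumes "F \<noteq> {}" and sub: "\<And>J. J \<in> F \<Longrightarrow> ideal.subspace J"
  shows "\<exists>J\<in>F. \<forall>K\<in>F. J \<subseteq> K \<longrightarrow> K = J"
proof (rule ccontr)
  assume "\<not> ?thesis"
  then have "\<forall>J\<in>F. \<exists>K\<in>F. J \<subset> K" by blast
  then have "\<exists>f. \<forall>n. f n \<in> F \<and> f n \<subset> f (Suc n)"
    using assms(1)
    by (intro dependent_nat_choice[where P = "\<lambda>_ J. J \<in> F" and Q = "\<lambda>_ J K. J \<subset> K"])
      (simp_all add: ex_in_conv Bex_def)
  then obtain f :: "nat \<Rightarrow> ('n, 'k) mpoly set" where "\<forall>n. f n \<in> F \<and> f n \<subset> f (Suc n)" ..
  then have f: "\<And>n. f n \<in> F" "\<And>n. f n \<subset> f (Suc n)" by simp_all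
  have mono: "f m \<subseteq> f n" if "m \<le> n" for m n
    using that
  proof (induction rule: dec_induct)
    case (step n)
    show ?case by (rule subset_trans[OF step.IH psubset_imp_subset[OF f(2)]])
  qed simp
  note fsub = sub[OF f(1)]
  have "ideal.subspace (\<Union>n. f n)"
  proof (rule ideal.subspaceI)
    show "0 \<in> (\<Union>n. f n)" using ideal.subspace_0[OF fsub[of 0]] by auto
    show "c * x \<in> (\<Union>n. f n)" if "x \<in> (\<Union>n. f n)" for c x
      using that ideal.subspace_scale[OF fsub] by auto
    fix x y assume "x \<in> (\<Union>n. f n)" "y \<in> (\<Union>n. f n)"
    then obtain m n where "x \<in> f m" "y \<in> f n" by auto
    then have "x \<in> f (max m n)" "y \<in> f (max m n)"
      using mono[of m "max m n"] mono[of n "max m n"] by auto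
    then have "x + y \<in> f (max m n)" by (rule ideal.subspace_add[OF fsub])
    then show "x + y \<in> (\<Union>n. f n)" by auto
  qed
  then obtain B where B: "finite B" "B \<subseteq> (\<Union>n. f n)" "(\<Union>n. f n) = ideal.span B"
    using hilbert_basis by metis
  from B(1,2) have "\<exists>N. B \<subseteq> f N"
  proof (induction B)
    case (insert b B)
    then obtain N M where "B \<subseteq> f N" "b \<in> f M" by auto
    then have "insert b B \<subseteq> f (max M N)"
      using mono[of M "max M N"] mono[of N "max M N"] by auto
    then show ?case by (rule exI)
  qed simp
  then obtain N where "B \<subseteq> f N" by (elim exE)
  then have "ideal.span B \<subseteq> f N"
    by (rule ideal.span_minimal[OF _ fsub])
  moreover have "f (Suc N) \<subseteq> ideal.span B"
    using B(3) by auto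
  ultimately show False using f(2)[of N] by auto
qed

subsection \<open>Products and powers of ideals\<close>

lemma ideal_mult_subspace [simp]: "ideal.subspace (ideal_mult I J)"
  by (simp add: ideal_mult_def)

lemma ideal_mult_mem: "a \<in> I \<Longrightarrow> b \<in> J \<Longrightarrow> a * b \<in> ideal_mult I J"
  unfolding ideal_mult_def by (rule ideal.span_base) blast

text \<open>The scalars of the span are absorbed into the left factor, so no case for multiples is
  left.\<close>

lemma ideal_mult_induct [consumes 2, case_names zero add mult]:
  assumes "x \<in> ideal_mult I J" "ideal.subspace I"
    and "P 0" "\<And>x y. P x \<Longrightarrow> P y \<Longrightarrow> P (x + y)"
    and "\<And>a b. a \<in> I \<Longrightarrow> b \<in> J \<Longrightarrow> P (a * b)"
  shows "P x"
  using assms(1) unfolding ideal_mult_def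
proof (induction rule: ideal.span_induct_alt)
  case base
  show ?case by (rule assms(3))
next
  case (step c x y)
  from step.hyps(1) obtain a b where ab: "x = a * b" "a \<in> I" "b \<in> J"
    by auto
  have "P ((c * a) * b)"
    by (rule assms(5)[OF ideal.subspace_scale[OF assms(2) ab(2)] ab(3)])
  then have "P (c * x)" by (simp only: ab(1) mult.assoc)
  then show ?case using step.IH by (rule assms(4))
qed

lemma ideal_mult_subset_right: "ideal.subspace J \<Longrightarrow> ideal_mult I J \<subseteq> J"
  unfolding ideal_mult_def by (rule ideal.span_minimal) (auto intro: ideal.subspace_scale)

lemma ideal_power_subspace [simp]: "ideal.subspace (ideal_power I r)"
proof (cases r)
  case 0
  then show ?thesis by (simp add: ideal.subspace_def)
qed simp

lemma ideal_power_antimono: "r \<le> m \<Longrightarrow> ideal_power I m \<subseteq> ideal_power I r"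
proof (induction m rule: dec_induct)
  case (step m)
  then show ?case
    using ideal_mult_subset_right[OF ideal_power_subspace[of I m], of I] by auto
qed simp

lemma ideal_mult_UNIV:
  assumes "ideal.subspace I"
  shows "ideal_mult I UNIV = I"
proof
  show "ideal_mult I UNIV \<subseteq> I"
    unfolding ideal_mult_def
    by (rule ideal.span_minimal[OF _ assms]) (auto intro: subspace_mult_right[OF assms])
  show "I \<subseteq> ideal_mult I UNIV"
  proof
    fix x assume "x \<in> I"
    then show "x \<in> ideal_mult I UNIV" using ideal_mult_mem[of x I 1 UNIV] by simp
  qed
qed

lemma homogeneous_ideal_mult:
  fixes I J :: "('n, 'k::comm_ring_1) mpoly set"
  assumes "homogeneous_ideal I" "homogeneous_ideal J"
  shows "homogeneous_ideal (ideal_mult I J)"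
  unfolding homogeneous_ideal_iff
proof (intro conjI ballI allI)
  fix f d assume "f \<in> ideal_mult I J"
  then show "hcomp d f \<in> ideal_mult I J"
    using homogeneous_ideal_subspace[OF assms(1)]
  proof (induction rule: ideal_mult_induct)
    case zero
    show ?case by (simp add: ideal.subspace_0)
  next
    case (add x y)
    then show ?case by (simp add: hcomp_add ideal.subspace_add)
  next
    case (mult a b)
    then show ?case
      unfolding hcomp_mult
      by (intro ideal.subspace_sum[OF ideal_mult_subspace] ideal_mult_mem homogeneous_ideal_hcomp assms)
  qed
qed simp

lemma homogeneous_ideal_UNIV: "homogeneous_ideal (UNIV :: ('n, 'k::comm_ring_1) mpoly set)"
  by (auto simp: homogeneous_ideal_iff ideal.subspace_def)

lemma homogeneous_ideal_power:
  fixes I :: "('n, 'k::comm_ring_1) mpoly set"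
  assumes "homogeneous_ideal I"
  shows "homogeneous_ideal (ideal_power I r)"
  by (induction r) (simp_all add: homogeneous_ideal_mult assms homogeneous_ideal_UNIV)

text \<open>With y = s g + z and z in I, the only term of the expansion of y^m without a factor s is
  z^m. This carries a congruence modulo I over to I^m.\<close>

lemma power_mem_ideal_power_plus:
  assumes I: "ideal.subspace I" and y: "y - s * g \<in> I"
  shows "\<exists>h. y ^ m - s * h \<in> ideal_power I m"
proof (induction m)
  case (Suc m)
  then obtain h where h: "y ^ m - s * h \<in> ideal_power I m" by blast
  have "y ^ Suc m - s * (g * y ^ m + (y - s * g) * h) = (y - s * g) * (y ^ m - s * h)"
    by (simp add: algebra_simps)
  also have "\<dots> \<in> ideal_power I (Suc m)"
    using ideal_mult_mem[OF y h] by simp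
  finally show ?case by blast
qed simp

lemma homogeneous_ideal_insert:
  fixes J :: "('n, 'k::comm_ring_1) mpoly set"
  assumes J: "homogeneous_ideal J" and a: "homogeneous e a"
  shows "homogeneous_ideal (ideal.span (insert a J))"
  unfolding homogeneous_ideal_iff
proof (intro conjI ballI allI)
  note sub = homogeneous_ideal_subspace[OF J]
  have span: "ideal.span J = J" using sub by (simp add: ideal.span_eq_iff)
  fix f d assume "f \<in> ideal.span (insert a J)"
  then obtain k where "f - k * a \<in> J"
    unfolding ideal.span_insert span by blast
  then have "hcomp d (f - k * a) \<in> J" by (rule homogeneous_ideal_hcomp[OF J])
  then have "hcomp d f - hcomp (d - e) k * a \<in> J"
    using hcomp_mult_left[OF a, of d k] by (simp add: hcomp_diff mult.commute)
  then show "hcomp d f \<in> ideal.span (insert a J)"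
    unfolding ideal.span_insert span by blast
qed simp

subsection \<open>Homogeneous primes\<close>

text \<open>Take the components of f and g of least degrees p and q outside J. In degree p + q every
  other contribution to f g contains a component of lower degree, which lies in J.\<close>

lemma homogeneous_primeI:
  fixes J :: "('n, 'k::comm_ring_1) mpoly set"
  assumes J: "homogeneous_ideal J" "J \<noteq> UNIV"
    and ab: "\<And>a b d e. homogeneous d a \<Longrightarrow> homogeneous e b \<Longrightarrow> a * b \<in> J \<Longrightarrow> a \<in> J \<or> b \<in> J"
  shows "prime_ideal J"
  unfolding prime_ideal_def
proof (intro conjI allI impI)
  note sub = homogeneous_ideal_subspace[OF J(1)]
  show "ideal.subspace J" by (rule sub)
  show "J \<noteq> UNIV" by (rule J(2))
  fix f g assume fg: "f * g \<in> J"
  show "f \<in> J \<or> g \<in> J"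
  proof (rule ccontr)
    have in_degrees: "d \<in> degrees f" if "hcomp d f \<notin> J" for d and f :: "('n, 'k) mpoly"
      using that hcomp_eq_0[of d f] ideal.subspace_0[OF sub] by fastforce
    have min: "\<exists>d. hcomp d f \<notin> J \<and> (\<forall>e<d. hcomp e f \<in> J)" if "f \<notin> J" for f :: "('n, 'k) mpoly"
    proof -
      let ?D = "{d \<in> degrees f. hcomp d f \<notin> J}"
      have "\<exists>d. hcomp d f \<notin> J"
      proof (rule ccontr)
        assume "\<not> ?thesis"
        then have "\<And>d. hcomp d f \<in> J" by simp
        then have "f \<in> J" by (rule mem_if_hcomp_mem[OF sub])
        with that show False ..
      qed
      then obtain d where "hcomp d f \<notin> J" ..
      then have "?D \<noteq> {}" using in_degrees[of d f] by blast
      then have "Min ?D \<in> ?D" by (intro Min_in) auto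
      moreover have "hcomp e f \<in> J" if "e < Min ?D" for e
      proof (rule ccontr)
        assume "hcomp e f \<notin> J"
        then have "Min ?D \<le> e" using in_degrees[of e f] by (intro Min_le) auto
        with that show False by simp
      qed
      ultimately show ?thesis by blast
    qed
    assume "\<not> (f \<in> J \<or> g \<in> J)"
    then obtain p q where p: "hcomp p f \<notin> J" "\<And>e. e < p \<Longrightarrow> hcomp e f \<in> J"
      and q: "hcomp q g \<notin> J" "\<And>e. e < q \<Longrightarrow> hcomp e g \<in> J"
      using min[of f] min[of g] by blast
    have pf: "p \<in> degrees f" using p(1) by (rule in_degrees)
    have "hcomp (p + q) (f * g) =
        hcomp p f * hcomp q g + (\<Sum>e\<in>degrees f - {p}. hcomp e f * hcomp (p + q - e) g)"
      by (simp add: hcomp_mult sum.remove[OF finite_degrees pf])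
    moreover have "(\<Sum>e\<in>degrees f - {p}. hcomp e f * hcomp (p + q - e) g) \<in> J"
    proof (rule ideal.subspace_sum[OF sub])
      fix e assume "e \<in> degrees f - {p}"
      then consider "e < p" | "p + q - e < q" by (cases "e < p") auto
      then show "hcomp e f * hcomp (p + q - e) g \<in> J"
      proof cases
        case 1
        then show ?thesis by (rule subspace_mult_right[OF sub p(2)])
      next
        case 2
        then show ?thesis by (rule ideal.subspace_scale[OF sub q(2)])
      qed
    qed
    ultimately have "hcomp p f * hcomp q g \<in> J"
      using ideal.subspace_diff[OF sub homogeneous_ideal_hcomp[OF J(1) fg, of "p + q"]]
      by fastforce
    then show False using ab[OF homogeneous_hcomp homogeneous_hcomp] p(1) q(1) by blast
  qed
qed

lemma prime_ideal_power: "prime_ideal P \<Longrightarrow> f ^ N \<in> P \<Longrightarrow> f \<in> P"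
proof (induction N)
  case 0
  then show ?case by (auto simp: prime_ideal_def subspace_UNIV_iff)
qed (auto simp: prime_ideal_def)

text \<open>Noetherian induction: a maximal counterexample K is proper and not prime, so it contains
  a product a b of forms outside it. The primes for K + (a) and K + (b) together serve K, with the
  exponents added. The list Ps plays the part of the minimal primes, and N that of the nilpotency
  index of the radical.\<close>

lemma homogeneous_radical_decomposition:
  fixes J :: "('n::{finite, linorder}, 'k::field) mpoly set"
  assumes "homogeneous_ideal J"
  shows "\<exists>Ps N. finite Ps \<and> (\<forall>P\<in>Ps. prime_ideal P \<and> homogeneous_ideal P \<and> J \<subseteq> P) \<and>
    (\<forall>f. (\<forall>P\<in>Ps. f \<in> P) \<longrightarrow> f ^ N \<in> J)"
proof (rule ccontr)
  define Q where "Q J \<longleftrightarrow> (\<exists>Ps N. finite Ps \<and> (\<forall>P\<in>Ps. prime_ideal P \<and> homogeneous_ideal P \<and> J \<subseteq> P) \<and>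
    (\<forall>f. (\<forall>P\<in>Ps. f \<in> P) \<longrightarrow> f ^ N \<in> J))" for J :: "('n, 'k) mpoly set"
  assume "\<not> ?thesis"
  then have "\<not> Q J" by (simp add: Q_def)
  define F where "F = {J :: ('n, 'k) mpoly set. homogeneous_ideal J \<and> \<not> Q J}"
  have "J \<in> F" using \<open>\<not> Q J\<close> assms by (simp add: F_def)
  then obtain K where K: "K \<in> F" and max: "\<And>L. L \<in> F \<Longrightarrow> K \<subseteq> L \<Longrightarrow> L = K"
    using maximal_ideal_in_family[of F] homogeneous_ideal_subspace unfolding F_def by blast
  have hK: "homogeneous_ideal K" and nQ: "\<not> Q K" using K by (auto simp: F_def)
  note sub = homogeneous_ideal_subspace[OF hK]
  have span: "ideal.span K = K" using sub by (simp add: ideal.span_eq_iff)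
  have "K \<noteq> UNIV"
  proof
    assume "K = UNIV"
    \<comment> \<open>For the unit ideal the list of primes is empty, every f qualifies, and f^0 = 1
      lies in K.\<close>
    then have "Q K" unfolding Q_def by (intro exI[of _ "{}"] exI[of _ 0]) auto
    with nQ show False ..
  qed
  moreover have "\<not> prime_ideal K"
  proof
    assume "prime_ideal K"
    then have "Q K" unfolding Q_def using hK by (intro exI[of _ "{K}"] exI[of _ 1]) auto
    with nQ show False ..
  qed
  ultimately obtain a b d e where ab: "homogeneous d a" "homogeneous e b" "a * b \<in> K" "a \<notin> K" "b \<notin> K"
    using homogeneous_primeI[OF hK] by blast
  have Qa: "Q (ideal.span (insert x K))" if "homogeneous d' x" "x \<notin> K" for x d'
  proof (rule ccontr)
    assume "\<not> Q (ideal.span (insert x K))"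
    then have "ideal.span (insert x K) \<in> F"
      using homogeneous_ideal_insert[OF hK that(1)] by (simp add: F_def)
    moreover have "insert x K \<subseteq> ideal.span (insert x K)" by (rule ideal.span_superset)
    ultimately show False using max[of "ideal.span (insert x K)"] that(2) by blast
  qed
  have sup: "K \<subseteq> ideal.span (insert x K)" for x
    using ideal.span_superset[of "insert x K"] by blast
  obtain Ps N where Ps: "finite Ps"
    "\<forall>P\<in>Ps. prime_ideal P \<and> homogeneous_ideal P \<and> ideal.span (insert a K) \<subseteq> P"
    "\<forall>f. (\<forall>P\<in>Ps. f \<in> P) \<longrightarrow> f ^ N \<in> ideal.span (insert a K)"
    using Qa[OF ab(1,4)] unfolding Q_def by blast
  obtain Ps' N' where Ps': "finite Ps'"
    "\<forall>P\<in>Ps'. prime_ideal P \<and> homogeneous_ideal P \<and> ideal.span (insert b K) \<subseteq> P"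
    "\<forall>f. (\<forall>P\<in>Ps'. f \<in> P) \<longrightarrow> f ^ N' \<in> ideal.span (insert b K)"
    using Qa[OF ab(2,5)] unfolding Q_def by blast
  have "f ^ (N + N') \<in> K" if f: "\<forall>P\<in>Ps \<union> Ps'. f \<in> P" for f
  proof -
    obtain k where k: "f ^ N - k * a \<in> K"
      using Ps(3) f unfolding ideal.span_insert span by blast
    obtain k' where k': "f ^ N' - k' * b \<in> K"
      using Ps'(3) f unfolding ideal.span_insert span by blast
    have "f ^ (N + N') = (f ^ N - k * a) * f ^ N' + (k * a * (f ^ N' - k' * b) + k * k' * (a * b))"
      by (simp add: algebra_simps power_add)
    also have "\<dots> \<in> K"
      by (intro ideal.subspace_add[OF sub] subspace_mult_right[OF sub k]
          ideal.subspace_scale[OF sub k'] ideal.subspace_scale[OF sub ab(3)])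
    finally show ?thesis .
  qed
  then have "Q K"
    unfolding Q_def using Ps(1,2) Ps'(1,2) sup[of a] sup[of b]
    by (intro exI[of _ "Ps \<union> Ps'"] exI[of _ "N + N'"] conjI) blast+
  with nQ show False ..
qed

text \<open>Over a finite field, 1 plus the product of all X - a has positive degree and takes the
  value 1 everywhere.\<close>

lemma infinite_UNIV_alg_closed: "infinite (UNIV :: 'k::alg_closed_field set)"
proof
  assume fin: "finite (UNIV :: 'k set)"
  define p :: "'k poly" where "p = (\<Prod>a\<in>UNIV. [:- a, 1:])"
  have "degree p = card (UNIV :: 'k set)"
    unfolding p_def by (subst degree_prod_eq_sum_degree) auto
  then have "degree p > 0" using fin by (simp add: card_gt_0_iff)
  then have "degree (p + 1) > 0" by (subst degree_add_eq_left) auto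
  then obtain x where "poly (p + 1) x = 0"
    using alg_closed_imp_poly_has_root by blast
  moreover have "poly p x = 0"
    unfolding p_def poly_prod using fin by (intro prod_zero) auto
  ultimately show False by simp
qed

text \<open>Prime avoidance along a line: among the forms l + c x_i each ideal in question excludes
  at most one c, since two values would put both x_i and l into it. Infinitely many c are
  available.\<close>

lemma linear_form_avoiding:
  fixes Ps :: "('n, 'k::alg_closed_field) mpoly set set"
  assumes "finite Ps" "\<And>P. P \<in> Ps \<Longrightarrow> ideal.subspace P" "\<And>P. P \<in> Ps \<Longrightarrow> \<not> irrelevant_ideal \<subseteq> P"
  shows "\<exists>l. homogeneous 1 l \<and> (\<forall>P\<in>Ps. l \<notin> P)"
  using assms
proof (induction Ps)
  case empty
  show ?case by (intro exI[of _ 0]) simp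
next
  case (insert P Ps)
  then obtain l where l: "homogeneous 1 l" "\<forall>Q\<in>Ps. l \<notin> Q" by blast
  have sub: "ideal.subspace Q" if "Q \<in> insert P Ps" for Q using insert.prems(1) that by blast
  have "\<not> range var \<subseteq> P"
    using insert.prems(2)[of P] ideal.span_minimal[OF _ sub[of P], of "range var"]
    unfolding irrelevant_ideal_span_var by blast
  then obtain i where i: "var i \<notin> P" by blast
  let ?f = "\<lambda>c :: 'k. l + const c * var i"
  have "finite {c. ?f c \<in> Q}" if Q: "Q \<in> insert P Ps" for Q
  proof -
    note s = sub[OF Q]
    have "c = c'" if c: "?f c \<in> Q" "?f c' \<in> Q" for c c'
    proof (rule ccontr)
      assume "c \<noteq> c'"
      have "?f c - ?f c' = const (c - c') * var i"
        by (simp add: single_diff algebra_simps)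
      then have "const (c - c') * var i \<in> Q"
        using ideal.subspace_diff[OF s c] by simp
      then have "const (inverse (c - c')) * (const (c - c') * var i) \<in> Q"
        by (rule ideal.subspace_scale[OF s])
      then have v: "var i \<in> Q"
        using \<open>c \<noteq> c'\<close> by (simp add: const_mult_const flip: mult.assoc)
      then have "l \<in> Q"
        using ideal.subspace_diff[OF s c(1) ideal.subspace_scale[OF s v, of "const c"]] by simp
      with v i l(2) Q show False by blast
    qed
    then have "\<exists>c. {c. ?f c \<in> Q} \<subseteq> {c}" by blast
    then show ?thesis by (metis finite.simps finite_subset)
  qed
  then have "finite (\<Union>Q\<in>insert P Ps. {c. ?f c \<in> Q})"
    using insert.hyps(1) by blast
  then obtain c where "c \<notin> (\<Union>Q\<in>insert P Ps. {c. ?f c \<in> Q})"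
    using ex_new_if_finite[OF infinite_UNIV_alg_closed] by blast
  moreover have "homogeneous 1 (?f c)"
    by (intro homogeneous_add l homogeneous_const_mult homogeneous_var)
  ultimately show ?case by blast
qed

subsection \<open>Zero-dimensional subschemes\<close>

lemma topspace_proj_topology:
  "topspace proj_topology = (proj_points :: ('n, 'k::comm_ring_1) mpoly set set)"
proof
  show "topspace proj_topology \<subseteq> (proj_points :: ('n, 'k) mpoly set set)"
    unfolding topspace_def by (auto simp: openin_proj_topology)
  have "openin proj_topology {P \<in> proj_points. \<not> (UNIV :: ('n, 'k) mpoly set) \<subseteq> P}"
    unfolding openin_proj_topology using homogeneous_ideal_UNIV by blast
  moreover have "{P \<in> proj_points. \<not> (UNIV :: ('n, 'k) mpoly set) \<subseteq> P} = proj_points"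
    by (auto simp: proj_points_def prime_ideal_def)
  ultimately show "proj_points \<subseteq> topspace (proj_topology :: ('n, 'k) mpoly set topology)"
    using openin_subset by force
qed

lemma topspace_subscheme_space: "topspace (subscheme_space I) = {P \<in> proj_points. I \<subseteq> P}"
  by (auto simp: subscheme_space_def topspace_proj_topology)

lemma closedin_subscheme_space:
  fixes I :: "('n, 'k::comm_ring_1) mpoly set"
  shows "closedin (subscheme_space I) C \<longleftrightarrow>
     (\<exists>J. homogeneous_ideal J \<and> C = {P \<in> proj_points. I \<subseteq> P \<and> J \<subseteq> P})"
proof -
  have "closedin proj_topology T \<longleftrightarrow> (\<exists>J. homogeneous_ideal J \<and> T = {P \<in> proj_points. J \<subseteq> P})"
    for T :: "('n, 'k) mpoly set set"
  proof
    assume "closedin proj_topology T"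
    then obtain J where "T \<subseteq> proj_points" "homogeneous_ideal J" "proj_points - T = {P \<in> proj_points. \<not> J \<subseteq> P}"
      unfolding closedin_def topspace_proj_topology openin_proj_topology by blast
    moreover from this have "T = {P \<in> proj_points. J \<subseteq> P}" by blast
    ultimately show "\<exists>J. homogeneous_ideal J \<and> T = {P \<in> proj_points. J \<subseteq> P}" by blast
  next
    assume "\<exists>J. homogeneous_ideal J \<and> T = {P \<in> proj_points. J \<subseteq> P}"
    then obtain J where J: "homogeneous_ideal J" "T = {P \<in> proj_points. J \<subseteq> P}" by blast
    then have "proj_points - T = {P \<in> proj_points. \<not> J \<subseteq> P}" "T \<subseteq> proj_points" by blast+
    with J(1) show "closedin proj_topology T"
      unfolding closedin_def topspace_proj_topology openin_proj_topology by blast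
  qed
  then have "closedin (subscheme_space I) C \<longleftrightarrow>
      (\<exists>T. (\<exists>J. homogeneous_ideal J \<and> T = {P \<in> proj_points. J \<subseteq> P}) \<and> C = T \<inter> {P. I \<subseteq> P})"
    unfolding subscheme_space_def closedin_subtopology by simp
  also have "\<dots> \<longleftrightarrow> (\<exists>J. homogeneous_ideal J \<and> C = {P \<in> proj_points. J \<subseteq> P} \<inter> {P. I \<subseteq> P})"
    by (rule iffI; elim exE conjE; intro exI conjI; (assumption | rule refl | simp only:))
  also have "\<dots> \<longleftrightarrow> (\<exists>J. homogeneous_ideal J \<and> C = {P \<in> proj_points. I \<subseteq> P \<and> J \<subseteq> P})"
    by (simp add: Int_def conj_ac)
  finally show ?thesis .
qed

text \<open>P is the generic point: whichever of A and B contains P contains all points above P,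
  being given by an ideal.\<close>

lemma irreducible_closed_point:
  assumes P: "P \<in> proj_points" "I \<subseteq> P"
  shows "irreducible_closed (subscheme_space I) {R \<in> proj_points. I \<subseteq> R \<and> P \<subseteq> R}"
  unfolding irreducible_closed_def closedin_subscheme_space
proof (intro conjI allI impI)
  let ?V = "\<lambda>P. {R \<in> proj_points. I \<subseteq> R \<and> P \<subseteq> R}"
  show "\<exists>J. homogeneous_ideal J \<and> ?V P = ?V J"
    using P by (auto simp: proj_points_def)
  show "?V P \<noteq> {}" using P by blast
  fix A B
  assume *: "(\<exists>J. homogeneous_ideal J \<and> A = ?V J) \<and> (\<exists>J. homogeneous_ideal J \<and> B = ?V J) \<and> ?V P = A \<union> B"
  from * obtain J where J: "A = ?V J" by (elim conjE exE)
  from * obtain K where K: "B = ?V K" by (elim conjE exE)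
  from * have V: "?V P = A \<union> B" by (elim conjE)
  have "P \<in> A \<union> B" using P unfolding V[symmetric] by simp
  then show "?V P = A \<or> ?V P = B"
  proof
    assume "P \<in> A"
    then have "?V P \<subseteq> A" unfolding J by auto
    with V have "?V P = A" by blast
    then show ?thesis by (rule disjI1)
  next
    assume "P \<in> B"
    then have "?V P \<subseteq> B" unfolding K by auto
    with V have "?V P = B" by blast
    then show ?thesis by (rule disjI2)
  qed
qed

text \<open>A proper inclusion of points turns into a chain of two irreducible closed sets, the
  closure of Q inside the closure of P.\<close>

lemma zero_dim_incomparable:
  assumes "defines_zero_dim_subscheme I" "P \<in> proj_points" "Q \<in> proj_points" "I \<subseteq> P" "P \<subseteq> Q"
  shows "P = Q"
proof (rule ccontr)
  assume "P \<noteq> Q"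
  define C where "C i = (if i = (0::nat) then {R \<in> proj_points. I \<subseteq> R \<and> Q \<subseteq> R}
    else {R \<in> proj_points. I \<subseteq> R \<and> P \<subseteq> R})" for i
  have "irreducible_closed (subscheme_space I) (C i)" for i
    using irreducible_closed_point[of P I] irreducible_closed_point[of Q I] assms
    by (auto simp: C_def)
  moreover have "C i \<subset> C (Suc i)" if "i < 1" for i
  proof -
    have "P \<in> C 1" "P \<notin> C 0" "C 0 \<subseteq> C 1"
      using assms \<open>P \<noteq> Q\<close> by (auto simp: C_def)
    with that show ?thesis by (auto simp: psubset_eq)
  qed
  ultimately have "enat 1 \<le> krull_dim (subscheme_space I)"
    unfolding krull_dim_def by (intro Sup_upper) blast
  with assms(1) show False
    by (simp add: defines_zero_dim_subscheme_def one_enat_def zero_enat_def)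
qed

lemma var_power: "var i ^ N = monom (single i N)"
proof (induction N)
  case (Suc N)
  then show ?case
    using var_mult_monom[of i "single i N"] by (simp flip: single_add)
qed simp

text \<open>Pigeonhole: a monomial of degree at least \<open>CARD('n) * N\<close> has some exponent
  at least N.\<close>

lemma irrelevant_power_subset:
  fixes J :: "('n::finite, 'k::comm_ring_1) mpoly set"
  assumes J: "ideal.subspace J" "\<And>i. var i ^ N \<in> J"
    and f: "homogeneous d f" "d \<ge> int (CARD('n) * N)"
  shows "f \<in> J"
  using f(1)
proof (induction rule: mpoly_homogeneous_induct)
  case (monom u c)
  have "\<exists>i. lookup u i \<ge> N"
  proof (rule ccontr)
    assume "\<not> ?thesis"
    then have "(\<Sum>i\<in>UNIV. lookup u i) < (\<Sum>i\<in>(UNIV::'n set). N)"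
      by (intro sum_strict_mono) (auto simp: not_le)
    then have "monom_degree u < CARD('n) * N" by (simp add: monom_degree_eq_sum)
    moreover have "int (CARD('n) * N) \<le> int (monom_degree u)" using monom f(2) by simp
    ultimately show False by linarith
  qed
  then obtain i where i: "lookup u i \<ge> N" by blast
  then have u: "u = single i N + (u - single i N)"
    by (intro poly_mapping_eqI) (auto simp: lookup_add lookup_minus lookup_single when_def)
  have "monom u = var i ^ N * (monom (u - single i N) :: ('n, 'k) mpoly)"
    by (subst u) (simp add: var_power mult_single)
  then show ?case
    using ideal.subspace_scale[OF J(1) subspace_mult_right[OF J], of "const c"] by simp
qed (use J in \<open>auto intro: ideal.subspace_0 ideal.subspace_add\<close>)

text \<open>A prime found over I + (l) that were a point would contain a member of Ps, hence equal
  it in dimension 0, although l avoids that member. So all these primes contain the variables, and a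
  common power of each variable lies in I + (l).\<close>

theorem zero_dim_linear_form:
  fixes I :: "('n::{finite, linorder}, 'k::alg_closed_field) mpoly set"
  assumes I: "homogeneous_ideal I" and dim: "defines_zero_dim_subscheme I"
  shows "\<exists>l T. homogeneous 1 l \<and> l \<noteq> 0 \<and>
    (\<forall>d f. homogeneous d f \<longrightarrow> d \<ge> T \<longrightarrow> f \<in> ideal.span (insert l I))"
proof -
  obtain Ps N where Ps: "finite Ps" "\<And>P. P \<in> Ps \<Longrightarrow> prime_ideal P \<and> homogeneous_ideal P \<and> I \<subseteq> P"
    and N: "\<And>f. (\<And>P. P \<in> Ps \<Longrightarrow> f \<in> P) \<Longrightarrow> f ^ N \<in> I"
    using homogeneous_radical_decomposition[OF I] by metis
  obtain P0 where P0: "P0 \<in> proj_points" "I \<subseteq> P0"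
    using dim by (auto simp: defines_zero_dim_subscheme_def topspace_subscheme_space)
  \<comment> \<open>The point P0 is added to the list so that l is nonzero in any case.\<close>
  have "\<exists>l. homogeneous 1 l \<and> (\<forall>P\<in>insert P0 (Ps \<inter> proj_points). l \<notin> P)"
    using Ps(1) P0(1) by (intro linear_form_avoiding) (auto simp: proj_points_def prime_ideal_def)
  then obtain l where l: "homogeneous 1 l" "l \<notin> P0" "\<And>P. P \<in> Ps \<Longrightarrow> P \<in> proj_points \<Longrightarrow> l \<notin> P"
    by blast
  have "l \<noteq> 0"
    using l(2) P0(1) ideal.subspace_0[of P0] by (auto simp: proj_points_def prime_ideal_def)
  let ?J = "ideal.span (insert l I)"
  have J: "l \<in> ?J" "I \<subseteq> ?J"
    using ideal.span_superset[of "insert l I"] by auto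
  have hJ: "homogeneous_ideal ?J"
    by (rule homogeneous_ideal_insert[OF I l(1)])
  obtain Qs N' where Qs: "finite Qs" "\<And>P. P \<in> Qs \<Longrightarrow> prime_ideal P \<and> homogeneous_ideal P \<and> ?J \<subseteq> P"
    and N': "\<And>f. (\<And>P. P \<in> Qs \<Longrightarrow> f \<in> P) \<Longrightarrow> f ^ N' \<in> ?J"
    using homogeneous_radical_decomposition[OF hJ] by metis
  have "irrelevant_ideal \<subseteq> Q" if Q: "Q \<in> Qs" for Q
  proof (rule ccontr)
    assume nQ: "\<not> irrelevant_ideal \<subseteq> Q"
    have prime: "prime_ideal Q" and hQ: "homogeneous_ideal Q" and JQ: "?J \<subseteq> Q" using Qs(2)[OF Q] by auto
    have Qp: "Q \<in> proj_points" using prime hQ nQ by (simp add: proj_points_def)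
    \<comment> \<open>Otherwise the product of elements \<open>g P\<close> of P outside Q lies in
      every P, so a power of it lies in I and hence in the prime Q.\<close>
    have "\<exists>P\<in>Ps. P \<subseteq> Q"
    proof (rule ccontr)
      assume "\<not> ?thesis"
      then have "\<forall>P\<in>Ps. \<exists>x. x \<in> P \<and> x \<notin> Q" by blast
      from bchoice[OF this] obtain g where "\<forall>P\<in>Ps. g P \<in> P \<and> g P \<notin> Q" ..
      then have g: "\<And>P. P \<in> Ps \<Longrightarrow> g P \<in> P" "\<And>P. P \<in> Ps \<Longrightarrow> g P \<notin> Q" by simp_all
      have "prod g A \<notin> Q" if "finite A" "A \<subseteq> Ps" for A
        using that prime g(2)
        by (induction A) (auto simp: prime_ideal_def subspace_UNIV_iff)
      then have "prod g Ps \<notin> Q" using Ps(1) by blast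
      moreover have "prod g Ps \<in> P" if "P \<in> Ps" for P
        using that Ps(1) Ps(2)[OF that] g(1)[OF that]
        by (subst prod.remove[of Ps P]) (auto simp: prime_ideal_def intro: subspace_mult_right)
      ultimately show False
        using N[of "prod g Ps"] prime_ideal_power[OF prime, of "prod g Ps" N] J(2) JQ by blast
    qed
    then obtain P where P: "P \<in> Ps" "P \<subseteq> Q" by blast
    have Pp: "P \<in> proj_points" using Ps(2)[OF P(1)] P(2) nQ by (auto simp: proj_points_def)
    have "P = Q" using zero_dim_incomparable[OF dim Pp Qp _ P(2)] Ps(2)[OF P(1)] by blast
    with l(3)[OF P(1) Pp] J(1) JQ show False by blast
  qed
  then have "var i ^ N' \<in> ?J" for i
    using homogeneous_mem_irrelevant[OF homogeneous_var[of i]] by (intro N') auto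
  then have "f \<in> ?J" if "homogeneous d f" "d \<ge> int (CARD('n) * N')" for d f
    using irrelevant_power_subset[OF _ _ that] by simp
  with l(1) \<open>l \<noteq> 0\<close> show ?thesis by blast
qed

section \<open>Powers of a variable modulo a linear form\<close>

lemma linear_form_key:
  fixes l :: "('n::finite, 'k::comm_ring_1) mpoly"
  assumes "homogeneous 1 l" "l \<noteq> 0"
  shows "\<exists>j. single j 1 \<in> keys l"
proof -
  obtain u where u: "u \<in> keys l"
    using assms(2) by (metis ex_in_conv keys_eq_empty)
  then have deg: "monom_degree u = 1" using assms(1) by (auto simp: homogeneous_def)
  then have "u \<noteq> 0" by auto
  then obtain j where "lookup u j \<noteq> 0"
    by (metis lookup_zero poly_mapping_eqI)
  from single_add_diff[OF this] have "u = single j 1 + (u - single j 1)" ..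
  moreover from this have "monom_degree (u - single j 1) = 0"
    using deg monom_degree_add[of "single j 1" "u - single j 1"] by simp
  ultimately show ?thesis using u by auto
qed

text \<open>If x_j occurs in l and i differs from j, then x_i is a nonzerodivisor modulo l, so x_i^t
  in (l) would descend to 1 in (l).\<close>

lemma var_power_notin_linear:
  fixes l :: "('n::{finite, linorder}, 'k::field) mpoly"
  assumes "CARD('n) \<ge> 2" "homogeneous 1 l" "l \<noteq> 0"
  shows "\<exists>i. \<forall>t. var i ^ t \<notin> ideal.span {l}"
proof -
  obtain j where j: "single j 1 \<in> keys l"
    using linear_form_key[OF assms(2,3)] by blast
  have "\<not> UNIV \<subseteq> {j}"
    using assms(1) card_mono[of "{j}" "UNIV :: 'n set"] by auto
  then obtain i where i: "i \<noteq> j" by blast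
  have "ideal.span {l} \<subseteq> irrelevant_ideal"
    using homogeneous_mem_irrelevant[OF assms(2)] homogeneous_ideal_subspace[OF homogeneous_ideal_irrelevant]
    by (intro ideal.span_minimal) auto
  then have one: "1 \<notin> ideal.span {l}" by (auto simp: irrelevant_ideal_eq)
  have "var i ^ t \<notin> ideal.span {l}" for t
  proof (induction t)
    case 0
    show ?case using one by simp
  next
    case (Suc t)
    then show ?case using var_regular_mod_linear[of i "{}" j l "var i ^ t"] i j by auto
  qed
  then show ?thesis by blast
qed

text \<open>For I = 0 the ideal (l) would contain a power of every variable. Two variables are
  essential: with a single one the zero ideal does define a point.\<close>

lemma zero_dim_nonzero:
  fixes I :: "('n::{finite, linorder}, 'k::alg_closed_field) mpoly set"
  assumes "CARD('n) \<ge> 2" and I: "homogeneous_ideal I" and dim: "defines_zero_dim_subscheme I"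
  shows "\<exists>f\<in>I. f \<noteq> 0"
proof (rule ccontr)
  assume "\<not> ?thesis"
  then have I0: "I = {0}"
    using ideal.subspace_0[OF homogeneous_ideal_subspace[OF I]] by blast
  obtain l T where l: "homogeneous 1 l" "l \<noteq> 0"
    and T: "\<And>d f. homogeneous d f \<Longrightarrow> d \<ge> T \<Longrightarrow> f \<in> ideal.span (insert l I)"
    using zero_dim_linear_form[OF I dim] by metis
  obtain i where "\<forall>t. var i ^ t \<notin> ideal.span {l}"
    using var_power_notin_linear[OF assms(1) l] by blast
  moreover have "var i ^ nat T \<in> ideal.span (insert l I)"
    using homogeneous_power[OF homogeneous_var, of "nat T" i] by (intro T[of "int (nat T)"]) auto
  ultimately show False by (simp add: I0 ideal.span_insert)
qed

subsection \<open>Complexes of graded free modules\<close>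

text \<open>This says that L' is L + (x) for a linear form x that is a nonzerodivisor on R/L. The
  last clause is the graded form of the sum; phrased with elements, it spares the passage to
  quotient rings.\<close>

definition regular_ext ::
    "('n, 'k::comm_ring_1) mpoly set \<Rightarrow> ('n, 'k) mpoly \<Rightarrow> ('n, 'k) mpoly set \<Rightarrow> bool" where
  "regular_ext L x L' \<longleftrightarrow> ideal.subspace L \<and> ideal.subspace L' \<and> L \<subseteq> L' \<and> x \<in> L' \<and> homogeneous 1 x \<and>
     (\<forall>f. x * f \<in> L \<longrightarrow> f \<in> L) \<and>
     (\<forall>f d. homogeneous d f \<longrightarrow> f \<in> L' \<longrightarrow> (\<exists>g. homogeneous (d - 1) g \<and> f - x * g \<in> L))"

lemma regular_ext_insert:
  fixes x :: "('n, 'k::comm_ring_1) mpoly"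
  assumes L: "homogeneous_ideal (ideal.span S)" and x: "homogeneous 1 x"
    and reg: "\<And>f. x * f \<in> ideal.span S \<Longrightarrow> f \<in> ideal.span S"
  shows "regular_ext (ideal.span S) x (ideal.span (insert x S))"
proof -
  have "\<exists>g. homogeneous (d - 1) g \<and> f - x * g \<in> ideal.span S"
    if f: "homogeneous d f" "f \<in> ideal.span (insert x S)" for f d
  proof -
    obtain k where "f - k * x \<in> ideal.span S"
      using f(2) unfolding ideal.span_insert by auto
    then have "hcomp d (f - k * x) \<in> ideal.span S" by (rule homogeneous_ideal_hcomp[OF L])
    moreover have "hcomp d (f - k * x) = f - x * hcomp (d - 1) k"
      using hcomp_mult_left[OF x, of d k] hcomp_homogeneous[OF f(1), of d]
      by (simp add: hcomp_diff mult.commute)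
    ultimately show ?thesis by (metis homogeneous_hcomp)
  qed
  moreover have "ideal.span S \<subseteq> ideal.span (insert x S)"
    by (rule ideal.span_mono) auto
  moreover have "x \<in> ideal.span (insert x S)"
    by (rule ideal.span_base) simp
  ultimately show ?thesis
    unfolding regular_ext_def using x reg by simp
qed

locale graded_complex =
  fixes n :: "nat \<Rightarrow> nat" and b :: "nat \<Rightarrow> nat \<Rightarrow> int"
    and D :: "nat \<Rightarrow> nat \<Rightarrow> nat \<Rightarrow> ('n::{finite, linorder}, 'k::field) mpoly"
  assumes homogeneous_D:
      "j < n (Suc i) \<Longrightarrow> l < n i \<Longrightarrow> homogeneous (b (Suc i) j - b i l) (D i j l)"
    and complex: "v \<in> free_mod (n (Suc (Suc i))) \<Longrightarrow>
      free_hom (n (Suc i)) (n i) (D i) (free_hom (n (Suc (Suc i))) (n (Suc i)) (D (Suc i)) v) = (\<lambda>_. 0)"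
begin

abbreviation bd :: "nat \<Rightarrow> (nat \<Rightarrow> ('n, 'k) mpoly) \<Rightarrow> nat \<Rightarrow> ('n, 'k) mpoly" where
  "bd i \<equiv> free_hom (n (Suc i)) (n i) (D i)"

definition hmg :: "nat \<Rightarrow> int \<Rightarrow> (nat \<Rightarrow> ('n, 'k) mpoly) \<Rightarrow> bool" where
  "hmg i d v \<longleftrightarrow> v \<in> free_mod (n i) \<and> (\<forall>l<n i. homogeneous (d - b i l) (v l))"

text \<open>No map leaves homological degree 0, so everything is a cycle there, and acyclicity means
  that the differential is onto modulo L.\<close>

definition cycle_mod :: "('n, 'k) mpoly set \<Rightarrow> nat \<Rightarrow> (nat \<Rightarrow> ('n, 'k) mpoly) \<Rightarrow> bool" where
  "cycle_mod L i v \<longleftrightarrow> (case i of 0 \<Rightarrow> True | Suc j \<Rightarrow> \<forall>l. bd j v l \<in> L)"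

text \<open>The homology of the complex tensored with the quotient by \<open>L\<close> vanishes in
  homological degree \<open>i\<close> and internal degree \<open>d\<close>.\<close>
definition acyclic_mod :: "('n, 'k) mpoly set \<Rightarrow> nat \<Rightarrow> int \<Rightarrow> bool" where
  "acyclic_mod L i d \<longleftrightarrow> (\<forall>v. hmg i d v \<longrightarrow> cycle_mod L i v \<longrightarrow>
     (\<exists>w. hmg (Suc i) d w \<and> (\<forall>l. v l - bd i w l \<in> L)))"

lemma cycle_mod_0 [simp]: "cycle_mod L 0 v"
  by (simp add: cycle_mod_def)

lemma cycle_mod_Suc [simp]: "cycle_mod L (Suc i) v \<longleftrightarrow> (\<forall>l. bd i v l \<in> L)"
  by (simp add: cycle_mod_def)

lemma bd_diff: "bd i (\<lambda>l. v l - w l) l = bd i v l - bd i w l"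
  by (simp add: free_hom_def algebra_simps sum_subtractf)

lemma bd_scale: "bd i (\<lambda>l. x * v l) l = x * bd i v l"
  by (simp add: free_hom_def sum_distrib_left mult.assoc)

lemma bd_mem: "ideal.subspace L \<Longrightarrow> (\<And>l. v l \<in> L) \<Longrightarrow> bd i v l \<in> L"
  by (auto simp: free_hom_def intro!: ideal.subspace_sum subspace_mult_right ideal.subspace_0)

lemma hmg_diff: "hmg i d v \<Longrightarrow> hmg i d w \<Longrightarrow> hmg i d (\<lambda>l. v l - w l)"
  by (auto simp: hmg_def free_mod_def intro: homogeneous_diff)

lemma hmg_scale: "homogeneous 1 x \<Longrightarrow> hmg i (d - 1) v \<Longrightarrow> hmg i d (\<lambda>l. x * v l)"
proof -
  assume x: "homogeneous 1 x" and v: "hmg i (d - 1) v"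
  have "homogeneous (d - b i l) (x * v l)" if "l < n i" for l
    using homogeneous_mult[OF x, of "d - 1 - b i l" "v l"] v that by (simp add: hmg_def)
  with v show ?thesis by (simp add: hmg_def free_mod_def)
qed

lemma hmg_bd: "hmg (Suc i) d w \<Longrightarrow> hmg i d (bd i w)"
proof -
  assume w: "hmg (Suc i) d w"
  have "homogeneous (d - b i l) (w j * D i j l)" if "l < n i" "j < n (Suc i)" for l j
    using homogeneous_mult[of "d - b (Suc i) j" "w j" "b (Suc i) j - b i l" "D i j l"]
      homogeneous_D[OF that(2,1)] w that by (simp add: hmg_def)
  then show ?thesis
    by (auto simp: hmg_def free_mod_def free_hom_def intro!: homogeneous_sum)
qed

lemma regular_ext_vector:
  assumes "regular_ext L x L'" "hmg i d v" "\<And>l. v l \<in> L'"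
  shows "\<exists>w. hmg i (d - 1) w \<and> (\<forall>l. v l - x * w l \<in> L)"
proof -
  have "\<forall>l. \<exists>g. l < n i \<longrightarrow> homogeneous (d - b i l - 1) g \<and> v l - x * g \<in> L"
    using assms unfolding regular_ext_def hmg_def by blast
  from choice[OF this] obtain w
    where w: "\<forall>l. l < n i \<longrightarrow> homogeneous (d - b i l - 1) (w l) \<and> v l - x * w l \<in> L" ..
  define w' where "w' l = (if l < n i then w l else 0)" for l
  have "hmg i (d - 1) w'"
    using w by (auto simp: hmg_def w'_def free_mod_def algebra_simps)
  moreover have "v l - x * w' l \<in> L" for l
    using w assms(1,2) by (auto simp: w'_def regular_ext_def hmg_def free_mod_def ideal.subspace_0)
  ultimately show ?thesis by blast
qed

text \<open>Long exact sequence of 0 -> C/L(-1) -> C/L -> C/L' -> 0, with multiplication by x on the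
  left: in H_i(C/L)_d -> H_i(C/L')_d -> H_(i-1)(C/L)_(d-1) both outer terms vanish. In the proof, w
  represents the image of v under the connecting homomorphism.\<close>

lemma acyclic_mod_ext:
  assumes ext: "regular_ext L x L'" and L: "acyclic_mod L i d"
    and L_prev: "\<And>j. i = Suc j \<Longrightarrow> acyclic_mod L j (d - 1)"
  shows "acyclic_mod L' i d"
  unfolding acyclic_mod_def
proof (intro allI impI)
  fix v assume v: "hmg i d v" and cyc: "cycle_mod L' i v"
  have sub: "ideal.subspace L" and sub': "ideal.subspace L'" and LL': "L \<subseteq> L'" and xL': "x \<in> L'"
    and x: "homogeneous 1 x" and reg: "\<And>f. x * f \<in> L \<Longrightarrow> f \<in> L"
    using ext unfolding regular_ext_def by auto
  show "\<exists>w. hmg (Suc i) d w \<and> (\<forall>l. v l - bd i w l \<in> L')"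
  proof (cases i)
    case 0
    then have "cycle_mod L i v" by simp
    then show ?thesis using L v LL' unfolding acyclic_mod_def by blast
  next
    case (Suc j)
    have bdv: "hmg j d (bd j v)" using hmg_bd v Suc by simp
    have "\<And>l. bd j v l \<in> L'" using cyc Suc by simp
    from regular_ext_vector[OF ext bdv this] obtain w
      where w: "hmg j (d - 1) w" "\<And>l. bd j v l - x * w l \<in> L" by blast
    have "cycle_mod L j w"
    proof (cases j)
      case (Suc k)
      have "bd k w l \<in> L" for l
      proof -
        have "bd k (\<lambda>l. bd j v l - x * w l) l \<in> L" using bd_mem[OF sub w(2)] .
        moreover have "bd k (bd j v) = (\<lambda>_. 0)"
          using complex[of v k] v \<open>i = Suc j\<close> Suc by (simp add: hmg_def)
        ultimately have "- (x * bd k w l) \<in> L" by (simp add: bd_diff bd_scale)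
        then have "x * bd k w l \<in> L" using ideal.subspace_neg[OF sub] by fastforce
        then show ?thesis by (rule reg)
      qed
      with Suc show ?thesis by simp
    qed simp
    then obtain z where z: "hmg i (d - 1) z" "\<And>l. w l - bd j z l \<in> L"
      using L_prev[OF Suc] w(1) Suc unfolding acyclic_mod_def by blast
    have "cycle_mod L i (\<lambda>l. v l - x * z l)"
    proof -
      have "bd j v l - x * bd j z l \<in> L" for l
        using ideal.subspace_add[OF sub w(2)[of l] ideal.subspace_scale[OF sub z(2)[of l], of x]]
        by (simp add: algebra_simps)
      with Suc show ?thesis by (simp add: bd_diff bd_scale)
    qed
    then obtain y where y: "hmg (Suc i) d y" "\<And>l. v l - x * z l - bd i y l \<in> L"
      using L hmg_diff[OF v hmg_scale[OF x z(1)]] unfolding acyclic_mod_def by blast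
    have "v l - bd i y l \<in> L'" for l
    proof -
      have "v l - x * z l - bd i y l + x * z l \<in> L'"
        using y(2)[of l] LL' by (intro ideal.subspace_add[OF sub'] subspace_mult_right[OF sub' xL']) auto
      then show ?thesis by (simp add: algebra_simps)
    qed
    with y(1) show ?thesis by blast
  qed
qed

text \<open>The same sequence at H_(i+1)(C/L')_(d+1) -> H_i(C/L)_d -> H_i(C/L)_(d+1), where the
  second map is multiplication by x.\<close>

lemma acyclic_mod_descend:
  assumes ext: "regular_ext L x L'" and L': "acyclic_mod L' (Suc i) (d + 1)" and L: "acyclic_mod L i (d + 1)"
  shows "acyclic_mod L i d"
  unfolding acyclic_mod_def
proof (intro allI impI)
  fix v assume v: "hmg i d v" and cyc: "cycle_mod L i v"
  have sub: "ideal.subspace L" and sub': "ideal.subspace L'" and LL': "L \<subseteq> L'" and xL': "x \<in> L'"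
    and x: "homogeneous 1 x" and reg: "\<And>f. x * f \<in> L \<Longrightarrow> f \<in> L"
    using ext unfolding regular_ext_def by auto
  have "hmg i (d + 1) (\<lambda>l. x * v l)" using hmg_scale[OF x, of i "d + 1" v] v by simp
  moreover have "cycle_mod L i (\<lambda>l. x * v l)"
    using cyc by (cases i) (simp_all add: bd_scale ideal.subspace_scale[OF sub])
  ultimately obtain u where u: "hmg (Suc i) (d + 1) u" "\<And>l. x * v l - bd i u l \<in> L"
    using L unfolding acyclic_mod_def by blast
  have "bd i u l \<in> L'" for l
  proof -
    have "x * v l - (x * v l - bd i u l) \<in> L'"
      by (rule ideal.subspace_diff[OF sub' subspace_mult_right[OF sub' xL'] subsetD[OF LL' u(2)]])
    then show ?thesis by simp
  qed
  then obtain w where w: "hmg (Suc (Suc i)) (d + 1) w" "\<And>l. u l - bd (Suc i) w l \<in> L'"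
    using L' u(1) unfolding acyclic_mod_def cycle_mod_Suc by blast
  obtain y where y: "hmg (Suc i) d y" "\<And>l. u l - bd (Suc i) w l - x * y l \<in> L"
    using regular_ext_vector[OF ext hmg_diff[OF u(1) hmg_bd[OF w(1)]] w(2)] by auto
  have "v l - bd i y l \<in> L" for l
  proof (rule reg)
    have "bd i (\<lambda>l. u l - bd (Suc i) w l - x * y l) l \<in> L" by (rule bd_mem[OF sub y(2)])
    moreover have "bd i (bd (Suc i) w) = (\<lambda>_. 0)"
      using complex[of w i] w(1) by (simp add: hmg_def)
    ultimately have "bd i u l - x * bd i y l \<in> L"
      by (simp add: bd_diff bd_scale)
    from ideal.subspace_add[OF sub u(2)[of l] this]
    show "x * (v l - bd i y l) \<in> L" by (simp add: algebra_simps)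
  qed
  with y(1) show "\<exists>w. hmg (Suc i) d w \<and> (\<forall>l. v l - bd i w l \<in> L)" by blast
qed

text \<open>Modulo the irrelevant ideal only constants survive, and those of the l-th summand sit in
  degree \<open>b i l\<close>.\<close>

lemma acyclic_mod_positive_degrees:
  assumes "ideal.subspace L" "irrelevant_ideal \<subseteq> L" "\<And>l. l < n i \<Longrightarrow> b i l < d"
  shows "acyclic_mod L i d"
  unfolding acyclic_mod_def
proof (intro allI impI)
  fix v assume v: "hmg i d v"
  have "v l \<in> L" for l
  proof (cases "l < n i")
    case True
    then have "homogeneous (d - b i l) (v l)" "d - b i l \<noteq> 0"
      using v assms(3)[OF True] by (auto simp: hmg_def)
    then show ?thesis using homogeneous_mem_irrelevant assms(2) by blast
  next
    case False
    then show ?thesis using v ideal.subspace_0[OF assms(1)] by (simp add: hmg_def free_mod_def)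
  qed
  then have "hmg (Suc i) d (\<lambda>_. 0) \<and> (\<forall>l. v l - bd i (\<lambda>_. 0) l \<in> L)"
    by (simp add: hmg_def free_mod_def free_hom_def)
  then show "\<exists>w. hmg (Suc i) d w \<and> (\<forall>l. v l - bd i w l \<in> L)" by blast
qed

section \<open>Homology modulo l and the variables\<close>

lemma homogeneous_ideal_span_linear:
  assumes "homogeneous 1 l"
  shows "homogeneous_ideal (ideal.span (insert l (var ` A)))"
  using assms by (intro homogeneous_ideal_span) (auto intro: homogeneous_var)

text \<open>Modulo the other variables l reduces to its x_j term, a nonzero multiple of x_j.\<close>

lemma irrelevant_subset_span_linear:
  fixes l :: "('n, 'k) mpoly"
  assumes l: "homogeneous 1 l" and j: "single j 1 \<in> keys l"
  shows "irrelevant_ideal \<subseteq> ideal.span (insert l (var ` (UNIV - {j})))"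
proof -
  let ?A = "UNIV - {j}" and ?L = "ideal.span (insert l (var ` (UNIV - {j})))"
  let ?c = "lookup l (single j 1)"
  have mem: "ideal.span (var ` ?A) \<subseteq> ?L" by (rule ideal.span_mono) auto
  have "kill ?A (kill ?A l) = kill ?A l" by (simp add: kill_kill)
  then have "l - kill ?A l \<in> ideal.span (var ` ?A)" by (simp add: span_var_iff kill_diff)
  then have "l - (l - kill ?A l) \<in> ?L"
    using mem by (intro ideal.span_diff[OF ideal.span_base subsetD[OF mem]]) simp_all
  then have kill: "kill ?A l \<in> ?L" by simp
  have "kill ?A l = single (single j 1) ?c"
  proof (rule poly_mapping_eqI)
    fix u
    show "lookup (kill ?A l) u =
        lookup (single (single j 1) ?c) u"
    proof (cases "u \<in> keys (kill ?A l)")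
      case True
      then have u: "u \<in> keys l" "\<And>i. i \<noteq> j \<Longrightarrow> lookup u i = 0"
        by (auto simp: keys_kill)
      then have "monom_degree u = 1" using l by (auto simp: homogeneous_def)
      moreover have "monom_degree u = lookup u j"
        using u(2) by (simp add: monom_degree_eq_sum sum.remove[of UNIV j])
      ultimately have "u = single j 1"
        using u(2) by (intro poly_mapping_eqI) (auto simp: lookup_single when_def)
      then show ?thesis using True by (simp add: kill_def lookup_restrict_keys keys_restrict_keys)
    next
      case False
      moreover have "single j 1 \<in> keys (kill ?A l)"
        using j by (auto simp: keys_kill lookup_single)
      ultimately have "single j 1 \<noteq> u" by blast
      with False show ?thesis by (simp add: in_keys_iff lookup_single when_def)
    qed
  qed
  then have "var j = const (inverse ?c) * kill ?A l"
    using j by (simp add: var_def mult_single in_keys_iff)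
  then have "var j \<in> ?L" using kill ideal.span_scale by metis
  then have "range var \<subseteq> ?L"
    using ideal.span_base[of _ "insert l (var ` ?A)"] by blast
  then show ?thesis
    unfolding irrelevant_ideal_span_var by (rule ideal.span_minimal) simp
qed

text \<open>Induction on the number of variables still to be adjoined to l. With all of them
  adjoined the shifts decide. To remove one, start in a degree where the homology is known to vanish
  and go down with \<open>acyclic_mod_descend\<close>; that step looks at i + 1 and d + 1 together,
  which is why the bound \<beta> + i grows by one with i.\<close>

theorem acyclic_mod_bound:
  assumes l: "homogeneous 1 l" and j: "single j 1 \<in> keys l"
    and b: "\<And>i k. k < n i \<Longrightarrow> b i k \<le> \<beta> + int i"
    and "finite A" "A \<subseteq> UNIV - {j}"
    and "\<And>i. \<exists>T. \<forall>d\<ge>T. acyclic_mod (ideal.span (insert l (var ` A))) i d"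
    and "d > \<beta> + int i"
  shows "acyclic_mod (ideal.span (insert l (var ` A))) i d"
  using assms(5-7)
proof (induction "card (UNIV - {j} - A)" arbitrary: A i d)
  case 0
  then have A: "A = UNIV - {j}" by auto
  show ?case
    unfolding A
  proof (rule acyclic_mod_positive_degrees)
    show "irrelevant_ideal \<subseteq> ideal.span (insert l (var ` (UNIV - {j})))"
      by (rule irrelevant_subset_span_linear[OF l j])
    show "b i k < d" if "k < n i" for k
      using b[OF that] 0 by simp
  qed simp
next
  case (Suc m)
  then have "UNIV - {j} - A \<noteq> {}" by auto
  then obtain x where x: "x \<noteq> j" "x \<notin> A" by blast
  let ?L = "ideal.span (insert l (var ` A))" and ?L' = "ideal.span (insert l (var ` insert x A))"
  have "regular_ext ?L (var x) (ideal.span (insert (var x) (insert l (var ` A))))"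
    using var_regular_mod_linear[OF x(2) _ _ j] Suc.prems(1) x(1)
    by (intro regular_ext_insert homogeneous_ideal_span_linear l homogeneous_var) auto
  then have ext: "regular_ext ?L (var x) ?L'"
    by (simp add: insert_commute)
  have "UNIV - {j} - A = insert x (UNIV - {j} - insert x A)" using x by auto
  then have "m = card (UNIV - {j} - insert x A)"
    using Suc.hyps(2) by (simp add: card_insert_disjoint)
  moreover have "insert x A \<subseteq> UNIV - {j}" using x Suc.prems(1) by auto
  moreover have "\<exists>T. \<forall>d\<ge>T. acyclic_mod ?L' i d" for i
  proof -
    obtain T where T: "\<forall>d\<ge>T. acyclic_mod ?L i d" using Suc.prems(2) by blast
    \<comment> \<open>At i = 0 the truncated index is harmless: the extension lemma asks for a
      previous homological degree only when i is a successor.\<close>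
    obtain T' where T': "\<forall>d\<ge>T'. acyclic_mod ?L (i - 1) d" using Suc.prems(2) by blast
    have "acyclic_mod ?L' i d" if "d \<ge> max T (T' + 1)" for d
      using that T T' by (intro acyclic_mod_ext[OF ext]) auto
    then show ?thesis by blast
  qed
  ultimately have IH: "acyclic_mod ?L' i d" if "d > \<beta> + int i" for i d
    using Suc.hyps(1) that by blast
  obtain T where T: "\<And>d. d \<ge> T \<Longrightarrow> acyclic_mod ?L i d" using Suc.prems(2) by blast
  have "acyclic_mod ?L i d" if "nat (T - d) = k" "d > \<beta> + int i" for k d
    using that
  proof (induction k arbitrary: d)
    case 0
    then show ?case by (intro T) simp
  next
    case (Suc k)
    then have "nat (T - (d + 1)) = k" by linarith
    then have L: "acyclic_mod ?L i (d + 1)" using Suc.IH[of "d + 1"] Suc.prems(2) by simp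
    have "acyclic_mod ?L' (Suc i) (d + 1)" using Suc.prems(2) by (intro IH) simp
    then show ?case by (rule acyclic_mod_descend[OF ext _ L])
  qed
  then show ?case using Suc.prems(3) by blast
qed

text \<open>Hilbert's syzygy bound. Each adjoined variable costs one homological degree, so modulo
  all variables the homology vanishes beyond \<open>CARD('n)\<close>. There minimality makes the
  differentials zero, and a basis vector would be a nonzero class. Adjoining the variables one by
  one takes the place of a Koszul complex.\<close>

theorem minimal_complex_terminates:
  assumes exact: "\<And>i d. i \<ge> 1 \<Longrightarrow> acyclic_mod {0} i d"
    and minimal: "\<And>i v l. i \<ge> 1 \<Longrightarrow> v \<in> free_mod (n (Suc i)) \<Longrightarrow> bd i v l \<in> irrelevant_ideal"
    and i: "i > CARD('n)"
  shows "n i = 0"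
proof (rule ccontr)
  assume "n i \<noteq> 0"
  have vars: "\<forall>i d. i > card A \<longrightarrow> acyclic_mod (ideal.span (var ` A)) i d" if "finite A" for A :: "'n set"
    using that
  proof (induction A rule: finite_induct)
    case empty
    then show ?case using exact by simp
  next
    case (insert x A)
    have "regular_ext (ideal.span (var ` A)) (var x :: ('n, 'k) mpoly) (ideal.span (insert (var x) (var ` A)))"
      using var_regular_mod_vars[OF insert.hyps(2)]
      by (intro regular_ext_insert homogeneous_ideal_span) (auto intro: homogeneous_var)
    from acyclic_mod_ext[OF this] show ?case
      using insert.hyps insert.IH unfolding image_insert by simp
  qed
  have acyc: "acyclic_mod irrelevant_ideal i (b i 0)"
    using vars[of UNIV] i by (simp add: irrelevant_ideal_span_var)
  let ?e = "\<lambda>l. if l = 0 then 1 else 0 :: ('n, 'k) mpoly"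
  have hmg_e: "hmg i (b i 0) ?e"
    using \<open>n i \<noteq> 0\<close> by (auto simp: hmg_def free_mod_def homogeneous_one)
  obtain k where "i = Suc k" using i by (cases i) auto
  moreover have "CARD('n) > 0" by simp
  ultimately have k: "i = Suc k" "k \<ge> 1" using i by linarith+
  then have "cycle_mod irrelevant_ideal i ?e"
    using minimal[of k ?e] \<open>n i \<noteq> 0\<close> by (auto simp: free_mod_def)
  with hmg_e obtain w where w: "hmg (Suc i) (b i 0) w" "\<And>l. ?e l - bd i w l \<in> irrelevant_ideal"
    using acyc unfolding acyclic_mod_def by blast
  have "bd i w 0 \<in> irrelevant_ideal"
    using minimal[of i w 0] w(1) k by (simp add: hmg_def)
  with w(2)[of 0] show False
    by (simp add: irrelevant_ideal_eq lookup_minus)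
qed

end

subsection \<open>Graded submodules of free modules\<close>

definition vscale :: "'a::comm_ring_1 \<Rightarrow> (nat \<Rightarrow> 'a) \<Rightarrow> (nat \<Rightarrow> 'a)" where
  "vscale s v = (\<lambda>l. s * v l)"

lemma vscale_apply: "vscale s v l = s * v l"
  by (simp add: vscale_def)

interpretation vec: module "vscale :: 'a::comm_ring_1 \<Rightarrow> (nat \<Rightarrow> 'a) \<Rightarrow> (nat \<Rightarrow> 'a)"
  by unfold_locales (auto simp: vscale_apply fun_eq_iff algebra_simps)

lemma sum_fun_apply: "(\<Sum>a\<in>A. f a) x = (\<Sum>a\<in>A. f a x)"
  by (induction A rule: infinite_finite_induct) auto

lemma free_mod_subspace: "vec.subspace (free_mod q)"
  by (intro vec.subspaceI) (auto simp: free_mod_def vscale_apply)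

text \<open>Induction on the rank: the last coordinates of K form an ideal, and subtracting
  combinations of vectors that lift its generators leaves vectors of K with one coordinate
  less.\<close>

lemma free_mod_submodule_finitely_generated:
  fixes K :: "(nat \<Rightarrow> ('n::{finite, linorder}, 'k::field) mpoly) set"
  assumes "vec.subspace K" "K \<subseteq> free_mod q"
  shows "\<exists>B. finite B \<and> B \<subseteq> K \<and> K = vec.span B"
  using assms
proof (induction q arbitrary: K)
  case 0
  then have "K \<subseteq> {0}" by (auto simp: free_mod_def fun_eq_iff)
  with vec.subspace_0[OF 0(1)] have "K = {0}" by blast
  then show ?case by (intro exI[of _ "{}"]) simp
next
  case (Suc q)
  note sub = Suc.prems(1)
  define J where "J = (\<lambda>v. v q) ` K"
  have "ideal.subspace J"
  proof (rule ideal.subspaceI)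
    show "0 \<in> J" using vec.subspace_0[OF sub] by (auto simp: J_def intro!: image_eqI[of _ _ 0])
    show "x + y \<in> J" if xy: "x \<in> J" "y \<in> J" for x y
    proof -
      obtain v w where "v \<in> K" "w \<in> K" "x = v q" "y = w q" using xy by (auto simp: J_def)
      then show ?thesis
        using vec.subspace_add[OF sub, of v w] by (auto simp: J_def intro!: image_eqI[of _ _ "v + w"])
    qed
    show "c * x \<in> J" if x: "x \<in> J" for c x
    proof -
      obtain v where "v \<in> K" "x = v q" using x by (auto simp: J_def)
      then show ?thesis
        using vec.subspace_scale[OF sub, of v c] by (auto simp: J_def vscale_apply intro!: image_eqI[of _ _ "vscale c v"])
    qed
  qed
  then obtain C where C: "finite C" "C \<subseteq> J" "J = ideal.span C" using hilbert_basis by metis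
  then have "\<forall>h\<in>C. \<exists>v. v \<in> K \<and> v q = h" by (force simp: J_def)
  from bchoice[OF this] obtain e where e: "\<forall>h\<in>C. e h \<in> K \<and> e h q = h" ..
  have "vec.subspace (K \<inter> free_mod q)" by (intro vec.subspace_inter sub free_mod_subspace)
  then obtain B where B: "finite B" "B \<subseteq> K \<inter> free_mod q" "K \<inter> free_mod q = vec.span B"
    using Suc.IH[of "K \<inter> free_mod q"] by auto
  let ?B = "e ` C \<union> B"
  have BK: "?B \<subseteq> K" using e B(2) by auto
  have "v \<in> vec.span ?B" if v: "v \<in> K" for v
  proof -
    have "v q \<in> range (\<lambda>u. \<Sum>h\<in>C. u h * h)"
      using v C(1,3) ideal.span_finite[OF C(1)] by (auto simp: J_def)
    then obtain u where u: "v q = (\<Sum>h\<in>C. u h * h)" by auto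
    define w where "w = (\<Sum>h\<in>C. vscale (u h) (e h))"
    have w: "w \<in> K"
      unfolding w_def using e by (intro vec.subspace_sum[OF sub] vec.subspace_scale[OF sub]) auto
    have wq: "w q = v q" using e by (simp add: w_def u sum_fun_apply vscale_apply)
    have "(v - w) l = 0" if "q \<le> l" for l
    proof (cases "l = q")
      case False
      then have "v l = 0" "w l = 0"
        using that subsetD[OF Suc.prems(2) v] subsetD[OF Suc.prems(2) w] by (simp_all add: free_mod_def)
      then show ?thesis by simp
    qed (simp add: wq)
    then have "v - w \<in> free_mod q" by (simp add: free_mod_def)
    with vec.subspace_diff[OF sub v w] have "v - w \<in> vec.span B" using B(3) by blast
    then have "v - w \<in> vec.span ?B" using vec.span_mono[of B ?B] by blast
    moreover have "w \<in> vec.span ?B"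
      unfolding w_def by (intro vec.span_sum vec.span_scale vec.span_base) auto
    ultimately have "v - w + w \<in> vec.span ?B" by (rule vec.span_add)
    then show ?thesis by simp
  qed
  moreover have "vec.span ?B \<subseteq> K" using vec.span_minimal[OF BK sub] .
  ultimately have "K = vec.span ?B" by blast
  moreover have "finite ?B" using B(1) C(1) by simp
  ultimately show ?case using BK by blast
qed

text \<open>The degree d part for the grading in which the l-th basis vector has degree
  \<open>b l\<close>; hence the shift in each coordinate.\<close>

definition vcomp :: "(nat \<Rightarrow> int) \<Rightarrow> int \<Rightarrow> (nat \<Rightarrow> ('n, 'k::zero) mpoly) \<Rightarrow> (nat \<Rightarrow> ('n, 'k) mpoly)" where
  "vcomp b d v = (\<lambda>l. hcomp (d - b l) (v l))"

definition graded_submodule ::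
    "nat \<Rightarrow> (nat \<Rightarrow> int) \<Rightarrow> (nat \<Rightarrow> ('n, 'k::comm_ring_1) mpoly) set \<Rightarrow> bool" where
  "graded_submodule q b K \<longleftrightarrow> vec.subspace K \<and> K \<subseteq> free_mod q \<and> (\<forall>v\<in>K. \<forall>d. vcomp b d v \<in> K)"

lemma sum_vcomp:
  fixes v :: "nat \<Rightarrow> ('n, 'k::comm_ring_1) mpoly"
  assumes v: "v \<in> free_mod q"
  shows "(\<Sum>d\<in>(\<Union>l<q. (\<lambda>e. e + b l) ` degrees (v l)). vcomp b d v) = v"
proof
  fix l
  let ?E = "\<Union>l<q. (\<lambda>e. e + b l) ` degrees (v l)"
  have "(\<Sum>d\<in>?E. vcomp b d v) l = (\<Sum>d\<in>?E. hcomp (d - b l) (v l))"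
    by (simp add: sum_fun_apply vcomp_def)
  also have "\<dots> = (\<Sum>e\<in>(\<lambda>d. d - b l) ` ?E. hcomp e (v l))"
    by (subst sum.reindex) (auto simp: inj_on_def)
  also have "\<dots> = v l"
  proof (cases "l < q")
    case True
    have "degrees (v l) \<subseteq> (\<lambda>d. d - b l) ` ?E"
    proof
      fix e assume "e \<in> degrees (v l)"
      then have "e + b l \<in> ?E" using True by blast
      then have "e + b l - b l \<in> (\<lambda>d. d - b l) ` ?E" by (rule imageI)
      then show "e \<in> (\<lambda>d. d - b l) ` ?E" by simp
    qed
    then show ?thesis by (intro sum_hcomp) auto
  next
    case False
    then have "v l = 0" using v by (simp add: free_mod_def)
    then show ?thesis by simp
  qed
  finally show "(\<Sum>d\<in>?E. vcomp b d v) l = v l" .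
qed

lemma free_hom_eq_sum:
  "(\<And>j. j < p \<Longrightarrow> h j \<in> free_mod q) \<Longrightarrow> free_hom p q h v = (\<Sum>j<p. vscale (v j) (h j))"
  by (auto simp: free_hom_def fun_eq_iff sum_fun_apply free_mod_def vscale_apply)

lemma free_hom_in_free_mod [simp]: "free_hom p q M v \<in> free_mod q"
  by (simp add: free_hom_def free_mod_def)

lemma hcomp_free_hom:
  fixes M :: "nat \<Rightarrow> nat \<Rightarrow> ('n, 'k::comm_ring_1) mpoly"
  assumes "\<And>j l. j < p \<Longrightarrow> l < q \<Longrightarrow> homogeneous (b' j - b l) (M j l)"
  shows "vcomp b d (free_hom p q M v) = free_hom p q M (vcomp b' d v)"
proof
  fix l
  show "vcomp b d (free_hom p q M v) l = free_hom p q M (vcomp b' d v) l"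
  proof (cases "l < q")
    case True
    have "hcomp (d - b l) (v j * M j l) = hcomp (d - b' j) (v j) * M j l" if "j < p" for j
      using hcomp_mult_left[OF assms[OF that True], of "d - b l" "v j"] by (simp add: mult.commute)
    with True show ?thesis by (simp add: vcomp_def free_hom_def hcomp_sum)
  qed (simp add: vcomp_def free_hom_def)
qed

lemma free_hom_add: "free_hom p q M (v + w) = free_hom p q M v + free_hom p q M w"
  by (auto simp: free_hom_def fun_eq_iff algebra_simps sum.distrib)

lemma free_hom_vscale: "free_hom p q M (vscale s v) = vscale s (free_hom p q M v)"
  by (auto simp: free_hom_def fun_eq_iff sum_distrib_left algebra_simps vscale_apply)

lemma free_hom_zero: "free_hom p q M 0 = 0"
  by (auto simp: free_hom_def fun_eq_iff)

lemma graded_submodule_kernel: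
  fixes M :: "nat \<Rightarrow> nat \<Rightarrow> ('n, 'k::comm_ring_1) mpoly"
  assumes "\<And>j l. j < p \<Longrightarrow> l < q \<Longrightarrow> homogeneous (b' j - b l) (M j l)"
  shows "graded_submodule p b' {v \<in> free_mod p. free_hom p q M v = 0}"
  unfolding graded_submodule_def
proof (intro conjI ballI allI)
  show "vec.subspace {v \<in> free_mod p. free_hom p q M v = 0}"
    using vec.subspace_0[OF free_mod_subspace, of p] vec.subspace_add[OF free_mod_subspace, of _ p]
      vec.subspace_scale[OF free_mod_subspace, of _ p]
    by (intro vec.subspaceI) (auto simp: free_hom_zero free_hom_add free_hom_vscale)
  fix v d assume v: "v \<in> {v \<in> free_mod p. free_hom p q M v = 0}"
  then have "free_hom p q M (vcomp b' d v) = vcomp b d 0"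
    using hcomp_free_hom[of p q b' b M d v] assms by simp
  also have "\<dots> = 0" by (simp add: vcomp_def fun_eq_iff)
  finally show "vcomp b' d v \<in> {v \<in> free_mod p. free_hom p q M v = 0}"
    using v by (simp add: free_mod_def vcomp_def)
qed auto

text \<open>A homogeneous generating set of least cardinality has all its syzygies in the irrelevant
  ideal: a constant coefficient would allow a generator to be dropped.\<close>
lemma minimal_generators:
  fixes K :: "(nat \<Rightarrow> ('n::{finite, linorder}, 'k::field) mpoly) set"
  assumes K: "graded_submodule q b K"
  shows "\<exists>p b' M. (\<forall>j<p. \<forall>l<q. homogeneous (b' j - b l) (M j l)) \<and>
    free_hom p q M ` free_mod p = K \<and>
    (\<forall>v\<in>free_mod p. free_hom p q M v = 0 \<longrightarrow> (\<forall>l. v l \<in> irrelevant_ideal))"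
proof -
  have sub: "vec.subspace K" and Kq: "K \<subseteq> free_mod q" and Kd: "\<And>v d. v \<in> K \<Longrightarrow> vcomp b d v \<in> K"
    using K by (auto simp: graded_submodule_def)
  define gens where "gens B \<longleftrightarrow> finite B \<and> B \<subseteq> K \<and> vec.span B = K \<and> (\<forall>e\<in>B. \<exists>d. \<forall>l. homogeneous (d - b l) (e l))" for B
  have "\<exists>B. gens B"
  proof -
    obtain B where B: "finite B" "B \<subseteq> K" "K = vec.span B"
      using free_mod_submodule_finitely_generated[OF sub Kq] by blast
    define E where "E v = (\<Union>l<q. (\<lambda>e. e + b l) ` degrees (v l))" for v :: "nat \<Rightarrow> ('n, 'k) mpoly"
    let ?B = "\<Union>v\<in>B. (\<lambda>d. vcomp b d v) ` E v"
    have fin: "finite ?B" using B(1) by (auto simp: E_def)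
    have BK: "?B \<subseteq> K" using B(2) Kd by auto
    have "v \<in> vec.span ?B" if "v \<in> B" for v
    proof -
      have "(\<Sum>d\<in>E v. vcomp b d v) \<in> vec.span ?B"
        using that by (intro vec.span_sum vec.span_base) auto
      then show ?thesis using sum_vcomp[of v q b] B(2) Kq that by (auto simp: E_def)
    qed
    then have "K \<subseteq> vec.span ?B"
      unfolding B(3) by (intro vec.span_minimal) auto
    with vec.span_minimal[OF BK sub] have "vec.span ?B = K" by blast
    moreover have "\<forall>e\<in>?B. \<exists>d. \<forall>l. homogeneous (d - b l) (e l)"
      by (auto simp: vcomp_def intro: homogeneous_hcomp)
    ultimately show ?thesis using fin BK unfolding gens_def by blast
  qed
  then obtain B where B: "gens B" and least: "\<And>C. gens C \<Longrightarrow> card B \<le> card C"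
    using ex_has_least_nat[of gens _ card] by blast
  have finB: "finite B" and BK: "B \<subseteq> K" and span: "vec.span B = K"
    and homB: "\<forall>e\<in>B. \<exists>d. \<forall>l. homogeneous (d - b l) (e l)"
    using B by (auto simp: gens_def)
  obtain M where M: "bij_betw M {0..<card B} B"
    using ex_bij_betw_nat_finite[OF finB] by blast
  let ?p = "card B"
  have inj: "inj_on M {..<?p}" and img: "M ` {..<?p} = B"
    using M by (auto simp: bij_betw_def lessThan_atLeast0)
  have MB: "M j \<in> B" if "j < ?p" for j using img that by blast
  have "\<forall>j\<in>{..<?p}. \<exists>d. \<forall>l. homogeneous (d - b l) (M j l)"
    using homB MB by blast
  from bchoice[OF this] obtain b' where "\<forall>j\<in>{..<?p}. \<forall>l. homogeneous (b' j - b l) (M j l)" ..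
  then have hom: "homogeneous (b' j - b l) (M j l)" if "j < ?p" for j l using that by simp
  have free_hom_M: "free_hom ?p q M v = (\<Sum>j<?p. vscale (v j) (M j))" for v
    using MB BK Kq by (intro free_hom_eq_sum) blast
  have image: "free_hom ?p q M ` free_mod ?p = K"
  proof
    show "free_hom ?p q M ` free_mod ?p \<subseteq> K"
      unfolding free_hom_M using MB BK
      by (auto intro!: vec.subspace_sum[OF sub] vec.subspace_scale[OF sub])
    show "K \<subseteq> free_hom ?p q M ` free_mod ?p"
    proof
      fix x assume "x \<in> K"
      then have "x \<in> range (\<lambda>u. \<Sum>e\<in>B. vscale (u e) e)"
        using vec.span_finite[OF finB] span by simp
      then obtain u where "x = (\<Sum>e\<in>B. vscale (u e) e)" by blast
      also have "\<dots> = (\<Sum>j<?p. vscale (u (M j)) (M j))"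
        using sum.reindex[OF inj, of "\<lambda>e. vscale (u e) e"] by (simp add: img)
      also have "\<dots> = free_hom ?p q M (\<lambda>j. if j < ?p then u (M j) else 0)"
        unfolding free_hom_M by (intro sum.cong) auto
      finally show "x \<in> free_hom ?p q M ` free_mod ?p"
        by (intro image_eqI) (auto simp: free_mod_def)
    qed
  qed
  have "v j \<in> irrelevant_ideal" if v: "v \<in> free_mod ?p" "free_hom ?p q M v = 0" for v j
  proof (rule ccontr)
    assume nin: "v j \<notin> irrelevant_ideal"
    then have c: "lookup (v j) 0 \<noteq> 0" by (simp add: irrelevant_ideal_eq)
    then have j: "j < ?p" using v(1) by (auto simp: free_mod_def not_less intro: ccontr)
    \<comment> \<open>The component of degree \<open>b' j\<close> is still a syzygy, and its j-th
      coefficient is the constant term of \<open>v j\<close>, a unit.\<close>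
    define w where "w = vcomp b' (b' j) v"
    have "free_hom ?p q M w = vcomp b (b' j) (free_hom ?p q M v)"
      unfolding w_def using hom by (intro hcomp_free_hom[symmetric]) auto
    also have "\<dots> = 0" by (simp add: v(2) vcomp_def fun_eq_iff)
    finally have "(\<Sum>i<?p. vscale (w i) (M i)) = 0" by (simp add: free_hom_M)
    then have "vscale (w j) (M j) + (\<Sum>i\<in>{..<?p} - {j}. vscale (w i) (M i)) = 0"
      using j by (simp add: sum.remove[of "{..<?p}" j])
    then have "vscale (w j) (M j) = - (\<Sum>i\<in>{..<?p} - {j}. vscale (w i) (M i))"
      by (rule add_eq_0_iff2[THEN iffD1])
    also have "\<dots> \<in> vec.span (B - {M j})"
    proof (intro vec.span_neg vec.span_sum vec.span_scale vec.span_base)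
      fix i assume "i \<in> {..<?p} - {j}"
      then show "M i \<in> B - {M j}" using MB[of i] inj j by (auto simp: inj_on_def)
    qed
    finally have "vscale (const (inverse (lookup (v j) 0))) (vscale (w j) (M j)) \<in> vec.span (B - {M j})"
      by (rule vec.span_scale)
    moreover have "const (inverse (lookup (v j) 0)) * w j = 1"
      using c by (simp add: w_def vcomp_def hcomp_0 const_mult_const)
    then have "vscale (const (inverse (lookup (v j) 0))) (vscale (w j) (M j)) = M j"
      by (simp add: vscale_apply fun_eq_iff flip: mult.assoc)
    ultimately have Mj: "M j \<in> vec.span (B - {M j})"
      by simp
    have "B \<subseteq> vec.span (B - {M j})"
      using Mj vec.span_base[of _ "B - {M j}"] by blast
    then have "vec.span B \<subseteq> vec.span (B - {M j})" by (intro vec.span_minimal) auto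
    moreover have "vec.span (B - {M j}) \<subseteq> vec.span B" by (rule vec.span_mono) auto
    ultimately have "gens (B - {M j})"
      using B unfolding gens_def by auto
    from least[OF this] show False
      using finB MB[OF j] card_Diff1_less[of B "M j"] by simp
  qed
  with hom image show ?thesis by (intro exI[of _ ?p] exI[of _ b'] exI[of _ M]) auto
qed

subsection \<open>Minimal graded free resolutions\<close>

text \<open>Exactness provides a preimage that need not be homogeneous; its component of degree d
  still maps to v.\<close>

lemma (in graded_complex) acyclic_mod_zero:
  assumes exact: "{v \<in> free_mod (n (Suc i)). bd i v = (\<lambda>_. 0)} = bd (Suc i) ` free_mod (n (Suc (Suc i)))"
  shows "acyclic_mod {0} (Suc i) d"
  unfolding acyclic_mod_def
proof (intro allI impI)
  fix v assume v: "hmg (Suc i) d v" and cyc: "cycle_mod {0} (Suc i) v"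
  have vf: "v \<in> free_mod (n (Suc i))" using v by (simp add: hmg_def)
  moreover have "bd i v = (\<lambda>_. 0)" using cyc by (simp add: fun_eq_iff)
  ultimately have "v \<in> bd (Suc i) ` free_mod (n (Suc (Suc i)))" using exact by blast
  then obtain w where w: "w \<in> free_mod (n (Suc (Suc i)))" "v = bd (Suc i) w" by blast
  let ?w = "vcomp (b (Suc (Suc i))) d w"
  have "bd (Suc i) ?w = vcomp (b (Suc i)) d v"
    unfolding w(2) by (rule hcomp_free_hom[symmetric]) (rule homogeneous_D)
  also have "\<dots> = v"
  proof
    fix l
    show "vcomp (b (Suc i)) d v l = v l"
    proof (cases "l < n (Suc i)")
      case True
      then have "homogeneous (d - b (Suc i) l) (v l)" using v by (simp add: hmg_def)
      then show ?thesis by (simp add: vcomp_def hcomp_homogeneous)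
    next
      case False
      then show ?thesis using vf by (simp add: vcomp_def free_mod_def)
    qed
  qed
  finally have eq: "bd (Suc i) ?w = v" .
  have "hmg (Suc (Suc i)) d ?w"
    using w(1) by (simp add: hmg_def free_mod_def vcomp_def)
  moreover have "\<forall>l. v l - bd (Suc i) ?w l \<in> {0}" unfolding eq by simp
  ultimately show "\<exists>w. hmg (Suc (Suc i)) d w \<and> (\<forall>l. v l - bd (Suc i) w l \<in> {0})" by blast
qed

lemma graded_submodule_ideal:
  fixes I :: "('n, 'k::comm_ring_1) mpoly set"
  assumes I: "homogeneous_ideal I"
  shows "graded_submodule 1 (\<lambda>_. 0) {v \<in> free_mod 1. v 0 \<in> I}"
  unfolding graded_submodule_def
proof (intro conjI ballI allI)
  note sub = homogeneous_ideal_subspace[OF I]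
  show "vec.subspace {v \<in> free_mod 1. v 0 \<in> I}"
    by (intro vec.subspaceI)
      (auto simp: free_mod_def vscale_apply ideal.subspace_0[OF sub]
        intro: ideal.subspace_add[OF sub] ideal.subspace_scale[OF sub])
  fix v d assume "v \<in> {v \<in> free_mod 1. v 0 \<in> I}"
  then show "vcomp (\<lambda>_. 0) d v \<in> {v \<in> free_mod 1. v 0 \<in> I}"
    by (auto simp: free_mod_def vcomp_def homogeneous_ideal_hcomp[OF I])
qed auto

text \<open>Dependent choice of states (rank, degrees, module to be covered): a step covers the
  module by minimal generators and passes to their syzygies. These lie in the irrelevant ideal,
  which is minimality because the next differential maps onto them.\<close>

theorem minimal_graded_free_resolution_exists:
  fixes I :: "('n::{finite, linorder}, 'k::field) mpoly set"
  assumes I: "homogeneous_ideal I"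
  shows "\<exists>n b g D. minimal_graded_free_resolution I n b g D"
proof -
  define step where "step s t \<longleftrightarrow> (\<exists>M.
      (\<forall>j<fst t. \<forall>l<fst s. homogeneous (fst (snd t) j - fst (snd s) l) (M j l)) \<and>
      free_hom (fst t) (fst s) M ` free_mod (fst t) = snd (snd s) \<and>
      snd (snd t) = {v \<in> free_mod (fst t). free_hom (fst t) (fst s) M v = 0} \<and>
      (\<forall>v\<in>snd (snd t). \<forall>l. v l \<in> irrelevant_ideal))"
    for s t :: "nat \<times> (nat \<Rightarrow> int) \<times> (nat \<Rightarrow> ('n, 'k) mpoly) set"
  \<comment> \<open>The start is the ring itself with I as the module to be covered. So the sequence
    resolves R/I, and the resolution of I is its tail, shifted by one.\<close>
  define s0 :: "nat \<times> (nat \<Rightarrow> int) \<times> (nat \<Rightarrow> ('n, 'k) mpoly) set"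
    where "s0 = (1, \<lambda>_. 0, {v \<in> free_mod 1. v 0 \<in> I})"
  define good where "good s \<longleftrightarrow> graded_submodule (fst s) (fst (snd s)) (snd (snd s))"
    for s :: "nat \<times> (nat \<Rightarrow> int) \<times> (nat \<Rightarrow> ('n, 'k) mpoly) set"
  have "\<exists>f. \<forall>i. (good (f i) \<and> (i = 0 \<longrightarrow> f i = s0)) \<and> step (f i) (f (Suc i))"
  proof (rule dependent_nat_choice)
    show "\<exists>s. good s \<and> ((0::nat) = 0 \<longrightarrow> s = s0)"
      using graded_submodule_ideal[OF I] by (simp add: good_def s0_def)
    fix s and i :: nat assume "good s \<and> (i = 0 \<longrightarrow> s = s0)"
    then have s: "graded_submodule (fst s) (fst (snd s)) (snd (snd s))" by (simp add: good_def)
    obtain p b' M where M: "\<forall>j<p. \<forall>l<fst s. homogeneous (b' j - fst (snd s) l) (M j l)"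
      "free_hom p (fst s) M ` free_mod p = snd (snd s)"
      "\<forall>v\<in>free_mod p. free_hom p (fst s) M v = 0 \<longrightarrow> (\<forall>l. v l \<in> irrelevant_ideal)"
      using minimal_generators[OF s] by (elim exE conjE)
    define t where "t = (p, b', {v \<in> free_mod p. free_hom p (fst s) M v = 0})"
    have "good t"
      unfolding good_def t_def fst_conv snd_conv
      by (rule graded_submodule_kernel[where b = "fst (snd s)"]) (use M(1) in simp)
    moreover have "step s t"
      unfolding step_def t_def fst_conv snd_conv using M by (intro exI[of _ M]) simp
    ultimately show "\<exists>t. (good t \<and> (Suc i = 0 \<longrightarrow> t = s0)) \<and> step s t" by (intro exI[of _ t]) simp
  qed
  then obtain f where f: "\<forall>i. (good (f i) \<and> (i = 0 \<longrightarrow> f i = s0)) \<and> step (f i) (f (Suc i))" ..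
  define n where "n i = fst (f i)" for i
  define b where "b i = fst (snd (f i))" for i
  define K where "K i = snd (snd (f i))" for i
  have f0: "n 0 = 1" "b 0 = (\<lambda>_. 0)" "K 0 = {v \<in> free_mod 1. v 0 \<in> I}"
    using f by (auto simp: n_def b_def K_def s0_def)
  have "\<forall>i. step (f i) (f (Suc i))" using f by simp
  then have "\<forall>i. \<exists>M. (\<forall>j<n (Suc i). \<forall>l<n i. homogeneous (b (Suc i) j - b i l) (M j l)) \<and>
      free_hom (n (Suc i)) (n i) M ` free_mod (n (Suc i)) = K i \<and>
      K (Suc i) = {v \<in> free_mod (n (Suc i)). free_hom (n (Suc i)) (n i) M v = 0} \<and>
      (\<forall>v\<in>K (Suc i). \<forall>l. v l \<in> irrelevant_ideal)"
    unfolding step_def n_def b_def K_def .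
  from choice[OF this] obtain E where *:
    "\<forall>i. (\<forall>j<n (Suc i). \<forall>l<n i. homogeneous (b (Suc i) j - b i l) (E i j l)) \<and>
      free_hom (n (Suc i)) (n i) (E i) ` free_mod (n (Suc i)) = K i \<and>
      K (Suc i) = {v \<in> free_mod (n (Suc i)). free_hom (n (Suc i)) (n i) (E i) v = 0} \<and>
      (\<forall>v\<in>K (Suc i). \<forall>l. v l \<in> irrelevant_ideal)" ..
  let ?d = "\<lambda>i. free_hom (n (Suc i)) (n i) (E i)"
  from * have hom: "\<And>i j l. j < n (Suc i) \<Longrightarrow> l < n i \<Longrightarrow> homogeneous (b (Suc i) j - b i l) (E i j l)"
    and img: "\<And>i. ?d i ` free_mod (n (Suc i)) = K i"
    and ker: "\<And>i. K (Suc i) = {v \<in> free_mod (n (Suc i)). ?d i v = (\<lambda>_. 0)}"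
    and min: "\<And>i v l. v \<in> K (Suc i) \<Longrightarrow> v l \<in> irrelevant_ideal"
    by (simp_all add: zero_fun_def)
  interpret G: graded_complex n b E
  proof
    fix v :: "nat \<Rightarrow> ('n, 'k) mpoly" and i assume "v \<in> free_mod (n (Suc (Suc i)))"
    then have "?d (Suc i) v \<in> K (Suc i)"
      unfolding img[symmetric] by (rule imageI)
    then show "?d i (?d (Suc i) v) = (\<lambda>_. 0)"
      unfolding ker by simp
  qed (rule hom)
  have exact: "{v \<in> free_mod (n (Suc i)). ?d i v = (\<lambda>_. 0)} =
      ?d (Suc i) ` free_mod (n (Suc (Suc i)))" for i
    unfolding img ker ..
  have minimal: "?d (Suc i) v l \<in> irrelevant_ideal"
    if "v \<in> free_mod (n (Suc (Suc i)))" for i l and v :: "nat \<Rightarrow> ('n, 'k) mpoly"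
  proof (rule min)
    show "?d (Suc i) v \<in> K (Suc i)"
      unfolding img[symmetric] using that by (rule imageI)
  qed
  have zero: "n i = 0" if "i > CARD('n)" for i
  proof (rule G.minimal_complex_terminates[OF _ _ that])
    show "G.acyclic_mod {0} i d" if "i \<ge> 1" for i d
      using G.acyclic_mod_zero[OF exact, of "i - 1" d] that by simp
    show "G.bd i v l \<in> irrelevant_ideal" if "i \<ge> 1" "v \<in> free_mod (n (Suc i))"
      for i l and v :: "nat \<Rightarrow> ('n, 'k) mpoly"
      using minimal[of v "i - 1" l] that by simp
  qed
  have aug: "?d 0 v = (\<lambda>l. if l = 0 then \<Sum>j<n (Suc 0). v j * E 0 j 0 else 0)"
    for v :: "nat \<Rightarrow> ('n, 'k) mpoly"
    by (auto simp: free_hom_def f0 fun_eq_iff)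
  have "minimal_graded_free_resolution I (\<lambda>i. n (Suc i)) (\<lambda>i. b (Suc i)) (\<lambda>j. E 0 j 0) (\<lambda>i. E (Suc i))"
    unfolding minimal_graded_free_resolution_def
  proof (intro conjI)
    show "\<forall>i\<ge>CARD('n). n (Suc i) = 0" using zero by simp
    show "\<forall>j<n (Suc 0). homogeneous (b (Suc 0) j) (E 0 j 0)"
      using hom[of _ 0 0] f0 by simp
    show "\<forall>i. \<forall>j<n (Suc (Suc i)). \<forall>l<n (Suc i). homogeneous (b (Suc (Suc i)) j - b (Suc i) l) (E (Suc i) j l)"
      using hom by blast
    show "(\<lambda>v. \<Sum>j<n (Suc 0). v j * E 0 j 0) ` free_mod (n (Suc 0)) = I"
    proof (intro set_eqI iffI)
      fix x assume "x \<in> (\<lambda>v. \<Sum>j<n (Suc 0). v j * E 0 j 0) ` free_mod (n (Suc 0))"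
      then obtain v where v: "v \<in> free_mod (n (Suc 0))" "x = (\<Sum>j<n (Suc 0). v j * E 0 j 0)" by blast
      then have "?d 0 v \<in> K 0" unfolding img[symmetric] by blast
      then show "x \<in> I" using v(2) unfolding f0(3) aug by simp
    next
      fix x assume "x \<in> I"
      then have "(\<lambda>l. if l = 0 then x else 0) \<in> K 0" by (simp add: f0 free_mod_def)
      then obtain v where v: "v \<in> free_mod (n (Suc 0))"
        "(\<lambda>l. if l = 0 then x else 0) = ?d 0 v"
        unfolding img[symmetric] by blast
      from fun_cong[OF v(2), of 0] have "x = (\<Sum>j<n (Suc 0). v j * E 0 j 0)"
        unfolding aug by simp
      with v(1) show "x \<in> (\<lambda>v. \<Sum>j<n (Suc 0). v j * E 0 j 0) ` free_mod (n (Suc 0))" by blast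
    qed
    have "(?d 0 v = (\<lambda>_. 0)) \<longleftrightarrow> (\<Sum>j<n (Suc 0). v j * E 0 j 0) = 0" for v
      unfolding aug by (auto simp: fun_eq_iff)
    then show "{v \<in> free_mod (n (Suc 0)). (\<Sum>j<n (Suc 0). v j * E 0 j 0) = 0} =
        free_hom (n (Suc 1)) (n (Suc 0)) (E (Suc 0)) ` free_mod (n (Suc 1))"
      using exact[of 0] by simp
    show "\<forall>i. {v \<in> free_mod (n (Suc (Suc i))). ?d (Suc i) v = (\<lambda>_. 0)} =
        ?d (Suc (Suc i)) ` free_mod (n (Suc (Suc (Suc i))))"
      using exact by blast
    show "\<forall>i. \<forall>v\<in>free_mod (n (Suc (Suc i))). \<forall>l.
        ?d (Suc i) v l \<in> irrelevant_ideal"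
      using minimal by blast
  qed
  then show ?thesis by blast
qed

text \<open>Existence turns the choice in \<open>regularity\<close> into an actual resolution; the
  estimates below apply to whichever one it selects.\<close>

lemma regularity_eq_Max:
  fixes I :: "('n::{finite, linorder}, 'k::field) mpoly set"
  assumes "homogeneous_ideal I"
  obtains n b g D where "minimal_graded_free_resolution I n b g D"
    "regularity I = Max {b i j - int i | i j. i < CARD('n) \<and> j < n i}"
proof -
  have "\<exists>\<rho> n b g D. minimal_graded_free_resolution I n b g D \<and>
      \<rho> = Max {b i j - int i | i j. i < CARD('n) \<and> j < n i}"
    using minimal_graded_free_resolution_exists[OF assms] by blast
  from someI_ex[OF this] show thesis
    using that unfolding regularity_def by blast
qed

subsection \<open>Regularity and linear forms\<close>

lemma linear_decomposition:
  fixes I :: "('n, 'k::comm_ring_1) mpoly set"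
  assumes I: "homogeneous_ideal I" and l: "homogeneous 1 l"
    and f: "homogeneous d f" "f \<in> ideal.span (insert l I)"
  shows "\<exists>g h. g \<in> I \<and> homogeneous d g \<and> homogeneous (d - 1) h \<and> f = g + l * h"
proof -
  have span: "ideal.span I = I" using homogeneous_ideal_subspace[OF I] by (simp add: ideal.span_eq_iff)
  obtain k where k: "f - k * l \<in> I"
    using f(2) unfolding ideal.span_insert span by blast
  have "hcomp d (f - k * l) = f - l * hcomp (d - 1) k"
    using hcomp_mult_left[OF l, of d k] hcomp_homogeneous[OF f(1), of d]
    by (simp add: hcomp_diff mult.commute)
  then have "f - l * hcomp (d - 1) k \<in> I" "homogeneous d (f - l * hcomp (d - 1) k)"
    using homogeneous_ideal_hcomp[OF I k, of d] homogeneous_hcomp[of d "f - k * l"] by simp_all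
  then show ?thesis
    by (intro exI[of _ "f - l * hcomp (d - 1) k"] exI[of _ "hcomp (d - 1) k"]) simp
qed

text \<open>By the ascending chain condition \<open>I : l^e\<close> stabilises, and in large degrees every form
  is a multiple of \<open>l^e\<close> modulo \<open>I\<close>.\<close>
lemma linear_form_eventually_regular:
  fixes I :: "('n::{finite, linorder}, 'k::field) mpoly set"
  assumes I: "homogeneous_ideal I" and l: "homogeneous 1 l"
    and T: "\<And>d f. homogeneous d f \<Longrightarrow> d \<ge> T \<Longrightarrow> f \<in> ideal.span (insert l I)"
  shows "\<exists>T'. \<forall>d f. homogeneous d f \<longrightarrow> d \<ge> T' \<longrightarrow> l * f \<in> I \<longrightarrow> f \<in> I"
proof -
  note sub = homogeneous_ideal_subspace[OF I]
  define C where "C e = {w. l ^ e * w \<in> I}" for e :: nat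
  have "ideal.subspace (C e)" for e
    by (intro ideal.subspaceI)
      (auto simp: C_def ideal.subspace_0[OF sub] distrib_left ideal.subspace_add[OF sub]
        mult.left_commute[of "l ^ e"] ideal.subspace_scale[OF sub])
  then have "\<exists>J\<in>range C. \<forall>K\<in>range C. J \<subseteq> K \<longrightarrow> K = J"
    by (intro maximal_ideal_in_family) auto
  then obtain e where e: "\<And>K. K \<in> range C \<Longrightarrow> C e \<subseteq> K \<Longrightarrow> K = C e" by blast
  have "C e \<subseteq> C (Suc e)"
    by (auto simp: C_def mult.assoc ideal.subspace_scale[OF sub])
  then have Ce: "C (Suc e) = C e" using e by blast
  \<comment> \<open>Each factor l that is split off lowers the degree by one, so a factors require
    degree at least T + a.\<close>
  have decomp: "\<exists>g h. g \<in> I \<and> f = g + l ^ a * h" if "homogeneous d f" "d \<ge> T + int a" for f d a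
    using that
  proof (induction a arbitrary: d f)
    case 0
    then show ?case using ideal.subspace_0[OF sub] by (intro exI[of _ 0] exI[of _ f]) simp
  next
    case (Suc a)
    then obtain g h where g: "g \<in> I" and h: "homogeneous (d - 1) h" and f: "f = g + l * h"
      using linear_decomposition[OF I l Suc.prems(1) T[OF Suc.prems(1)]] by auto
    obtain g' h' where g': "g' \<in> I" and h': "h = g' + l ^ a * h'"
      using Suc.IH[OF h] Suc.prems(2) by auto
    have "f = (g + l * g') + l ^ Suc a * h'" by (simp add: f h' algebra_simps)
    moreover have "g + l * g' \<in> I" using g g' by (intro ideal.subspace_add[OF sub] ideal.subspace_scale[OF sub])
    ultimately show ?case by blast
  qed
  have "f \<in> I" if f: "homogeneous d f" "d \<ge> T + int e" "l * f \<in> I" for d f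
  proof -
    obtain g h where gh: "g \<in> I" "f = g + l ^ e * h" using decomp[OF f(1,2)] by blast
    have "l ^ Suc e * h = l * f - l * g" by (simp add: gh(2) algebra_simps)
    also have "\<dots> \<in> I" by (rule ideal.subspace_diff[OF sub f(3) ideal.subspace_scale[OF sub gh(1)]])
    finally have "h \<in> C e" unfolding Ce[symmetric] by (simp add: C_def)
    then show ?thesis using gh by (simp add: C_def ideal.subspace_add[OF sub])
  qed
  then show ?thesis by blast
qed

text \<open>With R in front, the resolution of I becomes one of R/I. Modulo l, its H_0 in degree d
  is R/(I + (l)) in degree d, and its H_1 in degree d + 1 is the kernel of l on R/I in degree d.
  Both vanish for d \<ge> \<rho> by \<open>acyclic_mod_bound\<close> with \<rho> - 1 for
  \<beta>.\<close>

theorem regularity_linear_form: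
  fixes I :: "('n::{finite, linorder}, 'k::field) mpoly set"
  assumes I: "homogeneous_ideal I" "I \<noteq> UNIV" "\<exists>f\<in>I. f \<noteq> 0"
    and l: "homogeneous 1 l" "l \<noteq> 0"
    and T: "\<And>d f. homogeneous d f \<Longrightarrow> d \<ge> T \<Longrightarrow> f \<in> ideal.span (insert l I)"
  shows "regularity I \<ge> 1"
    and "\<And>d f. homogeneous d f \<Longrightarrow> d \<ge> regularity I \<Longrightarrow> f \<in> ideal.span (insert l I)"
    and "\<And>d f. homogeneous d f \<Longrightarrow> d \<ge> regularity I \<Longrightarrow> l * f \<in> I \<Longrightarrow> f \<in> I"
proof -
  note sub = homogeneous_ideal_subspace[OF I(1)]
  have span_I: "ideal.span I = I" using sub by (simp add: ideal.span_eq_iff)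
  obtain n b g D where res: "minimal_graded_free_resolution I n b g D"
    and reg: "regularity I = Max {b i j - int i | i j. i < CARD('n) \<and> j < n i}"
    using regularity_eq_Max[OF I(1)] .
  define \<rho> where "\<rho> = regularity I"
  have n0: "\<And>i. i \<ge> CARD('n) \<Longrightarrow> n i = 0"
    and hom_g: "\<And>j. j < n 0 \<Longrightarrow> homogeneous (b 0 j) (g j)"
    and hom_D: "\<And>i j l. j < n (Suc i) \<Longrightarrow> l < n i \<Longrightarrow> homogeneous (b (Suc i) j - b i l) (D i j l)"
    and img_g: "(\<lambda>v. \<Sum>j<n 0. v j * g j) ` free_mod (n 0) = I"
    and ex0: "{v \<in> free_mod (n 0). (\<Sum>j<n 0. v j * g j) = 0} = free_hom (n 1) (n 0) (D 0) ` free_mod (n 1)"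
    and exS: "\<And>i. {v \<in> free_mod (n (Suc i)). free_hom (n (Suc i)) (n i) (D i) v = (\<lambda>_. 0)} =
       free_hom (n (Suc (Suc i))) (n (Suc i)) (D (Suc i)) ` free_mod (n (Suc (Suc i)))"
    using res unfolding minimal_graded_free_resolution_def by simp_all
  have le_rho: "b i j \<le> \<rho> + int i" if "j < n i" for i j
  proof -
    have "i < CARD('n)" using n0[of i] that by (cases "i < CARD('n)") auto
    have "{b i j - int i | i j. i < CARD('n) \<and> j < n i} =
        (\<lambda>(i, j). b i j - int i) ` (SIGMA i:{..<CARD('n)}. {..<n i})" by auto
    then have "finite {b i j - int i | i j. i < CARD('n) \<and> j < n i}" by simp
    then have "b i j - int i \<le> \<rho>"
      unfolding \<rho>_def reg using that \<open>i < CARD('n)\<close> by (intro Max_ge) auto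
    then show ?thesis by simp
  qed
  \<comment> \<open>Some generator is nonzero and lies in a proper homogeneous ideal, so its degree
    is positive.\<close>
  have "\<rho> \<ge> 1"
  proof -
    obtain f where f: "f \<in> I" "f \<noteq> 0" using I(3) by blast
    then obtain v where "f = (\<Sum>j<n 0. v j * g j)" using img_g by blast
    then obtain j where j: "j < n 0" "g j \<noteq> 0"
      using f(2) sum.neutral[of "{..<n 0}" "\<lambda>j. v j * g j"] by force
    let ?e = "\<lambda>i. if i = j then 1 else 0 :: ('n, 'k) mpoly"
    have "(\<Sum>i<n 0. ?e i * g i) = g j"
      using j(1) by (simp add: if_distrib[of "\<lambda>x. x * _"] cong: if_cong)
    moreover have "?e \<in> free_mod (n 0)" using j(1) by (simp add: free_mod_def)
    ultimately have "g j \<in> (\<lambda>v. \<Sum>j<n 0. v j * g j) ` free_mod (n 0)"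
      by (intro image_eqI[of _ _ ?e]) simp_all
    then have "g j \<in> I" unfolding img_g .
    then have "lookup (g j) 0 = 0"
      using homogeneous_ideal_subset_irrelevant[OF I(1,2)] by (auto simp: irrelevant_ideal_eq)
    then have "b 0 j \<noteq> 0"
      using homogeneous_zero_const[of "g j"] hom_g[OF j(1)] j(2) by auto
    moreover have "\<not> b 0 j < 0" using homogeneous_neg[OF hom_g[OF j(1)]] j(2) by blast
    ultimately show ?thesis using le_rho[OF j(1)] by simp
  qed
  then show "regularity I \<ge> 1" by (simp add: \<rho>_def)
  \<comment> \<open>R itself becomes homological degree 0, with a single generator of degree
    0.\<close>
  define n' where "n' = case_nat 1 n"
  define b' where "b' = case_nat (\<lambda>_. 0) b"
  define D' where "D' = case_nat (\<lambda>j _. g j) D"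
  have simps [simp]: "n' 0 = Suc 0" "n' (Suc i) = n i" "b' 0 = (\<lambda>_. 0)" "b' (Suc i) = b i"
    "D' 0 = (\<lambda>j _. g j)" "D' (Suc i) = D i" for i
    by (simp_all add: n'_def b'_def D'_def)
  have aug: "free_hom (n 0) (Suc 0) (\<lambda>j _. g j) v = (\<lambda>l. if l = 0 then \<Sum>j<n 0. v j * g j else 0)" for v
    by (auto simp: free_hom_def fun_eq_iff)
  have aug0: "free_hom (n 0) (Suc 0) (\<lambda>j _. g j) v = (\<lambda>_. 0) \<longleftrightarrow> (\<Sum>j<n 0. v j * g j) = 0" for v
    unfolding aug by (auto simp: fun_eq_iff)
  have exact: "{v \<in> free_mod (n' (Suc i)). free_hom (n' (Suc i)) (n' i) (D' i) v = (\<lambda>_. 0)} =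
      free_hom (n' (Suc (Suc i))) (n' (Suc i)) (D' (Suc i)) ` free_mod (n' (Suc (Suc i)))" for i
  proof (cases i)
    case 0
    then show ?thesis using ex0 by (simp add: aug0)
  next
    case (Suc k)
    then show ?thesis using exS[of k] by simp
  qed
  interpret G: graded_complex n' b' D'
  proof
    show "homogeneous (b' (Suc i) j - b' i l) (D' i j l)" if "j < n' (Suc i)" "l < n' i" for i j l
      using that hom_g hom_D by (cases i) auto
    show "free_hom (n' (Suc i)) (n' i) (D' i) (free_hom (n' (Suc (Suc i))) (n' (Suc i)) (D' (Suc i)) v) = (\<lambda>_. 0)"
      if "v \<in> free_mod (n' (Suc (Suc i)))" for i v
      using exact[of i] that by blast
  qed
  have acyc0: "G.acyclic_mod {0} (Suc i) d" for i d
    by (rule G.acyclic_mod_zero[OF exact])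
  let ?L = "ideal.span {l}"
  have ext: "regular_ext {0} l ?L"
    using regular_ext_insert[of "{}" l] l homogeneous_ideal_span[of "{}"] by simp
  have mult_L: "l * f \<in> ?L" for f
    by (simp add: mult.commute ideal.span_scale ideal.span_base)
  have subL: "ideal.subspace ?L" by simp
  have lift: "\<exists>w. G.hmg 1 d w \<and> G.bd 0 w 0 = f" if f: "f \<in> I" "homogeneous d f" for d f
  proof -
    obtain v where v: "v \<in> free_mod (n 0)" "f = (\<Sum>j<n 0. v j * g j)" using f(1) img_g by blast
    let ?w = "vcomp (b' 1) d v"
    have "G.bd 0 ?w = vcomp (b' 0) d (G.bd 0 v)"
      using hcomp_free_hom[of "n' 1" "n' 0" "b' 1" "b' 0" "D' 0" d v] G.homogeneous_D[of _ 0] by simp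
    then have "G.bd 0 ?w 0 = hcomp d f"
      by (simp add: vcomp_def aug v(2))
    then have "G.bd 0 ?w 0 = f" using f(2) by (simp add: hcomp_homogeneous)
    moreover have "G.hmg 1 d ?w" using v(1) by (simp add: G.hmg_def vcomp_def free_mod_def)
    ultimately show ?thesis by blast
  qed
  \<comment> \<open>The descent needs vanishing in large degrees: for i = 0 it is the assumption on
    T, for i = 1 the eventual injectivity of l on R/I, and for i \<ge> 2 it follows from exactness,
    as l is a nonzerodivisor on R.\<close>
  have fin: "\<exists>T. \<forall>d\<ge>T. G.acyclic_mod ?L i d" for i
  proof -
    consider "i = 0" | "i = 1" | k where "i = Suc (Suc k)" by (metis One_nat_def not0_implies_Suc)
    then show ?thesis
    proof cases
      case 1
      have "G.acyclic_mod ?L 0 d" if "d \<ge> T" for d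
        unfolding G.acyclic_mod_def
      proof (intro allI impI)
        fix v assume v: "G.hmg 0 d v"
        then have "homogeneous d (v 0)" by (simp add: G.hmg_def)
        from linear_decomposition[OF I(1) l(1) this T[OF this that]] obtain f h
          where fh: "f \<in> I" "homogeneous d f" "v 0 = f + l * h" by blast
        obtain w where w: "G.hmg 1 d w" "G.bd 0 w 0 = f" using lift[OF fh(1,2)] by blast
        have "v k - G.bd 0 w k \<in> ?L" for k
        proof (cases "k = 0")
          case True
          then show ?thesis using w(2) fh(3) mult_L by simp
        next
          case False
          then have "v k = 0" "G.bd 0 w k = 0" using v by (simp_all add: G.hmg_def free_mod_def free_hom_def)
          then show ?thesis by (simp add: ideal.span_zero)
        qed
        with w(1) show "\<exists>w. G.hmg (Suc 0) d w \<and> (\<forall>l. v l - G.bd 0 w l \<in> ?L)" by auto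
      qed
      with 1 show ?thesis by blast
    next
      case 2
      have "\<exists>T'. \<forall>d f. homogeneous d f \<longrightarrow> d \<ge> T' \<longrightarrow> l * f \<in> I \<longrightarrow> f \<in> I"
        by (rule linear_form_eventually_regular[OF I(1) l(1)]) (rule T)
      then obtain T' where T': "\<forall>d f. homogeneous d f \<longrightarrow> d \<ge> T' \<longrightarrow> l * f \<in> I \<longrightarrow> f \<in> I" ..
      have "G.acyclic_mod ?L 1 d" if d: "d \<ge> T' + 1" for d
        unfolding G.acyclic_mod_def
      proof (intro allI impI)
        fix v assume v: "G.hmg 1 d v" and cyc: "G.cycle_mod ?L 1 v"
        have "G.hmg 0 d (G.bd 0 v)" using G.hmg_bd[of 0 d v] v by simp
        moreover have "G.bd 0 v k \<in> ?L" for k using cyc G.cycle_mod_Suc[of ?L 0 v] by simp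
        ultimately obtain w where w: "G.hmg 0 (d - 1) w" "\<And>k. G.bd 0 v k - l * w k \<in> {0}"
          using G.regular_ext_vector[OF ext, of 0 d "G.bd 0 v"] by blast
        have eq: "G.bd 0 v 0 = l * w 0" using w(2)[of 0] by simp
        have "G.bd 0 v 0 \<in> I"
          using v img_g by (auto simp: aug G.hmg_def)
        then have "w 0 \<in> I"
          using T'[rule_format, of "d - 1" "w 0"] w(1) d eq by (simp add: G.hmg_def)
        then obtain z where z: "G.hmg 1 (d - 1) z" "G.bd 0 z 0 = w 0"
          using lift[of "w 0" "d - 1"] w(1) by (auto simp: G.hmg_def)
        have "G.cycle_mod {0} 1 (\<lambda>k. v k - l * z k)"
        proof -
          have "G.bd 0 (\<lambda>k. v k - l * z k) k = 0" for k
          proof (cases "k = 0")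
            case True
            then show ?thesis using eq z(2) by (simp add: G.bd_diff G.bd_scale del: simps)
          next
            case False
            then show ?thesis by (simp add: free_hom_def)
          qed
          then show ?thesis using G.cycle_mod_Suc[of "{0}" 0] by simp
        qed
        moreover have "G.hmg 1 d (\<lambda>k. v k - l * z k)"
          by (intro G.hmg_diff v G.hmg_scale l z)
        ultimately obtain y where y: "G.hmg 2 d y" "\<And>k. v k - l * z k - G.bd 1 y k \<in> {0}"
          using acyc0[of 0 d] unfolding G.acyclic_mod_def numeral_2_eq_2 One_nat_def by blast
        have "v k - G.bd 1 y k = l * z k" for k using y(2)[of k] by (simp add: algebra_simps)
        then have "\<forall>k. v k - G.bd 1 y k \<in> ?L" using mult_L by simp
        with y(1) show "\<exists>w. G.hmg (Suc 1) d w \<and> (\<forall>l. v l - G.bd 1 w l \<in> ?L)"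
          unfolding numeral_2_eq_2 One_nat_def by blast
      qed
      with 2 show ?thesis by blast
    next
      case 3
      have "G.acyclic_mod ?L i d" for d
        unfolding 3 by (rule G.acyclic_mod_ext[OF ext acyc0]) (use acyc0 in auto)
      then show ?thesis by blast
    qed
  qed
  \<comment> \<open>The index shift turns \<rho> + i into \<rho> - 1 + i; for the new summand R this
    reads 0 \<le> \<rho> - 1.\<close>
  have b'_le: "b' i k \<le> (\<rho> - 1) + int i" if "k < n' i" for i k
    using that le_rho \<open>\<rho> \<ge> 1\<close> by (cases i) fastforce+
  obtain j where j: "single j 1 \<in> keys l"
    using linear_form_key[OF l] by blast
  have acyc: "G.acyclic_mod ?L i d" if "d > \<rho> - 1 + int i" for i d
    using G.acyclic_mod_bound[OF l(1) j b'_le, of "{}" i d] fin that by simp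
  show "f \<in> ideal.span (insert l I)" if f: "homogeneous d f" "d \<ge> regularity I" for d f
  proof -
    let ?v = "\<lambda>k. if k = (0::nat) then f else 0"
    have "G.hmg 0 d ?v" using f by (simp add: G.hmg_def free_mod_def)
    then obtain w where w: "G.hmg 1 d w" "\<And>k. ?v k - G.bd 0 w k \<in> ?L"
      using acyc[of 0 d] f(2) unfolding G.acyclic_mod_def \<rho>_def by auto
    have "G.bd 0 w 0 \<in> I" using w(1) img_g by (auto simp: aug G.hmg_def)
    then have "G.bd 0 w 0 \<in> ideal.span (insert l I)" by (intro ideal.span_base) simp
    moreover have "?L \<subseteq> ideal.span (insert l I)" by (rule ideal.span_mono) simp
    then have "f - G.bd 0 w 0 \<in> ideal.span (insert l I)" using w(2)[of 0] by auto
    ultimately have "f - G.bd 0 w 0 + G.bd 0 w 0 \<in> ideal.span (insert l I)"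
      by (intro ideal.span_add)
    then show ?thesis by simp
  qed
  show "f \<in> I" if f: "homogeneous d f" "d \<ge> regularity I" "l * f \<in> I" for d f
  proof -
    have "homogeneous (d + 1) (l * f)" using homogeneous_mult[OF l(1) f(1)] by (simp add: add.commute)
    then obtain v where v: "G.hmg 1 (d + 1) v" "G.bd 0 v 0 = l * f"
      using lift[OF f(3)] by blast
    have "G.bd 0 v k \<in> ?L" for k
      using v(2) mult_L ideal.span_zero by (cases "k = 0") (auto simp: free_hom_def)
    then have "G.cycle_mod ?L 1 v" using G.cycle_mod_Suc[of ?L 0 v] by simp
    then obtain u where u: "G.hmg 2 (d + 1) u" "\<And>k. v k - G.bd 1 u k \<in> ?L"
      using acyc[of 1 "d + 1"] f(2) v(1) unfolding G.acyclic_mod_def \<rho>_def numeral_2_eq_2 by auto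
    have "G.hmg 1 (d + 1) (\<lambda>k. v k - G.bd 1 u k)"
      using G.hmg_diff[OF v(1), of "G.bd 1 u"] G.hmg_bd[of 1 "d + 1" u] u(1) by (simp add: numeral_2_eq_2)
    \<comment> \<open>Here v is a boundary plus l y. Applying the augmentation and cancelling l
      exhibits y as a preimage of f.\<close>
    from G.regular_ext_vector[OF ext this u(2)] obtain y
      where y: "G.hmg 1 d y" "\<And>k. v k - G.bd 1 u k - l * y k \<in> {0}" by auto
    have "G.bd 0 (G.bd 1 u) = (\<lambda>_. 0)"
      using G.complex[of u 0] u(1) by (simp add: G.hmg_def numeral_2_eq_2)
    then have eq: "G.bd 0 (\<lambda>k. v k - G.bd 1 u k - l * y k) 0 = l * f - l * G.bd 0 y 0"
      using v(2) by (simp add: G.bd_diff G.bd_scale del: simps)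
    have "(\<lambda>k. v k - G.bd 1 u k - l * y k) = (\<lambda>_. 0)" using y(2) by (simp add: fun_eq_iff)
    then have "l * f - l * G.bd 0 y 0 = G.bd 0 (\<lambda>_. 0) 0" using eq by (simp only:)
    then have "l * f = l * G.bd 0 y 0" by (simp add: free_hom_def)
    then have "f = G.bd 0 y 0" using l(2) by simp
    also have "\<dots> \<in> I" using y(1) img_g by (auto simp: aug G.hmg_def)
    finally show ?thesis .
  qed
qed

subsection \<open>Regularity of products\<close>

text \<open>What is kept of the bound reg I \<le> \<rho>. Unlike a resolution, these two conditions
  can be transported to products, where the thresholds add.\<close>

definition regular_above :: "('n, 'k::comm_ring_1) mpoly \<Rightarrow> ('n, 'k) mpoly set \<Rightarrow> nat \<Rightarrow> bool" where
  "regular_above l I \<rho> \<longleftrightarrow> homogeneous_ideal I \<and>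
     (\<forall>d f. homogeneous d f \<longrightarrow> d \<ge> int \<rho> \<longrightarrow> l * f \<in> I \<longrightarrow> f \<in> I) \<and>
     (\<forall>d f. homogeneous d f \<longrightarrow> d \<ge> int \<rho> \<longrightarrow> f \<in> ideal.span (insert l I))"

lemma regular_above_mono: "regular_above l I \<rho> \<Longrightarrow> \<rho> \<le> \<sigma> \<Longrightarrow> regular_above l I \<sigma>"
  unfolding regular_above_def by (meson of_nat_mono order_trans)

lemma regular_above_cancel:
  "regular_above l I \<rho> \<Longrightarrow> homogeneous d f \<Longrightarrow> d \<ge> int \<rho> \<Longrightarrow> l * f \<in> I \<Longrightarrow> f \<in> I"
  unfolding regular_above_def by blast

lemma regular_above_decomp:
  assumes "regular_above l I \<rho>" "homogeneous 1 l" "homogeneous d f" "d \<ge> int \<rho>"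
  shows "\<exists>g h. g \<in> I \<and> homogeneous d g \<and> homogeneous (d - 1) h \<and> f = g + l * h"
  using assms linear_decomposition[of I l d f] unfolding regular_above_def by blast

section \<open>Generation of an ideal from its threshold degree upwards\<close>

lemma exists_monomial_factor:
  assumes "monom_degree (u :: 'n::finite \<Rightarrow>\<^sub>0 nat) = Suc k"
  shows "\<exists>i w. u = single i 1 + w \<and> monom_degree w = k"
proof -
  have "u \<noteq> 0" using assms by auto
  then obtain i where "lookup u i \<noteq> 0" by (metis lookup_zero poly_mapping_eqI)
  from single_add_diff[OF this] have u: "u = single i 1 + (u - single i 1)" ..
  moreover have "monom_degree (u - single i 1) = k"
    using assms monom_degree_add[of "single i 1" "u - single i 1"]
    unfolding u[symmetric] by simp
  ultimately show ?thesis by blast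
qed

lemma monomial_split:
  "monom_degree (u :: 'n::finite \<Rightarrow>\<^sub>0 nat) = a + b \<Longrightarrow>
     \<exists>m z. u = m + z \<and> monom_degree m = a \<and> monom_degree z = b"
proof (induction a arbitrary: u)
  case 0
  then show ?case by (intro exI[of _ 0] exI[of _ u]) simp
next
  case (Suc a)
  then obtain i w where u: "u = single i 1 + w" "monom_degree w = a + b"
    using exists_monomial_factor[of u "a + b"] by auto
  obtain m z where "w = m + z" "monom_degree m = a" "monom_degree z = b" using Suc.IH[OF u(2)] by blast
  then show ?case
    using u(1) by (intro exI[of _ "single i 1 + m"] exI[of _ z]) (simp add: add.assoc)
qed

lemma form_split:
  fixes f :: "('n::finite, 'k::comm_ring_1) mpoly"
  assumes "homogeneous (d + 1) f" "d \<ge> 0"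
  shows "\<exists>k. f = (\<Sum>i\<in>UNIV. var i * k i) \<and> (\<forall>i. homogeneous d (k i))"
  using assms(1)
proof (induction rule: mpoly_homogeneous_induct)
  case zero
  show ?case by (intro exI[of _ "\<lambda>_. 0"]) simp
next
  case (add f g)
  then obtain k k' where "f = (\<Sum>i\<in>UNIV. var i * k i)" "\<And>i. homogeneous d (k i)"
    "g = (\<Sum>i\<in>UNIV. var i * k' i)" "\<And>i. homogeneous d (k' i)" by auto
  then show ?case
    by (intro exI[of _ "\<lambda>i. k i + k' i"]) (simp add: distrib_left sum.distrib homogeneous_add)
next
  case (monom u c)
  then have "monom_degree u = Suc (nat d)" using assms(2) by linarith
  then obtain j w where u: "u = single j 1 + w" "monom_degree w = nat d"
    using exists_monomial_factor by blast
  let ?k = "\<lambda>i. if i = j then const c * monom w else 0 :: ('n, 'k) mpoly"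
  have "(\<Sum>i\<in>UNIV. var i * ?k i) = (\<Sum>i\<in>UNIV. if i = j then var j * (const c * monom w) else 0)"
    by (rule sum.cong) auto
  also have "\<dots> = var j * (const c * monom w)" by simp
  also have "\<dots> = const c * monom u"
    unfolding u(1) var_mult_monom[symmetric] by (rule mult.left_commute)
  finally have "const c * monom u = (\<Sum>i\<in>UNIV. var i * ?k i)" ..
  moreover have "homogeneous d (?k i)" for i
    using u(2) assms(2) by (auto intro!: homogeneous_const_mult homogeneous_single)
  ultimately show ?case by (intro exI[of _ ?k] conjI allI)
qed

text \<open>Write f as a combination of the variables and reduce each coefficient modulo l to an
  element of I. The remainders combine to l H, so H lies in I by cancellation, and expanding l
  itself in the variables distributes l H over them.\<close>

lemma regular_above_generate_step:
  fixes l :: "('n::finite, 'k::comm_ring_1) mpoly"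
  assumes I: "regular_above l I \<rho>" and l: "homogeneous 1 l"
    and f: "f \<in> I" "homogeneous (d + 1) f" "d \<ge> int \<rho>"
  shows "\<exists>k. f = (\<Sum>i\<in>UNIV. var i * k i) \<and> (\<forall>i. k i \<in> I \<and> homogeneous d (k i))"
proof -
  have sub: "ideal.subspace I" using I by (simp add: regular_above_def homogeneous_ideal_subspace)
  obtain k where k: "f = (\<Sum>i\<in>UNIV. var i * k i)" "\<And>i. homogeneous d (k i)"
    using form_split[OF f(2)] f(3) by auto
  have "\<forall>i. \<exists>g h. g \<in> I \<and> homogeneous d g \<and> homogeneous (d - 1) h \<and> k i = g + l * h"
    using regular_above_decomp[OF I l k(2) f(3)] by blast
  from choice[OF this] obtain g
    where "\<forall>i. \<exists>h. g i \<in> I \<and> homogeneous d (g i) \<and> homogeneous (d - 1) h \<and> k i = g i + l * h" ..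
  from choice[OF this] obtain h
    where gh: "\<forall>i. g i \<in> I \<and> homogeneous d (g i) \<and> homogeneous (d - 1) (h i) \<and> k i = g i + l * h i" ..
  obtain c where c: "l = (\<Sum>i\<in>UNIV. var i * c i)" "\<And>i. homogeneous 0 (c i)"
    using form_split[of 0 l] l by auto
  let ?H = "\<Sum>i\<in>UNIV. var i * h i"
  have "homogeneous d (var i * h i)" for i
    using homogeneous_mult[OF homogeneous_var[of i], of "d - 1" "h i"] gh by simp
  then have H: "homogeneous d ?H" by (intro homogeneous_sum)
  have "f = (\<Sum>i\<in>UNIV. var i * (g i + l * h i))" unfolding k(1) using gh by simp
  also have "\<dots> = (\<Sum>i\<in>UNIV. var i * g i) + l * ?H"
    by (simp add: distrib_left sum.distrib sum_distrib_left mult.left_commute)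
  finally have fH: "f = (\<Sum>i\<in>UNIV. var i * g i) + l * ?H" .
  have "(\<Sum>i\<in>UNIV. var i * g i) \<in> I"
    using gh by (intro ideal.subspace_sum[OF sub] ideal.subspace_scale[OF sub]) blast
  then have "f - (\<Sum>i\<in>UNIV. var i * g i) \<in> I" by (rule ideal.subspace_diff[OF sub f(1)])
  moreover have "f - (\<Sum>i\<in>UNIV. var i * g i) = l * ?H" using fH by simp
  ultimately have "l * ?H \<in> I" by simp
  then have HI: "?H \<in> I" by (rule regular_above_cancel[OF I H f(3)])
  have "l * ?H = (\<Sum>i\<in>UNIV. (var i * c i) * ?H)" by (subst c(1)) (rule sum_distrib_right)
  then have "f = (\<Sum>i\<in>UNIV. var i * (g i + c i * ?H))"
    by (subst fH) (simp only: distrib_left sum.distrib mult.assoc)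
  moreover have "g i + c i * ?H \<in> I" for i
    using gh HI by (intro ideal.subspace_add[OF sub] ideal.subspace_scale[OF sub]) blast+
  moreover have "homogeneous d (g i + c i * ?H)" for i
    using homogeneous_mult[OF c(2) H] gh by (intro homogeneous_add) auto
  ultimately show ?thesis by (intro exI[of _ "\<lambda>i. g i + c i * ?H"]) blast
qed

text \<open>Iterating the step splits off one variable per degree. The predicate Q must vary in the
  induction, since the hypothesis is applied to Q at x_i times the argument.\<close>

lemma regular_above_generate:
  fixes l :: "('n::finite, 'k::comm_ring_1) mpoly"
  assumes I: "regular_above l I \<rho>" and l: "homogeneous 1 l"
    and "f \<in> I" "homogeneous (int \<rho> + int k) f"
    and "Q 0" "\<And>x y. Q x \<Longrightarrow> Q y \<Longrightarrow> Q (x + y)"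
    and "\<And>u a. monom_degree u = k \<Longrightarrow> a \<in> I \<Longrightarrow> homogeneous (int \<rho>) a \<Longrightarrow> Q (monom u * a)"
  shows "Q f"
  using assms(3-)
proof (induction k arbitrary: f Q)
  case 0
  then show ?case using "0.prems"(5)[of 0 f] by simp
next
  case (Suc k)
  have "homogeneous (int \<rho> + int k + 1) f" using Suc.prems(2) by (simp add: algebra_simps)
  from regular_above_generate_step[OF I l Suc.prems(1) this] obtain g
    where g: "f = (\<Sum>i\<in>UNIV. var i * g i)" "\<And>i. g i \<in> I" "\<And>i. homogeneous (int \<rho> + int k) (g i)"
    by auto
  have "Q (var i * g i)" for i
  proof (rule Suc.IH[OF g(2,3), where Q = "\<lambda>x. Q (var i * x)"])
    show "Q (var i * 0)" using Suc.prems(3) by simp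
    show "Q (var i * (x + y))" if "Q (var i * x)" "Q (var i * y)" for x y
      using Suc.prems(4)[OF that] by (simp add: distrib_left)
    show "Q (var i * (monom u * a))" if "monom_degree u = k" "a \<in> I" "homogeneous (int \<rho>) a" for u a
      using Suc.prems(5)[of "single i 1 + u" a] that
      by (simp add: var_mult_monom flip: mult.assoc)
  qed
  then have "Q (\<Sum>i\<in>A. var i * g i)" for A
    by (induction A rule: infinite_finite_induct) (simp_all add: Suc.prems(3,4))
  then show ?case unfolding g(1) .
qed

text \<open>Linear over k only: a value is prescribed for each monomial, with no relation among the
  values.\<close>

definition lin :: "(('n \<Rightarrow>\<^sub>0 nat) \<Rightarrow> ('n, 'k::comm_ring_1) mpoly) \<Rightarrow> ('n, 'k) mpoly \<Rightarrow> ('n, 'k) mpoly" where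
  "lin \<phi> f = (\<Sum>u\<in>keys f. const (lookup f u) * \<phi> u)"

lemma lin_superset:
  "finite A \<Longrightarrow> keys f \<subseteq> A \<Longrightarrow> lin \<phi> f = (\<Sum>u\<in>A. const (lookup f u) * \<phi> u)"
  unfolding lin_def by (rule sum.mono_neutral_left) (auto simp: in_keys_iff)

lemma lin_add: "lin \<phi> (f + g) = lin \<phi> f + lin \<phi> g"
proof -
  let ?A = "keys f \<union> keys g"
  have "lin \<phi> (f + g) = (\<Sum>u\<in>?A. const (lookup (f + g) u) * \<phi> u)"
    using Poly_Mapping.keys_add[of f g] by (intro lin_superset) auto
  also have "\<dots> = (\<Sum>u\<in>?A. const (lookup f u) * \<phi> u) + (\<Sum>u\<in>?A. const (lookup g u) * \<phi> u)"
    by (simp add: lookup_add single_add distrib_right sum.distrib)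
  also have "\<dots> = lin \<phi> f + lin \<phi> g" by (simp add: lin_superset[of ?A])
  finally show ?thesis .
qed

lemma lin_zero [simp]: "lin \<phi> 0 = 0"
  by (simp add: lin_def)

lemma lin_sum: "lin \<phi> (sum f A) = (\<Sum>a\<in>A. lin \<phi> (f a))"
  by (induction A rule: infinite_finite_induct) (simp_all add: lin_add)

lemma lin_monom: "lin \<phi> (const c * monom u) = const c * \<phi> u"
  using lin_superset[of "{u}" "const c * monom u" \<phi>] by (simp add: mult_single)

text \<open>Monomials of degree \<open>\<rho>\<close> and \<open>d\<close> are lifted modulo \<open>l\<close> to elements of \<open>I\<close> and \<open>J\<close>.  Since the
  syzygies of the monomials of a given degree are linear, the resulting products in \<open>I J\<close> depend,
  modulo \<open>l I J\<close>, only on the monomial of degree \<open>\<rho> + d + 1\<close> that they lift.\<close>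
locale regular_pair =
  fixes l :: "('n::{finite, linorder}, 'k::field) mpoly" and I J :: "('n, 'k) mpoly set" and \<rho> d :: nat
  assumes l: "homogeneous 1 l" "l \<noteq> 0" and I: "regular_above l I \<rho>" and J: "regular_above l J d"
begin

text \<open>Taking l I J as modulus instead of I J makes the final cancellation possible: in a
  domain, l f in l I J gives f in I J.\<close>

definition E :: "('n, 'k) mpoly set" where
  "E = (\<lambda>k. l * k) ` ideal_mult I J"

lemma subI: "ideal.subspace I" and subJ: "ideal.subspace J"
  using I J by (simp_all add: regular_above_def homogeneous_ideal_subspace)

lemma E_subspace: "ideal.subspace E"
proof -
  note sub = ideal_mult_subspace[of I J]
  show ?thesis
  proof (rule ideal.subspaceI)
    show "0 \<in> E" using ideal.subspace_0[OF sub] by (auto simp: E_def intro: image_eqI[of _ _ 0])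
    show "x + y \<in> E" if xy: "x \<in> E" "y \<in> E" for x y
    proof -
      obtain a b where "a \<in> ideal_mult I J" "b \<in> ideal_mult I J" "x = l * a" "y = l * b"
        using xy by (auto simp: E_def)
      then show ?thesis using ideal.subspace_add[OF sub, of a b]
        by (auto simp: E_def distrib_left intro!: image_eqI[of _ _ "a + b"])
    qed
    show "c * x \<in> E" if x: "x \<in> E" for c x
    proof -
      obtain a where "a \<in> ideal_mult I J" "x = l * a" using x by (auto simp: E_def)
      then show ?thesis using ideal.subspace_scale[OF sub, of a c]
        by (auto simp: E_def mult.left_commute intro!: image_eqI[of _ _ "c * a"])
    qed
  qed
qed

lemma mem_E: "k \<in> ideal_mult I J \<Longrightarrow> l * k \<in> E"
  unfolding E_def by (rule imageI)

lemma E_trans: "x - y \<in> E \<Longrightarrow> y - z \<in> E \<Longrightarrow> x - z \<in> E"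
  using ideal.subspace_add[OF E_subspace, of "x - y" "y - z"] by simp

text \<open>The degree of a is one too small for cancelling l; a variable is borrowed from b, whose
  degree is one above d.\<close>

lemma mult_left_E:
  assumes a: "l * a \<in> I" "homogeneous (int \<rho> - 1) a" and b: "b \<in> J" "homogeneous (int d + 1) b"
  shows "l * a * b \<in> E"
proof -
  obtain k where k: "b = (\<Sum>i\<in>UNIV. var i * k i)" "\<And>i. k i \<in> J"
    using regular_above_generate_step[OF J l(1) b] by auto
  have "(a * var i) * k i \<in> ideal_mult I J" for i
  proof (rule ideal_mult_mem[OF _ k(2)])
    have "homogeneous (int \<rho>) (a * var i)"
      using homogeneous_mult[OF a(2) homogeneous_var[of i]] by simp
    moreover have "l * (a * var i) \<in> I"
      using subspace_mult_right[OF subI a(1), of "var i"] by (simp add: mult.assoc)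
    ultimately show "a * var i \<in> I" by (rule regular_above_cancel[OF I _ order_refl])
  qed
  then have "l * (\<Sum>i\<in>UNIV. (a * var i) * k i) \<in> E"
    by (intro mem_E ideal.subspace_sum[OF ideal_mult_subspace])
  moreover have "l * (\<Sum>i\<in>UNIV. (a * var i) * k i) = l * a * b"
    unfolding k(1) by (simp add: sum_distrib_left mult.assoc)
  ultimately show ?thesis by simp
qed

lemma mult_right_E:
  assumes a: "a \<in> I" and b: "l * b \<in> J" "homogeneous (int d) b"
  shows "a * (l * b) \<in> E"
proof -
  have "b \<in> J" using regular_above_cancel[OF J b(2) _ b(1)] by simp
  then have "l * (a * b) \<in> E" by (intro mem_E ideal_mult_mem a)
  then show ?thesis by (simp add: mult.left_commute)
qed

lemma mult_left_E':
  assumes a: "l * a \<in> I" "homogeneous (int \<rho>) a" and b: "b \<in> J"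
  shows "l * a * b \<in> E"
proof -
  have "a \<in> I" using regular_above_cancel[OF I a(2) _ a(1)] by simp
  then have "l * (a * b) \<in> E" using b by (intro mem_E ideal_mult_mem)
  then show ?thesis by (simp add: mult.assoc)
qed

definition lift :: "('n, 'k) mpoly set \<Rightarrow> ('n \<Rightarrow>\<^sub>0 nat) \<Rightarrow> ('n, 'k) mpoly" where
  "lift K m = (SOME g. g \<in> K \<and> homogeneous (int (monom_degree m)) g \<and>
     (\<exists>h. homogeneous (int (monom_degree m) - 1) h \<and> monom m = g + l * h))"

lemma lift:
  assumes "regular_above l K e" "monom_degree m = e"
  shows "lift K m \<in> K" "\<exists>h. homogeneous (int e - 1) h \<and> monom m = lift K m + l * h"
proof -
  have "\<exists>g. g \<in> K \<and> homogeneous (int (monom_degree m)) g \<and>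
      (\<exists>h. homogeneous (int (monom_degree m) - 1) h \<and> monom m = g + l * h)"
    using regular_above_decomp[OF assms(1) l(1) homogeneous_single[OF refl], of m 1] assms(2) by auto
  from someI_ex[OF this] show "lift K m \<in> K" "\<exists>h. homogeneous (int e - 1) h \<and> monom m = lift K m + l * h"
    unfolding lift_def assms(2) by simp_all
qed

abbreviation \<alpha> :: "('n \<Rightarrow>\<^sub>0 nat) \<Rightarrow> ('n, 'k) mpoly" where
  "\<alpha> \<equiv> lift I"

abbreviation \<gamma> :: "('n \<Rightarrow>\<^sub>0 nat) \<Rightarrow> ('n, 'k) mpoly" where
  "\<gamma> \<equiv> lift J"

lemmas \<alpha> = lift[OF I] and \<gamma> = lift[OF J]

text \<open>A lift of the monomial x^m x_i x^w of degree \<rho> + d + 1. The variable in the middle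
  can be traded with either side, which makes all lifts of one monomial comparable.\<close>

definition \<tau> :: "('n \<Rightarrow>\<^sub>0 nat) \<Rightarrow> 'n \<Rightarrow> ('n \<Rightarrow>\<^sub>0 nat) \<Rightarrow> ('n, 'k) mpoly" where
  "\<tau> m i w = \<alpha> m * (var i * \<gamma> w)"

text \<open>The two right factors lift the same monomial of degree d + 1, so they differ by some l b
  in J; b has degree d, so it lies in J itself.\<close>

lemma \<tau>_same:
  assumes m: "monom_degree m = \<rho>" and w: "monom_degree w = d" "monom_degree w' = d"
    and eq: "single i 1 + w = single j 1 + w'"
  shows "\<tau> m i w - \<tau> m j w' \<in> E"
proof -
  obtain h where h: "homogeneous (int d - 1) h" "monom w = \<gamma> w + l * h" using \<gamma>(2)[OF w(1)] by blast
  obtain h' where h': "homogeneous (int d - 1) h'" "monom w' = \<gamma> w' + l * h'" using \<gamma>(2)[OF w(2)] by blast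
  let ?b = "var j * h' - var i * h"
  have "var i * monom w = (var j * monom w' :: ('n, 'k) mpoly)" by (simp only: var_mult_monom eq)
  then have b: "var i * \<gamma> w - var j * \<gamma> w' = l * ?b"
    unfolding h(2) h'(2) by (simp add: algebra_simps)
  have "homogeneous (int d) ?b"
    using homogeneous_mult[OF homogeneous_var h(1), of i] homogeneous_mult[OF homogeneous_var h'(1), of j]
    by (intro homogeneous_diff) simp_all
  moreover have "l * ?b \<in> J"
    unfolding b[symmetric] using \<gamma>(1) w
    by (intro ideal.subspace_diff[OF subJ] ideal.subspace_scale[OF subJ]) simp_all
  ultimately have "\<alpha> m * (l * ?b) \<in> E" using \<alpha>(1)[OF m] by (intro mult_right_E)
  then show ?thesis unfolding b[symmetric] \<tau>_def by (simp add: right_diff_distrib)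
qed

text \<open>The mirror image in I: trading a variable between the first factor and the middle
  changes the lift by l a with a of degree \<rho>. These are the linear syzygies of the monomials of
  degree \<rho>.\<close>

lemma \<tau>_exchange:
  assumes n: "Suc (monom_degree n) = \<rho>" and w: "monom_degree w = d"
  shows "\<tau> (single p 1 + n) q w - \<tau> (single q 1 + n) p w \<in> E"
proof -
  let ?m = "single p 1 + n" and ?m' = "single q 1 + n"
  have m: "monom_degree ?m = \<rho>" and m': "monom_degree ?m' = \<rho>" using n by simp_all
  obtain h where h: "homogeneous (int \<rho> - 1) h" "monom ?m = \<alpha> ?m + l * h" using \<alpha>(2)[OF m] by blast
  obtain h' where h': "homogeneous (int \<rho> - 1) h'" "monom ?m' = \<alpha> ?m' + l * h'" using \<alpha>(2)[OF m'] by blast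
  let ?a = "var p * h' - var q * h"
  have "var q * monom ?m = (var p * monom ?m' :: ('n, 'k) mpoly)"
    by (simp only: var_mult_monom add.left_commute)
  then have a: "\<alpha> ?m * var q - \<alpha> ?m' * var p = l * ?a"
    unfolding h(2) h'(2) by (simp add: algebra_simps)
  have "homogeneous (int \<rho>) ?a"
    using homogeneous_mult[OF homogeneous_var h(1), of q] homogeneous_mult[OF homogeneous_var h'(1), of p]
    by (intro homogeneous_diff) simp_all
  moreover have "l * ?a \<in> I"
    unfolding a[symmetric] using \<alpha>(1) m m'
    by (intro ideal.subspace_diff[OF subI] subspace_mult_right[OF subI]) simp_all
  ultimately have "l * ?a * \<gamma> w \<in> E" using \<gamma>(1)[OF w] by (intro mult_left_E')
  then show ?thesis unfolding a[symmetric] \<tau>_def by (simp add: left_diff_distrib mult.assoc)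
qed

text \<open>Two factorisations of one monomial are linked by single exchanges: a variable q lacking
  in m is brought to the middle and traded for a variable p that m has in excess. The truncated
  difference \<open>m - m'\<close> counts the excess, which drops at p.\<close>

lemma \<tau>_cong:
  assumes "monom_degree m = \<rho>" "monom_degree w = d" "monom_degree m' = \<rho>" "monom_degree w' = d"
    and "m + (single i 1 + w) = m' + (single j 1 + w')"
  shows "\<tau> m i w - \<tau> m' j w' \<in> E"
  using assms
proof (induction "monom_degree (m - m')" arbitrary: m i w rule: less_induct)
  case less
  note eq = less.prems(5)
  show ?case
  proof (cases "m = m'")
    case True
    then show ?thesis using \<tau>_same less.prems by simp
  next
    case False
    have deg: "(\<Sum>x\<in>UNIV. lookup m x) = (\<Sum>x\<in>UNIV. lookup m' x)"
      using less.prems(1,3) by (simp add: monom_degree_eq_sum)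
    have ex: "\<exists>x. lookup a x < lookup c x"
      if "a \<noteq> c" "(\<Sum>x\<in>UNIV. lookup a x) = (\<Sum>x\<in>UNIV. lookup c x)"
      for a c :: "'n \<Rightarrow>\<^sub>0 nat"
    proof (rule ccontr)
      assume "\<not> ?thesis"
      then have le: "\<And>x. lookup c x \<le> lookup a x" by (simp add: not_less)
      obtain y where "lookup a y \<noteq> lookup c y"
        using \<open>a \<noteq> c\<close> by (meson poly_mapping_eqI)
      then have "lookup c y < lookup a y" using le[of y] by simp
      then have "(\<Sum>x\<in>UNIV. lookup c x) < (\<Sum>x\<in>UNIV. lookup a x)"
        using le by (intro sum_strict_mono_ex1) auto
      with that(2) show False by simp
    qed
    obtain q where q: "lookup m q < lookup m' q" using ex[OF False deg] by blast
    obtain p where p: "lookup m' p < lookup m p"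
      using ex[of m' m] False deg by auto
    define n where "n = m - single p 1"
    have m: "m = single p 1 + n"
      unfolding n_def using p by (intro single_add_diff[symmetric]) simp
    have n: "Suc (monom_degree n) = \<rho>" using less.prems(1) unfolding m by simp
    let ?z = "single i 1 + w"
    define w1 where "w1 = ?z - single q 1"
    have "lookup (m + ?z) q = lookup (m' + (single j 1 + w')) q"
      using eq by simp
    then have "lookup ?z q \<noteq> 0" using q unfolding lookup_add by linarith
    then have z: "single q 1 + w1 = ?z"
      unfolding w1_def by (rule single_add_diff)
    then have w1: "monom_degree w1 = d"
      using less.prems(2) monom_degree_add[of "single q 1" w1] by simp
    have "\<tau> m i w - \<tau> m q w1 \<in> E"
      by (rule \<tau>_same[OF less.prems(1,2) w1 z[symmetric]])
    moreover have "\<tau> m q w1 - \<tau> (single q 1 + n) p w1 \<in> E"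
      unfolding m by (rule \<tau>_exchange[OF n w1])
    moreover have "\<tau> (single q 1 + n) p w1 - \<tau> m' j w' \<in> E"
    proof (rule less.hyps)
      have pq: "p \<noteq> q" using p q by auto
      have le: "lookup (single q 1 + n - m') x \<le> lookup (m - m') x" for x
        using q p pq unfolding n_def
        by (cases "x = q"; cases "x = p") (auto simp: lookup_add lookup_minus lookup_single when_def)
      have "lookup (single q 1 + n - m') p < lookup (m - m') p"
        using q p pq unfolding n_def by (auto simp: lookup_add lookup_minus lookup_single when_def)
      then show "monom_degree (single q 1 + n - m') < monom_degree (m - m')"
        unfolding monom_degree_eq_sum using le by (intro sum_strict_mono_ex1) auto
      show "monom_degree (single q 1 + n) = \<rho>" using n by simp
      have "single q 1 + n + (single p 1 + w1) = m + (single q 1 + w1)"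
        unfolding m by (simp only: ac_simps)
      then show "single q 1 + n + (single p 1 + w1) = m' + (single j 1 + w')"
        unfolding z eq .
    qed (use w1 less.prems in simp_all)
    ultimately show ?thesis by (blast intro: E_trans)
  qed
qed

text \<open>One value per monomial; by \<open>\<tau>_cong\<close> the choice is immaterial modulo
  E.\<close>

definition \<theta> :: "('n \<Rightarrow>\<^sub>0 nat) \<Rightarrow> ('n, 'k) mpoly" where
  "\<theta> u = (SOME x. \<exists>m i w. monom_degree m = \<rho> \<and> monom_degree w = d \<and>
     u = m + (single i 1 + w) \<and> x = \<tau> m i w)"

lemma \<tau>_\<theta>:
  assumes "monom_degree m = \<rho>" "monom_degree w = d"
  shows "\<tau> m i w - \<theta> (m + (single i 1 + w)) \<in> E"
proof -
  let ?u = "m + (single i 1 + w)"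
  have "\<exists>x m' i' w'. monom_degree m' = \<rho> \<and> monom_degree w' = d \<and>
      ?u = m' + (single i' 1 + w') \<and> x = \<tau> m' i' w'"
    using assms by blast
  from someI_ex[OF this] obtain m' i' w' where
    "monom_degree m' = \<rho>" "monom_degree w' = d" "?u = m' + (single i' 1 + w')" "\<theta> ?u = \<tau> m' i' w'"
    unfolding \<theta>_def[symmetric] by blast
  then show ?thesis using \<tau>_cong[OF assms, of m' w' i i'] by simp
qed

text \<open>Lifts of degree d + 1 are taken as a variable times a lift of degree d, so that their
  product with \<open>\<alpha> m\<close> is literally some \<open>\<tau> m i w\<close>.\<close>

definition \<beta> :: "('n \<Rightarrow>\<^sub>0 nat) \<Rightarrow> ('n, 'k) mpoly" where
  "\<beta> z = (SOME b. \<exists>i w. monom_degree w = d \<and> z = single i 1 + w \<and> b = var i * \<gamma> w)"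

lemma \<beta>:
  assumes "monom_degree z = Suc d"
  shows "\<exists>i w. monom_degree w = d \<and> z = single i 1 + w \<and> \<beta> z = var i * \<gamma> w"
proof -
  have "\<exists>b i w. monom_degree w = d \<and> z = single i 1 + w \<and> b = var i * \<gamma> w"
    using exists_monomial_factor[OF assms] by blast
  from someI_ex[OF this] show ?thesis unfolding \<beta>_def[symmetric] .
qed

lemma lin_lift:
  assumes K: "ideal.subspace K" and f: "homogeneous e f"
    and \<phi>: "\<And>u. int (monom_degree u) = e \<Longrightarrow> \<phi> u \<in> K \<and> (\<exists>h. homogeneous (e - 1) h \<and> monom u = \<phi> u + l * h)"
  shows "lin \<phi> f \<in> K \<and> (\<exists>h. homogeneous (e - 1) h \<and> f = lin \<phi> f + l * h)"
  using f
proof (induction rule: mpoly_homogeneous_induct)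
  case zero
  then show ?case by (auto simp: ideal.subspace_0[OF K] intro: exI[of _ 0])
next
  case (add f g)
  then obtain h h' where h: "homogeneous (e - 1) h" "homogeneous (e - 1) h'"
    and f: "f = lin \<phi> f + l * h" and g: "g = lin \<phi> g + l * h'" by blast
  have "lin \<phi> (f + g) + l * (h + h') = (lin \<phi> f + l * h) + (lin \<phi> g + l * h')"
    by (simp only: lin_add distrib_left ac_simps)
  also have "\<dots> = f + g" by (simp only: f[symmetric] g[symmetric])
  finally have "f + g = lin \<phi> (f + g) + l * (h + h')" ..
  moreover have "homogeneous (e - 1) (h + h')" using h by (rule homogeneous_add)
  moreover have "lin \<phi> (f + g) \<in> K" using add by (simp add: lin_add ideal.subspace_add[OF K])
  ultimately show ?case by blast
next
  case (monom u c)
  then obtain h where h: "\<phi> u \<in> K" "homogeneous (e - 1) h" "monom u = \<phi> u + l * h" using \<phi> by blast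
  have "const c * monom u = const c * \<phi> u + l * (const c * h)"
    by (simp add: h(3) distrib_left mult.left_commute)
  then show ?case
    unfolding lin_monom using h(1) homogeneous_const_mult[OF h(2)]
    by (auto simp: ideal.subspace_scale[OF K])
qed

lemma lin_\<alpha>:
  assumes "homogeneous (int \<rho>) a"
  shows "lin \<alpha> a \<in> I \<and> (\<exists>h. homogeneous (int \<rho> - 1) h \<and> a = lin \<alpha> a + l * h)"
  by (rule lin_lift[OF subI assms]) (simp add: \<alpha>)

lemma lin_\<beta>:
  assumes "homogeneous (int d + 1) b"
  shows "lin \<beta> b \<in> J \<and> (\<exists>h. homogeneous (int d) h \<and> b = lin \<beta> b + l * h)"
proof -
  have "\<beta> z \<in> J \<and> (\<exists>h. homogeneous (int d + 1 - 1) h \<and> monom z = \<beta> z + l * h)"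
    if "int (monom_degree z) = int d + 1" for z
  proof -
    have "monom_degree z = Suc d" using that by linarith
    from \<beta>[OF this] obtain i w where w: "monom_degree w = d" "z = single i 1 + w" "\<beta> z = var i * \<gamma> w"
      by blast
    obtain h where h: "homogeneous (int d - 1) h" "monom w = \<gamma> w + l * h" using \<gamma>(2)[OF w(1)] by blast
    have "monom z = var i * (\<gamma> w + l * h)" by (simp only: w(2) var_mult_monom flip: h(2))
    then have "monom z = \<beta> z + l * (var i * h)"
      by (simp only: w(3) distrib_left mult.left_commute)
    moreover have "homogeneous (int d) (var i * h)"
      using homogeneous_mult[OF homogeneous_var h(1)] by simp
    ultimately show ?thesis
      unfolding w(3) using ideal.subspace_scale[OF subJ \<gamma>(1)[OF w(1)]] by auto
  qed
  from lin_lift[OF subJ assms this] show ?thesis by simp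
qed

lemma lin_mult:
  assumes "homogeneous (int \<rho>) a" "homogeneous (int d + 1) b"
  shows "lin \<alpha> a * lin \<beta> b - lin \<theta> (a * b) \<in> E"
  using assms(1)
proof (induction rule: mpoly_homogeneous_induct)
  case zero
  then show ?case by (simp add: ideal.subspace_0[OF E_subspace])
next
  case (add f g)
  from ideal.subspace_add[OF E_subspace this] show ?case
    by (simp add: lin_add distrib_right algebra_simps)
next
  case (monom m c)
  then have m: "monom_degree m = \<rho>" by simp
  show ?case using assms(2)
  proof (induction rule: mpoly_homogeneous_induct)
    case zero
    then show ?case by (simp add: ideal.subspace_0[OF E_subspace])
  next
    case (add f g)
    from ideal.subspace_add[OF E_subspace this] show ?case
      by (simp add: lin_add distrib_left algebra_simps)
  next
    case (monom z c')
    then have "monom_degree z = Suc d" by simp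
    from \<beta>[OF this] obtain i w where w: "monom_degree w = d" "z = single i 1 + w" "\<beta> z = var i * \<gamma> w"
      by blast
    have "(const c * monom m) * (const c' * monom z) = const (c * c') * monom (m + z)"
      by (simp add: mult_single)
    moreover have "(const c * \<alpha> m) * (const c' * \<beta> z) = const (c * c') * \<tau> m i w"
      by (simp add: \<tau>_def w(3) mult.assoc mult.left_commute flip: const_mult_const)
    ultimately have "lin \<alpha> (const c * monom m) * lin \<beta> (const c' * monom z)
        - lin \<theta> ((const c * monom m) * (const c' * monom z)) = const (c * c') * (\<tau> m i w - \<theta> (m + z))"
      by (simp only: lin_monom right_diff_distrib)
    also have "\<dots> \<in> E"
      using \<tau>_\<theta>[OF m w(1), of i] unfolding w(2) by (rule ideal.subspace_scale[OF E_subspace])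
    finally show ?case .
  qed
qed

text \<open>Each factor is its monomialwise lift plus a multiple of l. The corrections l h and l h'
  lie in I and J themselves, so their contributions to the product fall into E.\<close>

lemma mult_cong_\<theta>:
  assumes a: "a \<in> I" "homogeneous (int \<rho>) a" and b: "b \<in> J" "homogeneous (int d + 1) b"
  shows "a * b - lin \<theta> (a * b) \<in> E"
proof -
  obtain h where h: "homogeneous (int \<rho> - 1) h" "a = lin \<alpha> a + l * h" and aI: "lin \<alpha> a \<in> I"
    using lin_\<alpha>[OF a(2)] by blast
  obtain h' where h': "homogeneous (int d) h'" "b = lin \<beta> b + l * h'" and bJ: "lin \<beta> b \<in> J"
    using lin_\<beta>[OF b(2)] by blast
  have lh: "l * h \<in> I" using ideal.subspace_diff[OF subI a(1) aI] h(2) by (metis add_diff_cancel_left')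
  have lh': "l * h' \<in> J" using ideal.subspace_diff[OF subJ b(1) bJ] h'(2) by (metis add_diff_cancel_left')
  have "a * b = (lin \<alpha> a + l * h) * b" using h(2) by simp
  also have "\<dots> = lin \<alpha> a * (lin \<beta> b + l * h') + l * h * b"
    using h'(2) by (simp add: distrib_right)
  finally have "a * b - lin \<theta> (a * b) =
      (lin \<alpha> a * lin \<beta> b - lin \<theta> (a * b)) + (lin \<alpha> a * (l * h') + l * h * b)"
    by (simp add: distrib_left)
  also have "\<dots> \<in> E"
    using lin_mult[OF a(2) b(2)] mult_right_E[OF aI lh' h'(1)] mult_left_E[OF lh h(1) b]
    by (intro ideal.subspace_add[OF E_subspace])
  finally show ?thesis .
qed

text \<open>A component of an element of I J is a sum of products of components. In each product one
  factor is expanded from its threshold degree and the freed monomials are handed to the other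
  factor, until the degrees are \<rho> and d + 1.\<close>

lemma ideal_mult_cong_\<theta>:
  assumes g: "g \<in> ideal_mult I J"
  shows "hcomp (int \<rho> + int d + 1) g - lin \<theta> (hcomp (int \<rho> + int d + 1) g) \<in> E"
proof -
  let ?t = "int \<rho> + int d + 1"
  define Q where "Q g \<longleftrightarrow> g - lin \<theta> g \<in> E" for g
  have Q0: "Q 0" by (simp add: Q_def ideal.subspace_0[OF E_subspace])
  have Q_add: "Q (x + y)" if "Q x" "Q y" for x y
    using ideal.subspace_add[OF E_subspace that[unfolded Q_def]]
    by (simp add: Q_def lin_add algebra_simps)
  have Q_sum: "Q (sum x A)" if "\<And>a. a \<in> A \<Longrightarrow> Q (x a)" for x :: "int \<Rightarrow> _" and A
    using that by (induction A rule: infinite_finite_induct) (simp_all add: Q0 Q_add)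
  have hI: "homogeneous_ideal I" and hJ: "homogeneous_ideal J"
    using I J by (simp_all add: regular_above_def)
  have J': "regular_above l J (Suc d)" using regular_above_mono[OF J] by simp
  have prod: "Q (hcomp e a * hcomp (?t - e) b)" if ab: "a \<in> I" "b \<in> J" "e \<ge> 0" for a b e
  proof -
    have a': "hcomp e a \<in> I" and b': "hcomp (?t - e) b \<in> J"
      using ab homogeneous_ideal_hcomp hI hJ by blast+
    \<comment> \<open>The degrees e and t - e add up to \<rho> + d + 1: if e is below \<rho>, the
      other degree exceeds d + 1 and the expansion takes place in J; otherwise it takes place in
      I.\<close>
    consider "?t - e < 0" | "?t - e \<ge> 0" "e \<ge> int \<rho>" | "e < int \<rho>" by linarith
    then show ?thesis
    proof cases
      case 1
      then have "hcomp (?t - e) b = 0" by (rule homogeneous_neg[OF homogeneous_hcomp])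
      then show ?thesis by (simp add: Q0)
    next
      case 2
      define k where "k = nat (e - int \<rho>)"
      have k: "e = int \<rho> + int k" using 2(2) by (simp add: k_def)
      show ?thesis
      proof (rule regular_above_generate[OF I l(1) a', where Q = "\<lambda>x. Q (x * hcomp (?t - e) b)" and k = k])
        show "homogeneous (int \<rho> + int k) (hcomp e a)" unfolding k by (rule homogeneous_hcomp)
        show "Q (0 * hcomp (?t - e) b)" by (simp add: Q0)
        show "Q ((x + y) * hcomp (?t - e) b)" if "Q (x * hcomp (?t - e) b)" "Q (y * hcomp (?t - e) b)" for x y
          using Q_add[OF that] by (simp add: distrib_right)
        fix u :: "'n \<Rightarrow>\<^sub>0 nat" and x :: "('n, 'k) mpoly"
        assume u: "monom_degree u = k" and x: "x \<in> I" "homogeneous (int \<rho>) x"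
        have "homogeneous (int k + (?t - e)) (monom u * hcomp (?t - e) b)"
          using u by (intro homogeneous_mult homogeneous_single homogeneous_hcomp) simp
        then have "homogeneous (int d + 1) (monom u * hcomp (?t - e) b)"
          unfolding k by (simp add: algebra_simps)
        from mult_cong_\<theta>[OF x ideal.subspace_scale[OF subJ b'] this]
        show "Q (monom u * x * hcomp (?t - e) b)"
          by (simp add: Q_def mult.assoc mult.left_commute)
      qed
    next
      case 3
      define k where "k = nat (int \<rho> - e)"
      have k: "?t - e = int (Suc d) + int k" using 3 by (simp add: k_def)
      show ?thesis
      proof (rule regular_above_generate[OF J' l(1) b', where Q = "\<lambda>x. Q (hcomp e a * x)" and k = k])
        show "homogeneous (int (Suc d) + int k) (hcomp (?t - e) b)" unfolding k by (rule homogeneous_hcomp)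
        show "Q (hcomp e a * 0)" by (simp add: Q0)
        show "Q (hcomp e a * (x + y))" if "Q (hcomp e a * x)" "Q (hcomp e a * y)" for x y
          using Q_add[OF that] by (simp add: distrib_left)
        fix u :: "'n \<Rightarrow>\<^sub>0 nat" and x :: "('n, 'k) mpoly"
        assume u: "monom_degree u = k" and x: "x \<in> J" "homogeneous (int (Suc d)) x"
        have "homogeneous (int k + e) (monom u * hcomp e a)"
          using u by (intro homogeneous_mult homogeneous_single homogeneous_hcomp) simp
        then have "homogeneous (int \<rho>) (monom u * hcomp e a)"
          using 3 by (simp add: k_def)
        moreover have "homogeneous (int d + 1) x" using x(2) by (simp add: add.commute)
        ultimately have "Q (monom u * hcomp e a * x)"
          using mult_cong_\<theta>[OF ideal.subspace_scale[OF subI a'] _ x(1)] by (simp add: Q_def)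
        then show "Q (hcomp e a * (monom u * x))" by (simp add: mult.assoc mult.left_commute)
      qed
    qed
  qed
  have "Q (hcomp ?t g)" using g subI
  proof (induction rule: ideal_mult_induct)
    case zero
    then show ?case by (simp add: Q0)
  next
    case (add x y)
    then show ?case by (simp add: hcomp_add Q_add)
  next
    case (mult a b)
    then show ?case
      unfolding hcomp_mult by (intro Q_sum prod) (auto simp: degrees_def)
  qed
  then show ?thesis by (simp add: Q_def)
qed

text \<open>On a monomial v = x^m x^w the value at l v is, modulo E and up to the constant c, the
  sum of all \<open>\<kappa> i * \<tau> m i w\<close>. There the middle variables recombine to l,
  leaving l times a product of lifts in I and J.\<close>

lemma lin_\<theta>_linear:
  assumes "homogeneous (int \<rho> + int d) f"
  shows "lin \<theta> (l * f) \<in> E"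
  using assms
proof (induction rule: mpoly_homogeneous_induct)
  case zero
  then show ?case by (simp add: ideal.subspace_0[OF E_subspace])
next
  case (add f g)
  then show ?case by (simp add: distrib_left lin_add ideal.subspace_add[OF E_subspace])
next
  case (monom v c)
  then have "monom_degree v = \<rho> + d" by linarith
  then obtain m w where mw: "v = m + w" "monom_degree m = \<rho>" "monom_degree w = d"
    using monomial_split by blast
  obtain k where k: "l = (\<Sum>i\<in>UNIV. var i * k i)" "\<And>i. homogeneous 0 (k i)"
    using form_split[of 0 l] l(1) by auto
  define \<kappa> where "\<kappa> i = lookup (k i) 0" for i
  have k_const: "k i = const (\<kappa> i)" for i
    unfolding \<kappa>_def by (rule homogeneous_zero_const[OF k(2)])
  have \<kappa>: "l = (\<Sum>i\<in>UNIV. const (\<kappa> i) * var i)"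
    by (subst k(1)) (simp only: k_const mult.commute)
  have "const (\<kappa> i) * var i * (const c * monom v) = const (\<kappa> i * c) * monom (m + (single i 1 + w))" for i
    by (simp add: mw(1) var_def mult_single ac_simps)
  then have "l * (const c * monom v) = (\<Sum>i\<in>UNIV. const (\<kappa> i * c) * monom (m + (single i 1 + w)))"
    by (subst \<kappa>) (simp only: sum_distrib_right)
  then have "lin \<theta> (l * (const c * monom v)) = (\<Sum>i\<in>UNIV. const (\<kappa> i * c) * \<theta> (m + (single i 1 + w)))"
    by (simp only: lin_sum lin_monom)
  moreover have "(\<Sum>i\<in>UNIV. const (\<kappa> i * c) * (\<tau> m i w - \<theta> (m + (single i 1 + w)))) \<in> E"
    by (intro ideal.subspace_sum[OF E_subspace] ideal.subspace_scale[OF E_subspace] \<tau>_\<theta> mw)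
  ultimately have diff: "(\<Sum>i\<in>UNIV. const (\<kappa> i * c) * \<tau> m i w) - lin \<theta> (l * (const c * monom v)) \<in> E"
    by (simp add: right_diff_distrib sum_subtractf)
  have "(\<Sum>i\<in>UNIV. const (\<kappa> i * c) * \<tau> m i w) = (\<Sum>i\<in>UNIV. const (\<kappa> i) * var i) * (\<alpha> m * (const c * \<gamma> w))"
    unfolding \<tau>_def sum_distrib_right const_mult_const[symmetric]
    by (simp only: ac_simps)
  also have "\<dots> = l * (\<alpha> m * (const c * \<gamma> w))" by (simp only: \<kappa>[symmetric])
  also have "\<dots> \<in> E"
    by (intro mem_E ideal_mult_mem \<alpha>(1) ideal.subspace_scale[OF subJ] \<gamma>(1) mw)
  finally have "(\<Sum>i\<in>UNIV. const (\<kappa> i * c) * \<tau> m i w) \<in> E" .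
  from ideal.subspace_diff[OF E_subspace this diff] show ?case by simp
qed

text \<open>Membership in I J makes l f congruent to its image under the linear extension of
  \<theta>, and that image lies in E because l f is a multiple of l. So l f = l k with k in I
  J.\<close>

theorem cancel_linear_form:
  assumes f: "homogeneous (int \<rho> + int d) f" "l * f \<in> ideal_mult I J"
  shows "f \<in> ideal_mult I J"
proof -
  have "homogeneous (int \<rho> + int d + 1) (l * f)"
    using homogeneous_mult[OF l(1) f(1)] by (simp add: add.commute)
  then have "hcomp (int \<rho> + int d + 1) (l * f) = l * f" by (simp add: hcomp_homogeneous)
  then have "l * f - lin \<theta> (l * f) \<in> E" using ideal_mult_cong_\<theta>[OF f(2)] by simp
  then have "l * f - lin \<theta> (l * f) + lin \<theta> (l * f) \<in> E"
    by (rule ideal.subspace_add[OF E_subspace _ lin_\<theta>_linear[OF f(1)]])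
  then obtain k where "k \<in> ideal_mult I J" "l * f = l * k" by (auto simp: E_def)
  then show ?thesis using l(2) by simp
qed

end

text \<open>Injectivity is \<open>cancel_linear_form\<close>. For the other half, a monomial is
  split into factors of degree \<rho> and of degree at least \<sigma>, and their decompositions
  modulo l are multiplied.\<close>

theorem regular_above_mult:
  fixes l :: "('n::{finite, linorder}, 'k::field) mpoly"
  assumes l: "homogeneous 1 l" "l \<noteq> 0" and I: "regular_above l I \<rho>" and J: "regular_above l J \<sigma>"
  shows "regular_above l (ideal_mult I J) (\<rho> + \<sigma>)"
  unfolding regular_above_def
proof (intro conjI allI impI)
  show "homogeneous_ideal (ideal_mult I J)"
    using I J by (intro homogeneous_ideal_mult) (simp_all add: regular_above_def)
next
  fix e and f :: "('n, 'k) mpoly" assume f: "homogeneous e f" "e \<ge> int (\<rho> + \<sigma>)" "l * f \<in> ideal_mult I J"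
  \<comment> \<open>The threshold of J is raised to d so that \<rho> + d is exactly the degree of
    f.\<close>
  define d where "d = nat (e - int \<rho>)"
  have d: "e = int \<rho> + int d" "\<sigma> \<le> d" using f(2) by (simp_all add: d_def)
  interpret regular_pair l I J \<rho> d
    using l I regular_above_mono[OF J d(2)] by unfold_locales
  show "f \<in> ideal_mult I J" using cancel_linear_form f unfolding d(1) by blast
next
  let ?S = "ideal.span (insert l (ideal_mult I J))"
  have lS: "l * h \<in> ?S" for h
    using ideal.span_scale[OF ideal.span_base, of l "insert l (ideal_mult I J)" h] by (simp add: mult.commute)
  fix e and f :: "('n, 'k) mpoly" assume f: "homogeneous e f" "e \<ge> int (\<rho> + \<sigma>)"
  show "f \<in> ?S" using f(1)
  proof (induction rule: mpoly_homogeneous_induct)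
    case zero
    then show ?case by (rule ideal.span_zero)
  next
    case (add f g)
    then show ?case by (rule ideal.span_add)
  next
    case (monom u c)
    then have "monom_degree u = \<rho> + (monom_degree u - \<rho>)" using f(2) by linarith
    then obtain m z where mz: "u = m + z" "monom_degree m = \<rho>" "monom_degree z = monom_degree u - \<rho>"
      using monomial_split by blast
    obtain g h where g: "g \<in> I" "(monom m :: ('n, 'k) mpoly) = g + l * h"
      using regular_above_decomp[OF I l(1) homogeneous_single, of m "int \<rho>" 1] mz(2) by auto
    have "monom_degree z \<ge> \<sigma>" using mz(3) monom f(2) by linarith
    then obtain g' h' where g': "g' \<in> J" "(monom z :: ('n, 'k) mpoly) = g' + l * h'"
      using regular_above_decomp[OF J l(1) homogeneous_single, of z "int (monom_degree z)" 1] by auto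
    have "monom u = monom m * (monom z :: ('n, 'k) mpoly)" by (simp add: mz(1) mult_single)
    also have "\<dots> = g * g' + l * (g * h' + h * (g' + l * h'))"
      unfolding g(2) g'(2) by (simp add: algebra_simps)
    also have "\<dots> \<in> ?S"
      using ideal_mult_mem[OF g(1) g'(1)] by (intro ideal.span_add lS ideal.span_base) simp
    finally show ?case by (rule ideal.span_scale)
  qed
qed

corollary regular_above_power:
  fixes l :: "('n::{finite, linorder}, 'k::field) mpoly"
  assumes l: "homogeneous 1 l" "l \<noteq> 0" and I: "regular_above l I \<rho>"
  shows "regular_above l (ideal_power I r) (r * \<rho>)"
proof (induction r)
  case 0
  have "ideal.span (insert l UNIV) = (UNIV :: ('n, 'k) mpoly set)" by simp
  then show ?case by (simp add: regular_above_def homogeneous_ideal_UNIV)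
next
  case (Suc r)
  from regular_above_mult[OF l I Suc] show ?case by simp
qed

subsection \<open>Symbolic powers\<close>

lemma colon_subspace: "ideal.subspace I \<Longrightarrow> ideal.subspace {h. h * g \<in> I}"
  by (intro ideal.subspaceI)
    (auto simp: distrib_right mult.assoc ideal.subspace_0 ideal.subspace_add ideal.subspace_scale)

text \<open>A maximal annihilator of a nonzero class is prime: if a b kills g' and b does not, the
  annihilator of b g' contains that of g', hence equals it, and it contains a.\<close>

lemma associated_prime_exists:
  fixes I :: "('n::{finite, linorder}, 'k::field) mpoly set"
  assumes I: "ideal.subspace I" and g: "g \<notin> I"
  shows "\<exists>P\<in>associated_primes I. {h. h * g \<in> I} \<subseteq> P"
proof -
  define C where "C g = {h. h * g \<in> I}" for g
  define F where "F = {C g' | g'. g' \<notin> I \<and> C g \<subseteq> C g'}"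
  have "C g \<in> F" using g by (auto simp: F_def)
  moreover have "ideal.subspace K" if "K \<in> F" for K
    using that colon_subspace[OF I] by (auto simp: F_def C_def)
  ultimately obtain K where K: "K \<in> F" and max: "\<forall>L\<in>F. K \<subseteq> L \<longrightarrow> L = K"
    using maximal_ideal_in_family[of F] by blast
  from K obtain g' where g': "K = C g'" "g' \<notin> I" "C g \<subseteq> C g'" by (auto simp: F_def)
  have "prime_ideal K"
    unfolding prime_ideal_def
  proof (intro conjI allI impI)
    show "ideal.subspace K" unfolding g'(1) C_def by (rule colon_subspace[OF I])
    have "1 \<notin> K" using g' by (simp add: C_def)
    then show "K \<noteq> UNIV" by blast
    fix a b assume ab: "a * b \<in> K"
    show "a \<in> K \<or> b \<in> K"
    proof (cases "b \<in> K")
      case False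
      then have "b * g' \<notin> I" by (simp add: g'(1) C_def)
      moreover have "C g' \<subseteq> C (b * g')"
        by (auto simp: C_def mult.left_commute[of _ b] ideal.subspace_scale[OF I])
      ultimately have "C (b * g') = K" using max g' unfolding F_def by blast
      then show ?thesis using ab by (auto simp: C_def g'(1) mult.assoc)
    qed simp
  qed
  then have "K \<in> associated_primes I" by (auto simp: associated_primes_def g'(1) C_def)
  with g' show ?thesis by (auto simp: C_def)
qed

text \<open>An element that kills a nonzero class lies in an annihilator, hence in an associated
  prime; so denominators are nonzerodivisors modulo I. For proper I some associated prime exists,
  and it contains 0.\<close>

lemma associated_primes_complement:
  fixes I :: "('n::{finite, linorder}, 'k::field) mpoly set"
  defines "A \<equiv> - \<Union>(associated_primes I)"
  shows "1 \<in> A" "s \<in> A \<Longrightarrow> t \<in> A \<Longrightarrow> s * t \<in> A"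
    and "ideal.subspace I \<Longrightarrow> I \<noteq> UNIV \<Longrightarrow> 0 \<notin> A"
    and "ideal.subspace I \<Longrightarrow> s \<in> A \<Longrightarrow> s * f \<in> I \<Longrightarrow> f \<in> I"
proof -
  show "1 \<in> A"
    unfolding A_def associated_primes_def prime_ideal_def using subspace_UNIV_iff by auto
  show "s \<in> A \<Longrightarrow> t \<in> A \<Longrightarrow> s * t \<in> A"
    unfolding A_def associated_primes_def prime_ideal_def by blast
  show "0 \<notin> A" if I: "ideal.subspace I" "I \<noteq> UNIV"
  proof -
    have "1 \<notin> I" using I subspace_UNIV_iff by blast
    then obtain P where P: "P \<in> associated_primes I" using associated_prime_exists[OF I(1)] by blast
    then have "ideal.subspace P" by (simp add: associated_primes_def prime_ideal_def)
    then have "0 \<in> P" by (rule ideal.subspace_0)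
    with P show ?thesis by (auto simp: A_def)
  qed
  show "f \<in> I" if sf: "ideal.subspace I" "s \<in> A" "s * f \<in> I"
  proof (rule ccontr)
    assume "f \<notin> I"
    then obtain P where "P \<in> associated_primes I" "{h. h * f \<in> I} \<subseteq> P"
      using associated_prime_exists[OF sf(1)] by blast
    with sf show False by (auto simp: A_def)
  qed
qed

text \<open>Clearing denominators: the product of the denominators of a finite sum is a common one.
  From here on the fraction field has left the proof.\<close>

lemma mem_symbolic_power_iff:
  fixes I :: "('n::{finite, linorder}, 'k::field) mpoly set"
  assumes I: "ideal.subspace I" "I \<noteq> UNIV"
  shows "f \<in> symbolic_power I m \<longleftrightarrow> (\<exists>s. s \<notin> \<Union>(associated_primes I) \<and> s * f \<in> ideal_power I m)"
proof
  let ?A = "- \<Union>(associated_primes I)"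
  note A = associated_primes_complement[where I = I]
  have nz: "s \<noteq> 0" if "s \<in> ?A" for s using A(3)[OF I] that by blast
  have sum: "\<exists>s h. s \<in> ?A \<and> h \<in> ideal_power I m \<and> to_fract s * (\<Sum>g\<in>G. x g * to_fract g) = to_fract h"
    if "finite G" "G \<subseteq> ideal_power I m" "\<forall>g\<in>G. x g \<in> localization ?A" for G and x :: "('n, 'k) mpoly \<Rightarrow> _"
    using that
  proof (induction G)
    case empty
    show ?case using A(1) ideal.subspace_0[OF ideal_power_subspace] by (intro exI[of _ 1] exI[of _ 0]) auto
  next
    case (insert g G)
    then obtain s h where sh: "s \<in> ?A" "h \<in> ideal_power I m"
      "to_fract s * (\<Sum>g\<in>G. x g * to_fract g) = to_fract h" by blast
    obtain a t where at: "x g = Fract a t" "t \<in> ?A"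
      using insert.prems by (auto simp: localization_def)
    have xg: "to_fract t * x g = to_fract a"
      using nz[OF at(2)] by (simp add: at(1) Fract_conv_to_fract)
    have "to_fract (s * t) * (\<Sum>g\<in>insert g G. x g * to_fract g) =
        to_fract s * (to_fract t * x g) * to_fract g + to_fract t * (to_fract s * (\<Sum>g\<in>G. x g * to_fract g))"
      using insert.hyps by (simp add: algebra_simps)
    also have "\<dots> = to_fract ((s * a) * g + t * h)"
      by (simp only: xg sh(3) to_fract_mult to_fract_add)
    finally have eq: "to_fract (s * t) * (\<Sum>g\<in>insert g G. x g * to_fract g) = to_fract ((s * a) * g + t * h)" .
    have "(s * a) * g + t * h \<in> ideal_power I m"
      using insert.prems sh(2)
      by (intro ideal.subspace_add[OF ideal_power_subspace] ideal.subspace_scale[OF ideal_power_subspace]) auto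
    then show ?case using A(2)[OF sh(1) at(2)] eq by blast
  qed
  {
    assume "f \<in> symbolic_power I m"
    then obtain G x where G: "finite G" "G \<subseteq> ideal_power I m" "\<forall>g\<in>G. x g \<in> localization ?A"
      and f: "to_fract f = (\<Sum>g\<in>G. x g * to_fract g)"
      unfolding symbolic_power_def extended_ideal_def by blast
    obtain s h where s: "s \<in> ?A" "h \<in> ideal_power I m" "to_fract s * to_fract f = to_fract h"
      using sum[OF G] unfolding f[symmetric] by blast
    then have "s * f = h" by (metis to_fract_eq_iff to_fract_mult)
    with s show "\<exists>s. s \<notin> \<Union>(associated_primes I) \<and> s * f \<in> ideal_power I m" by blast
  next
    assume "\<exists>s. s \<notin> \<Union>(associated_primes I) \<and> s * f \<in> ideal_power I m"
    then obtain s where s: "s \<in> ?A" "s * f \<in> ideal_power I m" by blast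
    have "to_fract f = (\<Sum>g\<in>{s * f}. Fract 1 s * to_fract g)"
      using nz[OF s(1)] by (simp add: Fract_conv_to_fract)
    moreover have "Fract 1 s \<in> localization ?A" using s(1) by (auto simp: localization_def)
    ultimately show "f \<in> symbolic_power I m"
      unfolding symbolic_power_def extended_ideal_def using s(2)
      by (intro CollectI exI[of _ "{s * f}"] exI[of _ "\<lambda>_. Fract 1 s"]) auto
  }
qed

lemma prime_ideal_irrelevant:
  "prime_ideal (irrelevant_ideal :: ('n::finite, 'k::field) mpoly set)"
  unfolding prime_ideal_def
proof (intro conjI allI impI)
  show "ideal.subspace (irrelevant_ideal :: ('n, 'k) mpoly set)"
    by (rule homogeneous_ideal_subspace[OF homogeneous_ideal_irrelevant])
  have "1 \<notin> (irrelevant_ideal :: ('n, 'k) mpoly set)" by (simp add: irrelevant_ideal_eq)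
  then show "(irrelevant_ideal :: ('n, 'k) mpoly set) \<noteq> UNIV" by blast
qed (simp add: irrelevant_ideal_eq lookup_mult_zero)

text \<open>A form of maximal degree outside \<open>I\<close> killed by \<open>l\<close> modulo \<open>I\<close> would have the irrelevant
  ideal as its annihilator.\<close>
lemma linear_form_regular:
  fixes I :: "('n::{finite, linorder}, 'k::field) mpoly set"
  assumes reg: "regular_above l I \<rho>" and l: "homogeneous 1 l"
    and irr: "irrelevant_ideal \<notin> associated_primes I"
    and f: "l * f \<in> I"
  shows "f \<in> I"
proof -
  have I: "homogeneous_ideal I" using reg by (simp add: regular_above_def)
  note sub = homogeneous_ideal_subspace[OF I]
  have hom: "f \<in> I" if "nat (int \<rho> - d) = k" "homogeneous d f" "l * f \<in> I" for k d f
    using that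
  proof (induction k arbitrary: d f)
    case 0
    then show ?case by (intro regular_above_cancel[OF reg 0(2) _ 0(3)]) simp
  next
    case (Suc k)
    \<comment> \<open>Descending induction on the degree: x_i f is again killed by l modulo I, in
      degree one higher.\<close>
    have "var i * f \<in> I" for i
    proof (rule Suc.IH[of "1 + d"])
      show "nat (int \<rho> - (1 + d)) = k" using Suc.prems(1) by linarith
      show "homogeneous (1 + d) (var i * f)" by (rule homogeneous_mult[OF homogeneous_var Suc.prems(2)])
      show "l * (var i * f) \<in> I"
        using ideal.subspace_scale[OF sub Suc.prems(3), of "var i"] by (simp add: mult.left_commute)
    qed
    then have "range var \<subseteq> {h. h * f \<in> I}" by blast
    then have sup: "irrelevant_ideal \<subseteq> {h. h * f \<in> I}"
      unfolding irrelevant_ideal_span_var by (rule ideal.span_minimal[OF _ colon_subspace[OF sub]])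
    show ?case
    proof (rule ccontr)
      assume "f \<notin> I"
      then have "{h. h * f \<in> I} \<subseteq> irrelevant_ideal"
        using unit_cancel[OF I] by (auto simp: irrelevant_ideal_eq)
      with sup have "irrelevant_ideal = {h. h * f \<in> I}" by blast
      then have "irrelevant_ideal \<in> associated_primes I"
        using prime_ideal_irrelevant unfolding associated_primes_def by blast
      with irr show False ..
    qed
  qed
  have "hcomp d f \<in> I" for d
  proof (rule hom[OF refl homogeneous_hcomp])
    have "hcomp (d + 1) (l * f) \<in> I" by (rule homogeneous_ideal_hcomp[OF I f])
    then show "l * hcomp d f \<in> I" by (simp add: hcomp_mult_left[OF l])
  qed
  then show ?thesis by (rule mem_if_hcomp_mem[OF sub])
qed

text \<open>Gaussian elimination: the equation t is solved for a pivot x0, and the other unknowns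
  satisfy the modified system \<open>a'\<close> with one equation less.\<close>

lemma underdetermined_system:
  fixes a :: "'x \<Rightarrow> 't \<Rightarrow> 'k::field"
  assumes "finite T" "finite X" "card T < card X"
  shows "\<exists>c. (\<exists>x\<in>X. c x \<noteq> 0) \<and> (\<forall>t\<in>T. (\<Sum>x\<in>X. c x * a x t) = 0)"
  using assms
proof (induction T arbitrary: X a)
  case empty
  then have "X \<noteq> {}" by auto
  then show ?case by (intro exI[of _ "\<lambda>_. 1"]) auto
next
  case (insert t T)
  show ?case
  proof (cases "\<forall>x\<in>X. a x t = 0")
    case True
    have "card T < card X" using insert by simp
    then obtain c where "\<exists>x\<in>X. c x \<noteq> 0" "\<forall>s\<in>T. (\<Sum>x\<in>X. c x * a x s) = 0"
      using insert.IH[OF insert.prems(1)] by blast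
    moreover have "(\<Sum>x\<in>X. c x * a x t) = 0" using True by simp
    ultimately show ?thesis by blast
  next
    case False
    then obtain x0 where x0: "x0 \<in> X" "a x0 t \<noteq> 0" by blast
    define X' where "X' = X - {x0}"
    define a' where "a' x s = a x s - a x t / a x0 t * a x0 s" for x s
    have X: "X = insert x0 X'" "x0 \<notin> X'" "finite X'" using x0 insert.prems(1) by (auto simp: X'_def)
    have "card T < card X'" using insert.prems(2) insert.hyps X by simp
    then obtain c where c: "\<exists>x\<in>X'. c x \<noteq> 0" "\<forall>s\<in>T. (\<Sum>x\<in>X'. c x * a' x s) = 0"
      using insert.IH[OF X(3), where a = a'] by blast
    define c' where "c' x = (if x = x0 then - (\<Sum>y\<in>X'. c y * a y t / a x0 t) else c x)" for x
    have sum: "(\<Sum>x\<in>X. c' x * a x s) = (\<Sum>x\<in>X'. c x * a' x s)" for s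
    proof -
      have "(\<Sum>x\<in>X'. c' x * a x s) = (\<Sum>x\<in>X'. c x * a x s)"
        using X(2) by (intro sum.cong) (auto simp: c'_def)
      then have "(\<Sum>x\<in>X. c' x * a x s) = (\<Sum>x\<in>X'. c x * a x s) - (\<Sum>y\<in>X'. c y * a y t / a x0 t) * a x0 s"
        using X by (simp add: c'_def)
      also have "\<dots> = (\<Sum>x\<in>X'. c x * a' x s)"
        by (simp add: a'_def sum_distrib_right right_diff_distrib sum_subtractf mult.assoc)
      finally show ?thesis .
    qed
    have "a' x t = 0" for x using x0(2) by (simp add: a'_def)
    then have "\<forall>s\<in>insert t T. (\<Sum>x\<in>X. c' x * a x s) = 0" using c(2) by (simp add: sum)
    moreover have "\<exists>x\<in>X. c' x \<noteq> 0"
    proof -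
      obtain x where "x \<in> X'" "c x \<noteq> 0" using c(1) by blast
      then have "x \<in> X" "c' x \<noteq> 0" using X by (auto simp: c'_def)
      then show ?thesis by blast
    qed
    ultimately show ?thesis by blast
  qed
qed

section \<open>Growth of R/I and algebraic dependence on l\<close>

definition degree_le :: "nat \<Rightarrow> ('n, 'k::zero) mpoly \<Rightarrow> bool" where
  "degree_le D f \<longleftrightarrow> (\<forall>u\<in>keys f. monom_degree u \<le> D)"

lemma degree_le_mono: "degree_le D f \<Longrightarrow> D \<le> D' \<Longrightarrow> degree_le D' f"
  by (auto simp: degree_le_def intro: order_trans)

lemma degree_le_mult:
  fixes f g :: "('n::finite, 'k::comm_ring_1) mpoly"
  assumes "degree_le D f" "degree_le D' g"
  shows "degree_le (D + D') (f * g)"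
  unfolding degree_le_def
proof
  fix u assume "u \<in> keys (f * g)"
  then obtain a b where "u = a + b" "a \<in> keys f" "b \<in> keys g"
    using keys_mult by blast
  then show "monom_degree u \<le> D + D'" using assms by (auto simp: degree_le_def intro: add_mono)
qed

lemma degree_le_power:
  fixes f :: "('n::finite, 'k::comm_ring_1) mpoly"
  assumes "degree_le D f"
  shows "degree_le (e * D) (f ^ e)"
proof (induction e)
  case 0
  show ?case by (simp add: degree_le_def)
next
  case (Suc e)
  from degree_le_mult[OF assms Suc] show ?case by simp
qed

lemma exists_degree_le: "\<exists>D. degree_le D f"
  by (intro exI[of _ "Max (monom_degree ` keys f)"]) (simp add: degree_le_def)

lemma finite_monomials_degree_le: "finite {u :: 'n::finite \<Rightarrow>\<^sub>0 nat. monom_degree u \<le> D}"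
proof (rule finite_imageD)
  have "lookup u i \<le> monom_degree u" for u :: "'n \<Rightarrow>\<^sub>0 nat" and i
    unfolding monom_degree_eq_sum by (rule member_le_sum) auto
  then have "lookup ` {u :: 'n \<Rightarrow>\<^sub>0 nat. monom_degree u \<le> D} \<subseteq> (UNIV :: 'n set) \<rightarrow>\<^sub>E {..D}"
    by (auto intro: order_trans)
  then show "finite (lookup ` {u :: 'n \<Rightarrow>\<^sub>0 nat. monom_degree u \<le> D})"
    by (rule finite_subset) (simp add: finite_PiE)
  show "inj_on lookup {u :: 'n \<Rightarrow>\<^sub>0 nat. monom_degree u \<le> D}"
    by (auto simp: inj_on_def intro: poly_mapping_eqI)
qed

text \<open>Modulo \<open>I\<close> the polynomials of degree at most \<open>D\<close> are spanned by the products of a power of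
  \<open>l\<close> and a monomial of degree at most \<open>\<rho>\<close>, so their dimension grows only linearly in \<open>D\<close>.\<close>
lemma spanned_by_linear_powers:
  fixes I :: "('n::{finite, linorder}, 'k::field) mpoly set"
  assumes reg: "regular_above l I \<rho>" and l: "homogeneous 1 l"
  defines "B \<equiv> {u. monom_degree u \<le> \<rho>}"
  assumes f: "degree_le D f"
  shows "\<exists>a. f - (\<Sum>p\<in>{..D} \<times> B. const (a p) * (l ^ fst p * monom (snd p))) \<in> I"
proof -
  have I: "homogeneous_ideal I" using reg by (simp add: regular_above_def)
  note sub = homogeneous_ideal_subspace[OF I]
  have fin: "finite ({..D} \<times> B)" by (simp add: B_def finite_monomials_degree_le)
  define v where "v p = l ^ fst p * (monom (snd p) :: ('n, 'k) mpoly)" for p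
  define Sp where "Sp f \<longleftrightarrow> (\<exists>a. f - (\<Sum>p\<in>{..D} \<times> B. const (a p) * v p) \<in> I)" for f
  have Sp_I: "Sp g" if "g \<in> I" for g
    using that by (auto simp: Sp_def intro: exI[of _ "\<lambda>_. 0"])
  have Sp_add: "Sp (f + g)" if fg: "Sp f" "Sp g" for f g
  proof -
    obtain a c where "f - (\<Sum>p\<in>{..D} \<times> B. const (a p) * v p) \<in> I" "g - (\<Sum>p\<in>{..D} \<times> B. const (c p) * v p) \<in> I"
      using fg by (auto simp: Sp_def)
    from ideal.subspace_add[OF sub this]
    have "f + g - (\<Sum>p\<in>{..D} \<times> B. const (a p + c p) * v p) \<in> I"
      by (simp add: single_add distrib_right sum.distrib algebra_simps)
    then show ?thesis unfolding Sp_def by (intro exI[of _ "\<lambda>p. a p + c p"])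
  qed
  have Sp_basis: "Sp (const c * v q)" if "q \<in> {..D} \<times> B" for c q
  proof -
    have "(\<Sum>p\<in>{..D} \<times> B. const (if p = q then c else 0) * v p) = (\<Sum>p\<in>{..D} \<times> B. if p = q then const c * v q else 0)"
      by (rule sum.cong) auto
    also have "\<dots> = const c * v q" using that fin by simp
    finally show ?thesis
      unfolding Sp_def by (intro exI[of _ "\<lambda>p. if p = q then c else 0"]) (simp add: ideal.subspace_0[OF sub])
  qed
  \<comment> \<open>The invariant is e + i \<le> D: as long as the degree e exceeds \<rho>, a degree
    of f is traded for one more power of l.\<close>
  have hom: "Sp (l ^ i * f)" if "homogeneous (int e) f" "e + i \<le> D" for e i f
    using that
  proof (induction e arbitrary: i f)
    case 0
    from "0.prems"(1) show ?case
    proof (induction rule: mpoly_homogeneous_induct)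
      case zero
      then show ?case using Sp_I[OF ideal.subspace_0[OF sub]] by simp
    next
      case (add f g)
      from Sp_add[OF this] show ?case by (simp add: distrib_left)
    next
      case (monom u c)
      then show ?case using Sp_basis[of "(i, u)" c] "0.prems"(2)
        by (simp add: v_def B_def ac_simps)
    qed
  next
    case (Suc e)
    from Suc.prems(1) show ?case
    proof (induction rule: mpoly_homogeneous_induct)
      case zero
      then show ?case using Sp_I[OF ideal.subspace_0[OF sub]] by simp
    next
      case (add f g)
      from Sp_add[OF this] show ?case by (simp add: distrib_left)
    next
      case (monom u c)
      show ?case
      proof (cases "Suc e \<le> \<rho>")
        case True
        then show ?thesis using Sp_basis[of "(i, u)" c] Suc.prems(2) monom
          by (simp add: v_def B_def ac_simps)
      next
        case False
        have "homogeneous (int (Suc e)) (const c * monom u)"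
          using monom by (intro homogeneous_const_mult homogeneous_single)
        then obtain g h where gh: "g \<in> I" "homogeneous (int e) h" "const c * monom u = g + l * h"
          using regular_above_decomp[OF reg l, of "int (Suc e)" "const c * monom u"] False by auto
        have "Sp (l ^ Suc i * h)" using Suc.IH[OF gh(2), of "Suc i"] Suc.prems(2) by simp
        moreover have "Sp (l ^ i * g)" by (intro Sp_I ideal.subspace_scale[OF sub] gh(1))
        ultimately have "Sp (l ^ i * g + l ^ Suc i * h)" by (intro Sp_add)
        moreover have "l ^ i * (const c * monom u) = l ^ i * g + l ^ Suc i * h"
          unfolding gh(3) by (simp add: algebra_simps)
        ultimately show ?thesis by simp
      qed
    qed
  qed
  have sumSp: "Sp (\<Sum>u\<in>A. const (lookup f u) * monom u)" if "A \<subseteq> keys f" for A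
  proof -
    from that have "finite A" by (rule finite_subset) simp
    then show ?thesis using that
    proof (induction A)
      case empty
      show ?case using Sp_I[OF ideal.subspace_0[OF sub]] by simp
    next
      case (insert u A)
      have "homogeneous (int (monom_degree u)) (const (lookup f u) * monom u)"
        by (intro homogeneous_const_mult homogeneous_single refl)
      moreover have "monom_degree u \<le> D" using f insert.prems by (auto simp: degree_le_def)
      ultimately have "Sp (const (lookup f u) * monom u)"
        using hom[of "monom_degree u" _ 0] by simp
      with insert show ?case by (simp add: Sp_add)
    qed
  qed
  have "Sp f" using sumSp[OF order_refl] by (simp only: sum_monom)
  then show ?thesis by (simp add: Sp_def v_def)
qed

lemma const_sum: "const (sum f A) = (\<Sum>a\<in>A. const (f a))"
  by (induction A rule: infinite_finite_induct) (simp_all add: single_add)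

text \<open>The N^2 products l^i s^j have degree at most N (1 + \<delta>), and modulo I the
  polynomials of that degree span a space of dimension at most linear in N. For large N the products
  are dependent.\<close>

lemma algebraic_over_linear_form:
  fixes I :: "('n::{finite, linorder}, 'k::field) mpoly set"
  assumes reg: "regular_above l I \<rho>" and l: "homogeneous 1 l"
  shows "\<exists>N c. (\<exists>i<N. \<exists>j<N. c i j \<noteq> 0) \<and> (\<Sum>j<N. \<Sum>i<N. const (c i j) * l ^ i * s ^ j) \<in> I"
proof -
  have I: "homogeneous_ideal I" using reg by (simp add: regular_above_def)
  note sub = homogeneous_ideal_subspace[OF I]
  define B :: "('n \<Rightarrow>\<^sub>0 nat) set" where "B = {u. monom_degree u \<le> \<rho>}"
  have finB: "finite B" by (simp add: B_def finite_monomials_degree_le)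
  obtain \<delta> where \<delta>: "degree_le \<delta> s" using exists_degree_le by blast
  \<comment> \<open>Chosen so that N * N is the sum of N (1 + \<delta>) \<open>card B\<close> and N
    (\<open>card B\<close> + 1), which exceeds the number (N (1 + \<delta>) + 1)
    \<open>card B\<close> of spanning elements.\<close>
  define N where "N = (1 + \<delta>) * card B + card B + 1"
  define D where "D = N * (1 + \<delta>)"
  define v where "v p = l ^ fst p * (monom (snd p) :: ('n, 'k) mpoly)" for p
  let ?X = "{..<N} \<times> {..<N}" and ?T = "{..D} \<times> B"
  have "degree_le D (l ^ fst x * s ^ snd x)" if "x \<in> ?X" for x
  proof -
    have "degree_le 1 l" using l by (auto simp: degree_le_def homogeneous_def)
    then have "degree_le (fst x * 1 + snd x * \<delta>) (l ^ fst x * s ^ snd x)"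
      by (intro degree_le_mult degree_le_power \<delta>)
    moreover have "fst x * 1 + snd x * \<delta> \<le> N * 1 + N * \<delta>"
      using that by (intro add_mono mult_right_mono) auto
    ultimately show ?thesis by (auto simp: D_def algebra_simps intro: degree_le_mono)
  qed
  then have "\<forall>x\<in>?X. \<exists>a. l ^ fst x * s ^ snd x - (\<Sum>p\<in>?T. const (a p) * v p) \<in> I"
    using spanned_by_linear_powers[OF reg l] unfolding B_def v_def by blast
  from bchoice[OF this] obtain a where
    a: "\<forall>x\<in>?X. l ^ fst x * s ^ snd x - (\<Sum>p\<in>?T. const (a x p) * v p) \<in> I" ..
  have "card ?T < card ?X"
  proof -
    have "card ?T = (N * (1 + \<delta>) + 1) * card B" by (simp add: D_def card_cartesian_product)
    also have "\<dots> = N * ((1 + \<delta>) * card B) + card B" by (simp add: algebra_simps)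
    also have "\<dots> < N * ((1 + \<delta>) * card B) + N * (card B + 1)"
    proof -
      have "card B + 1 \<le> N * (card B + 1)" by (simp add: N_def)
      then show ?thesis by linarith
    qed
    also have "\<dots> = N * N" unfolding N_def by (simp add: algebra_simps)
    finally show ?thesis by (simp add: card_cartesian_product)
  qed
  then obtain c where c: "\<exists>x\<in>?X. c x \<noteq> 0" "\<forall>p\<in>?T. (\<Sum>x\<in>?X. c x * a x p) = 0"
    using underdetermined_system[of ?T ?X a] finB by auto
  have "(\<Sum>x\<in>?X. const (c x) * (\<Sum>p\<in>?T. const (a x p) * v p)) =
      (\<Sum>x\<in>?X. \<Sum>p\<in>?T. const (c x * a x p) * v p)"
    by (simp only: sum_distrib_left mult.assoc[symmetric] const_mult_const)
  also have "\<dots> = (\<Sum>p\<in>?T. \<Sum>x\<in>?X. const (c x * a x p) * v p)"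
    by (rule sum.swap)
  also have "\<dots> = (\<Sum>p\<in>?T. const (\<Sum>x\<in>?X. c x * a x p) * v p)"
  proof (rule sum.cong[OF refl])
    fix p
    show "(\<Sum>x\<in>?X. const (c x * a x p) * v p) =
        const (\<Sum>x\<in>?X. c x * a x p) * v p"
      by (simp only: const_sum sum_distrib_right)
  qed
  also have "\<dots> = 0" using c(2) by (intro sum.neutral) simp
  finally have zero: "(\<Sum>x\<in>?X. const (c x) * (\<Sum>p\<in>?T. const (a x p) * v p)) = 0" .
  have "(\<Sum>x\<in>?X. const (c x) * (l ^ fst x * s ^ snd x - (\<Sum>p\<in>?T. const (a x p) * v p))) \<in> I"
    using a by (intro ideal.subspace_sum[OF sub] ideal.subspace_scale[OF sub]) blast
  then have "(\<Sum>x\<in>?X. const (c x) * (l ^ fst x * s ^ snd x)) \<in> I"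
    by (simp only: right_diff_distrib sum_subtractf zero diff_0_right)
  also have "(\<Sum>x\<in>?X. const (c x) * (l ^ fst x * s ^ snd x)) = (\<Sum>i<N. \<Sum>j<N. const (c (i, j)) * l ^ i * s ^ j)"
    by (simp add: sum.cartesian_product case_prod_unfold mult.assoc)
  also have "\<dots> = (\<Sum>j<N. \<Sum>i<N. const (c (i, j)) * l ^ i * s ^ j)"
    by (rule sum.swap)
  finally have "(\<Sum>j<N. \<Sum>i<N. const (c (i, j)) * l ^ i * s ^ j) \<in> I" .
  moreover have "\<exists>i<N. \<exists>j<N. c (i, j) \<noteq> 0" using c(1) by auto
  ultimately show ?thesis by (intro exI[of _ N] exI[of _ "\<lambda>i j. c (i, j)"]) simp
qed

lemma sum_power_split:
  fixes s :: "'a::comm_ring_1"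
  assumes "j0 < N" "\<And>j. j < j0 \<Longrightarrow> g j = 0"
  shows "\<exists>h. (\<Sum>j<N. g j * s ^ j) = s ^ j0 * (g j0 + s * h)"
proof -
  have "(\<Sum>j<N. g j * s ^ j) = (\<Sum>j\<in>{j0..<N}. g j * s ^ j)"
    using assms(2) by (intro sum.mono_neutral_right) (auto simp: not_le)
  also have "\<dots> = g j0 * s ^ j0 + (\<Sum>j\<in>{Suc j0..<N}. g j * s ^ j)"
    using assms(1) by (rule sum.atLeast_Suc_lessThan)
  also have "(\<Sum>j\<in>{Suc j0..<N}. g j * s ^ j) = (\<Sum>j\<in>{Suc j0..<N}. s ^ j0 * (s * (g j * s ^ (j - Suc j0))))"
  proof (rule sum.cong[OF refl])
    fix j assume "j \<in> {Suc j0..<N}"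
    then have "s ^ j = s ^ j0 * (s * s ^ (j - Suc j0))"
      by (simp flip: power_Suc power_add)
    then show "g j * s ^ j = s ^ j0 * (s * (g j * s ^ (j - Suc j0)))" by (simp add: ac_simps)
  qed
  finally have "(\<Sum>j<N. g j * s ^ j) = s ^ j0 * (g j0 + s * (\<Sum>j\<in>{Suc j0..<N}. g j * s ^ (j - Suc j0)))"
    by (simp add: sum_distrib_left algebra_simps)
  then show ?thesis ..
qed

lemma lookup_power_zero:
  fixes f :: "('n::finite, 'k::comm_ring_1) mpoly"
  shows "lookup (f ^ e) 0 = lookup f 0 ^ e"
  by (induction e) (simp_all add: lookup_mult_zero)

text \<open>A nonzero polynomial in \<open>l\<close> lies in \<open>I + (s)\<close>; up to a power of \<open>l\<close> it has nonzero constant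
  term and can be cancelled modulo homogeneous ideals.\<close>
lemma linear_power_mult_mem:
  fixes I :: "('n::{finite, linorder}, 'k::field) mpoly set"
  assumes reg: "regular_above l I \<rho>" and l: "homogeneous 1 l"
    and s: "\<And>f. s * f \<in> I \<Longrightarrow> f \<in> I"
    and f: "s * f \<in> ideal_power I m"
  shows "\<exists>e. l ^ e * f \<in> ideal_power I m"
proof -
  have I: "homogeneous_ideal I" using reg by (simp add: regular_above_def)
  note sub = homogeneous_ideal_subspace[OF I]
  obtain N c where c: "\<exists>i<N. \<exists>j<N. c i j \<noteq> 0" and cI: "(\<Sum>j<N. \<Sum>i<N. const (c i j) * l ^ i * s ^ j) \<in> I"
    using algebraic_over_linear_form[OF reg l] by blast
  define g where "g j = (\<Sum>i<N. const (c i j) * l ^ i)" for j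
  \<comment> \<open>The lowest power of s whose coefficient, a polynomial in l, is not formally
    zero. Cancelling s^j0 modulo I leaves \<open>g j0\<close> congruent to a multiple of s.\<close>
  define j0 where "j0 = (LEAST j. j < N \<and> (\<exists>i<N. c i j \<noteq> 0))"
  have "\<exists>j. j < N \<and> (\<exists>i<N. c i j \<noteq> 0)" using c by blast
  from LeastI_ex[OF this] have j0: "j0 < N" "\<exists>i<N. c i j0 \<noteq> 0" by (auto simp: j0_def)
  have "g j = 0" if "j < j0" for j
    using not_less_Least[of j "\<lambda>j. j < N \<and> (\<exists>i<N. c i j \<noteq> 0)"] that j0(1)
    by (auto simp: g_def j0_def[symmetric] intro!: sum.neutral)
  from sum_power_split[of j0 N g s, OF j0(1) this] obtain h where
    "(\<Sum>j<N. g j * s ^ j) = s ^ j0 * (g j0 + s * h)" by blast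
  then have "s ^ j0 * (g j0 + s * h) \<in> I" using cI by (simp add: g_def sum_distrib_right)
  moreover have "s ^ k * w \<in> I \<Longrightarrow> w \<in> I" for k w
  proof (induction k)
    case (Suc k)
    then show ?case using s[of "s ^ k * w"] by (simp add: mult.assoc)
  qed simp
  ultimately have "g j0 + s * h \<in> I" by blast
  then have gs: "g j0 - s * (- h) \<in> I" by simp
  \<comment> \<open>The lowest power of l in \<open>g j0\<close>; the cofactor u then has a nonzero
    constant term, because l has none.\<close>
  define i0 where "i0 = (LEAST i. i < N \<and> c i j0 \<noteq> 0)"
  have "\<exists>i. i < N \<and> c i j0 \<noteq> 0" using j0(2) by blast
  from LeastI_ex[OF this] have i0: "i0 < N" "c i0 j0 \<noteq> 0" by (auto simp: i0_def)
  have "const (c i j0) = 0" if "i < i0" for i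
    using not_less_Least[of i "\<lambda>i. i < N \<and> c i j0 \<noteq> 0"] that i0(1) by (auto simp: i0_def[symmetric])
  from sum_power_split[of i0 N "\<lambda>i. const (c i j0)" l, OF i0(1) this] obtain h' where
    gl: "g j0 = l ^ i0 * (const (c i0 j0) + l * h')" unfolding g_def by blast
  define u where "u = const (c i0 j0) + l * h'"
  have "lookup u 0 = c i0 j0"
    using lookup_homogeneous_zero[OF l] by (simp add: u_def lookup_add lookup_mult_zero)
  then have u: "lookup (u ^ m) 0 \<noteq> 0" using i0(2) by (simp add: lookup_power_zero)
  \<comment> \<open>The m-th power lifts the congruence from I to I^m, and after multiplication by f
    the multiple of s is absorbed by s f in I^m.\<close>
  obtain k where k: "g j0 ^ m - s * k \<in> ideal_power I m"
    using power_mem_ideal_power_plus[OF sub gs] by blast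
  note subm = ideal_power_subspace[of I m]
  have "(g j0 ^ m - s * k) * f + k * (s * f) \<in> ideal_power I m"
    by (intro ideal.subspace_add[OF subm] subspace_mult_right[OF subm k] ideal.subspace_scale[OF subm f])
  moreover have "(g j0 ^ m - s * k) * f + k * (s * f) = g j0 ^ m * f"
    by (simp add: algebra_simps)
  moreover have "g j0 ^ m = u ^ m * l ^ (i0 * m)"
    by (simp add: gl flip: u_def) (simp add: power_mult_distrib power_mult mult.commute)
  ultimately have "u ^ m * (l ^ (i0 * m) * f) \<in> ideal_power I m" by (simp add: mult.assoc)
  then have "l ^ (i0 * m) * f \<in> ideal_power I m"
    by (rule unit_cancel[OF homogeneous_ideal_power[OF I] u])
  then show ?thesis ..
qed

section \<open>From denominators back to degrees\<close>

lemma regular_above_cancel_power: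
  assumes reg: "regular_above l I \<rho>" and l: "homogeneous 1 l"
    and f: "homogeneous d f" "d \<ge> int \<rho>" "l ^ e * f \<in> I"
  shows "f \<in> I"
  using f
proof (induction e arbitrary: d f)
  case (Suc e)
  have "homogeneous (1 + d) (l * f)" by (rule homogeneous_mult[OF l Suc.prems(1)])
  then have "l * f \<in> I"
    using Suc.IH[of "1 + d" "l * f"] Suc.prems(2,3) by (simp add: ac_simps)
  then show ?case by (rule regular_above_cancel[OF reg Suc.prems(1,2)])
qed simp

lemma alpha_le: "f \<in> J \<Longrightarrow> f \<noteq> 0 \<Longrightarrow> homogeneous (int t) f \<Longrightarrow> alpha J \<le> t"
  unfolding alpha_def by (rule Least_le) blast

theorem corollary2p3p5:
  fixes I :: "('n::{finite, linorder}, 'k::alg_closed_field) mpoly set" and c :: real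
  assumes "CARD('n) \<ge> 2"
    and "homogeneous_ideal I"
    and "defines_zero_dim_subscheme I"
    and "c > 0"
    and "\<forall>m::nat. m \<ge> 1 \<longrightarrow> real m * c \<le> real (alpha (symbolic_power I m))"
  shows "(\<forall>m r::nat. m \<ge> 1 \<longrightarrow> r \<ge> 1 \<longrightarrow> real m / real r \<ge> real_of_int (regularity I) / c \<longrightarrow>
            symbolic_power I m \<subseteq> ideal_power I r) \<and>
         resurgence I \<le> ereal (real_of_int (regularity I) / c)"
proof -
  note I = assms(2)
  note sub = homogeneous_ideal_subspace[OF I]
  have nU: "I \<noteq> UNIV"
  proof -
    obtain P where "P \<in> proj_points" "I \<subseteq> P"
      using assms(3) by (auto simp: defines_zero_dim_subscheme_def topspace_subscheme_space)
    then show ?thesis by (auto simp: proj_points_def prime_ideal_def)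
  qed
  obtain l T where l: "homogeneous 1 l" "l \<noteq> 0"
    and T: "\<forall>d f. homogeneous d f \<longrightarrow> d \<ge> T \<longrightarrow> f \<in> ideal.span (insert l I)"
    using zero_dim_linear_form[OF I assms(3)] by blast
  have T': "f \<in> ideal.span (insert l I)" if "homogeneous d f" "d \<ge> T" for d f
    using T that by blast
  note regularity = regularity_linear_form[OF I nU zero_dim_nonzero[OF assms(1-3)] l]
  have reg: "regularity I \<ge> 1" by (rule regularity(1)) (rule T')
  have reg2: "f \<in> ideal.span (insert l I)" if "homogeneous d f" "d \<ge> regularity I" for d f
    by (rule regularity(2)[OF _ that]) (rule T')
  have reg3: "f \<in> I" if "homogeneous d f" "d \<ge> regularity I" "l * f \<in> I" for d f
    by (rule regularity(3)[OF _ that]) (rule T')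
  define \<rho> where "\<rho> = nat (regularity I)"
  have \<rho>: "regularity I = int \<rho>" "\<rho> \<ge> 1" using reg by (simp_all add: \<rho>_def)
  have regular: "regular_above l I \<rho>"
    unfolding regular_above_def \<rho>(1)[symmetric] using I reg2 reg3 by blast
  note symb = mem_symbolic_power_iff[OF sub nU]
  note A = associated_primes_complement[where I = I]
  \<comment> \<open>Modulo l the power x_i^\<rho> agrees with a form of I of degree \<rho>, which is
    nonzero since x_i^\<rho> is no multiple of l. This bounds \<open>alpha\<close> of the first
    symbolic power by \<rho>.\<close>
  have "c \<le> real \<rho>"
  proof -
    obtain i where i: "\<forall>t. var i ^ t \<notin> ideal.span {l}"
      using var_power_notin_linear[OF assms(1) l] by blast
    have "homogeneous (int \<rho>) (var i ^ \<rho> :: ('n, 'k) mpoly)"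
      using homogeneous_power[OF homogeneous_var, of \<rho> i] by simp
    from regular_above_decomp[OF regular l(1) this order_refl] obtain g h
      where gh: "g \<in> I" "homogeneous (int \<rho>) g" "var i ^ \<rho> = g + l * h" by blast
    have "g \<noteq> 0"
    proof
      assume "g = 0"
      then have "var i ^ \<rho> = h * l" using gh(3) by (simp add: mult.commute)
      then have "var i ^ \<rho> \<in> ideal.span {l}" by (simp add: ideal.span_scale ideal.span_base)
      with i show False by blast
    qed
    moreover have "g \<in> symbolic_power I 1"
      unfolding symb using A(1) gh(1) by (intro exI[of _ 1]) (simp add: ideal_mult_UNIV[OF sub])
    ultimately have "alpha (symbolic_power I 1) \<le> \<rho>" using gh(2) by (intro alpha_le)
    then show ?thesis using assms(5)[rule_format, of 1] by simp
  qed
  have main: "symbolic_power I m \<subseteq> ideal_power I r"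
    if m: "m \<ge> 1" and r: "r \<ge> 1" and mr: "real m / real r \<ge> real_of_int (regularity I) / c" for m r :: nat
  proof
    fix f assume "f \<in> symbolic_power I m"
    then obtain s where s: "s \<notin> \<Union>(associated_primes I)" "s * f \<in> ideal_power I m"
      unfolding symb by blast
    have mc: "real (r * \<rho>) \<le> real m * c"
      using mr r assms(4) by (simp add: \<rho>(1) field_simps)
    have "real r * c \<le> real r * real \<rho>" using \<open>c \<le> real \<rho>\<close> by (simp add: mult_left_mono)
    then have "real r * c \<le> real m * c" using mc by simp
    then have "r \<le> m" using assms(4) by simp
    then have le: "ideal_power I m \<subseteq> ideal_power I r" by (rule ideal_power_antimono)
    show "f \<in> ideal_power I r"
    proof (cases "irrelevant_ideal \<in> associated_primes I")
      case True
      \<comment> \<open>A denominator outside the irrelevant ideal has a nonzero constant term and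
        can be cancelled modulo the homogeneous ideal I^m.\<close>
      with s(1) have "lookup s 0 \<noteq> 0" by (auto simp: irrelevant_ideal_eq)
      from unit_cancel[OF homogeneous_ideal_power[OF I] this s(2)] le show ?thesis by blast
    next
      case False
      have l_reg: "h \<in> I" if "l * h \<in> I" for h
        using linear_form_regular[OF regular l(1) False that] .
      \<comment> \<open>An associated prime containing l would be the annihilator of a class killed
        by l, hence of the zero class. So powers of l are admissible homogeneous denominators, and
        the components of f stay in I^(m).\<close>
      have lA: "l \<notin> \<Union>(associated_primes I)"
      proof
        assume "l \<in> \<Union>(associated_primes I)"
        then obtain P g where P: "prime_ideal P" "P = {h. h * g \<in> I}" "l \<in> P"
          unfolding associated_primes_def by blast
        then have "g \<in> I" using l_reg by simp
        then have "P = UNIV" using P(2) ideal.subspace_scale[OF sub] by auto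
        with P(1) show False by (simp add: prime_ideal_def)
      qed
      have l_pow: "l ^ e \<notin> \<Union>(associated_primes I)" for e
        using A(1) A(2)[of l] lA by (induction e) auto
      have "h \<in> I" if "s * h \<in> I" for h
        using A(4)[OF sub _ that] s(1) by simp
      from linear_power_mult_mem[OF regular l(1) this s(2)] obtain e
        where e: "l ^ e * f \<in> ideal_power I m" by blast
      show ?thesis
      proof (rule mem_if_hcomp_mem[OF ideal_power_subspace])
        fix d
        have "hcomp (d + int e) (l ^ e * f) \<in> ideal_power I m"
          by (rule homogeneous_ideal_hcomp[OF homogeneous_ideal_power[OF I] e])
        then have comp: "l ^ e * hcomp d f \<in> ideal_power I m"
          using homogeneous_power[OF l(1), of e] by (simp add: hcomp_mult_left)
        show "hcomp d f \<in> ideal_power I r"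
        proof (cases "hcomp d f = 0")
          case True
          then show ?thesis by (simp add: ideal.subspace_0)
        next
          case nz: False
          then have "d \<ge> 0" using homogeneous_neg[OF homogeneous_hcomp, of d f] by force
          then have d: "homogeneous (int (nat d)) (hcomp d f)" by simp
          have "hcomp d f \<in> symbolic_power I m" unfolding symb using l_pow comp by blast
          then have "alpha (symbolic_power I m) \<le> nat d" by (rule alpha_le[OF _ nz d])
          then have "real m * c \<le> real (nat d)" using assms(5) m by (meson of_nat_mono order_trans)
          \<comment> \<open>The lower bound m c on \<open>alpha\<close> and the assumption on m / r
            put the degree of the component above the threshold r \<rho> of I^r.\<close>
          then have "real (r * \<rho>) \<le> real (nat d)" using mc by linarith
          then have "int (r * \<rho>) \<le> int (nat d)" by linarith
          moreover have "l ^ e * hcomp d f \<in> ideal_power I r" using comp le by blast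
          ultimately show ?thesis
            using regular_above_cancel_power[OF regular_above_power[OF l regular] l(1) d] by blast
        qed
      qed
    qed
  qed
  moreover have "resurgence I \<le> ereal (real_of_int (regularity I) / c)"
    unfolding resurgence_def
  proof (rule Sup_least)
    fix x assume "x \<in> {ereal (real m / real r) | m r. m \<ge> 1 \<and> r \<ge> 1 \<and> \<not> symbolic_power I m \<subseteq> ideal_power I r}"
    then obtain m r where "x = ereal (real m / real r)" "m \<ge> 1" "r \<ge> 1" "\<not> symbolic_power I m \<subseteq> ideal_power I r"
      by blast
    then show "x \<le> ereal (real_of_int (regularity I) / c)"
      using main[of m r] by (cases "real m / real r \<ge> real_of_int (regularity I) / c") auto
  qed
  ultimately show ?thesis by blast
qed

end
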